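(* Let $(U_0,U_1,\dots,U_n)$ be a copula-based Markov chain generated by a copula with density $c(u,v)=1+\sum_{z=1}^{\infty}\lambda_z\varphi_z(u)\varphi_z(v)$ and the uniform marginal distribution on $(0,1)$. Fix $k\ge 1$ and suppose that $$\sum_{z=1}^\infty |\lambda_z|\Big(\int_0^1\varphi_z(x)\varphi_k^2(x)\,dx\Big)^2<\infty\quad\text{and}\quad \int_0^1\varphi_k^4(x)\,dx<\infty .$$ Then $$\hat\lambda_k=\frac1n\sum_{i=1}^n\varphi_k(U_i)\varphi_k(U_{i-1})$$ is an unbiased and consistent estimator of $\lambda_k$. Moreover, $\sqrt n(\hat\lambda_k-\lambda_k)\to N(0,\sigma^2)$ in distribution as $n\to\infty$, where the positive real number $\sigma^2$ is given by $$\sigma^2=1-\lambda_k^2+\sum_{z=1}^\infty\lambda_z\Big(\int_0^1\varphi_z(x)\varphi_k^2(x)\,dx\Big)^2+2\lambda_k^2\Big(\int_0^1\varphi_k^4(x)\,dx-1\Big)+2\sum_{m=2}^\infty\lambda_k^2\sum_{z=1}^\infty\lambda_z^{m-1}\Big(\int_0^1\varphi_z(x)\varphi_k^2(x)\,dx\Big)^2 .$$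
   Context: A copula is a bivariate cumulative distribution function with uniform marginals on $[0,1]$. Throughout, $\{1,\varphi_1,\varphi_2,\dots\}$ is an orthonormal basis of $L^2(0,1)$ (real functions), $(\lambda_z)_{z\ge1}$ is a real sequence such that $(|\lambda_z|)$ takes finitely many values or converges to $0$, and $c(u,v)=1+\sum_{z\ge1}\lambda_z\varphi_z(u)\varphi_z(v)$ is the density of a copula, the series converging pointwise and uniformly on $(0,1)^2$. (A sufficient condition for this is $1+\sum_k\lambda_k\alpha_k\ge0$, where $\alpha_k=\max\varphi_k^2$ if $\lambda_k<0$ and $\alpha_k=\min\varphi_k\max\varphi_k$ if $\lambda_k>0$.) A Markov chain generated by a copula $C$ with density $c$ and the uniform marginal distribution is a stationary Markov chain $(U_i)_{i\ge0}$ with each $U_i$ uniform on $(0,1)$ and with $C$ the joint distribution function of $(U_i,U_{i+1})$; equivalently its transition density is $c(u,\cdot)$.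
   Formalization: Consistency and the normal limit are proved assuming no λ_z equals 1 (otherwise the chain is not ergodic and they can fail); σ² ≥ 0 in general, with N(0,0) the point mass at 0, and σ² > 0 when c > 0 almost everywhere (σ² can be 0 otherwise). *)

theory Defs
  imports "HOL-Probability.Probability"
begin

subsection \<open>Copulas and their densities\<close>

definition uniform01 :: "real measure" where
  "uniform01 = uniform_measure lborel {0<..<1}"

definition copula :: "(real \<Rightarrow> real \<Rightarrow> real) \<Rightarrow> bool" where
  "copula C \<longleftrightarrow> (\<exists>\<mu> :: (real \<times> real) measure.
     prob_space \<mu> \<and> sets \<mu> = sets borel \<and>
     distr \<mu> borel fst = uniform01 \<and> distr \<mu> borel snd = uniform01 \<and>
     (\<forall>u v. C u v = measure \<mu> ({..u} \<times> {..v})))"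

text \<open>Only the values of \<open>c\<close> on the open unit square matter.\<close>

definition copula_density :: "(real \<Rightarrow> real \<Rightarrow> real) \<Rightarrow> (real \<Rightarrow> real \<Rightarrow> real) \<Rightarrow> bool" where
  "copula_density C c \<longleftrightarrow> copula C \<and>
     (AE p in lborel. p \<in> {0<..<1} \<times> {0<..<1} \<longrightarrow> 0 \<le> c (fst p) (snd p)) \<and>
     set_integrable lborel ({0<..<1} \<times> {0<..<1}) (\<lambda>p. c (fst p) (snd p)) \<and>
     (\<forall>u\<in>{0..1}. \<forall>v\<in>{0..1}.
        C u v = (LBINT p:{0<..<u} \<times> {0<..<v}. c (fst p) (snd p)))"

subsection \<open>Orthonormal bases and the series density\<close>

text \<open>Elements of \<open>L\<^sup>2(0,1)\<close> are represented by Borel functions on the real line, of which only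
  the restriction to \<open>(0,1)\<close> is used (a Borel function on \<open>(0,1)\<close> may be extended by \<open>0\<close>).\<close>

definition L2_01 :: "(real \<Rightarrow> real) \<Rightarrow> bool" where
  "L2_01 f \<longleftrightarrow> f \<in> borel_measurable borel \<and> set_integrable lborel {0<..<1} (\<lambda>x. (f x)\<^sup>2)"

text \<open>\<open>{1, \<phi> 1, \<phi> 2, \<dots>}\<close> is an orthonormal basis of \<open>L\<^sup>2(0,1)\<close>: an orthonormal system whose linear
  span is dense. The value \<open>\<phi> 0\<close> is never used; the constant function is treated separately.\<close>

definition onb_with_one :: "(nat \<Rightarrow> real \<Rightarrow> real) \<Rightarrow> bool" where
  "onb_with_one \<phi> \<longleftrightarrow>
     (\<forall>z\<ge>1. L2_01 (\<phi> z)) \<and>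
     (\<forall>z\<ge>1. (LBINT x:{0<..<1}. \<phi> z x) = 0) \<and>
     (\<forall>z\<ge>1. \<forall>w\<ge>1. (LBINT x:{0<..<1}. \<phi> z x * \<phi> w x) = (if z = w then 1 else 0)) \<and>
     (\<forall>f. L2_01 f \<longrightarrow> (\<forall>\<epsilon>>0. \<exists>N a.
        (LBINT x:{0<..<1}. (f x - (a 0 + (\<Sum>z=1..N. a z * \<phi> z x)))\<^sup>2) < \<epsilon>))"

text \<open>A series \<open>\<Sum>z\<ge>1. f z\<close> is written \<open>\<Sum>z. f (Suc z)\<close> throughout.\<close>

definition series_density :: "(nat \<Rightarrow> real) \<Rightarrow> (nat \<Rightarrow> real \<Rightarrow> real) \<Rightarrow> real \<Rightarrow> real \<Rightarrow> real" where
  "series_density lam \<phi> u v = 1 + (\<Sum>z. lam (Suc z) * \<phi> (Suc z) u * \<phi> (Suc z) v)"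

text \<open>Uniform convergence of the partial sums to \<open>series_density lam \<phi>\<close> includes pointwise
  convergence.\<close>

definition series_converges :: "(nat \<Rightarrow> real) \<Rightarrow> (nat \<Rightarrow> real \<Rightarrow> real) \<Rightarrow> bool" where
  "series_converges lam \<phi> \<longleftrightarrow>
     uniform_limit ({0<..<1} \<times> {0<..<1})
       (\<lambda>N p. 1 + (\<Sum>z=1..N. lam z * \<phi> z (fst p) * \<phi> z (snd p)))
       (\<lambda>p. series_density lam \<phi> (fst p) (snd p)) sequentially"

subsection \<open>Markov chains generated by a copula\<close>

definition past :: "'a measure \<Rightarrow> (nat \<Rightarrow> 'a \<Rightarrow> real) \<Rightarrow> nat \<Rightarrow> 'a measure" where
  "past M U n = sigma (space M) {U i -` B \<inter> space M | i B. i \<le> n \<and> B \<in> sets borel}"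

definition markov_chain :: "'a measure \<Rightarrow> (nat \<Rightarrow> 'a \<Rightarrow> real) \<Rightarrow> bool" where
  "markov_chain M U \<longleftrightarrow>
     (\<forall>i. U i \<in> borel_measurable M) \<and>
     (\<forall>n. \<forall>B\<in>sets borel. AE \<omega> in M.
        real_cond_exp M (past M U n) (indicator (U (Suc n) -` B \<inter> space M)) \<omega> =
        real_cond_exp M (vimage_algebra (space M) (U n) borel)
          (indicator (U (Suc n) -` B \<inter> space M)) \<omega>)"

text \<open>Stationarity is not listed separately: the Markov property together with identical laws of
  all the pairs \<open>(U i, U (i + 1))\<close> implies it.\<close>

definition copula_markov_chain ::
    "'a measure \<Rightarrow> (real \<Rightarrow> real \<Rightarrow> real) \<Rightarrow> (nat \<Rightarrow> 'a \<Rightarrow> real) \<Rightarrow> bool" where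
  "copula_markov_chain M C U \<longleftrightarrow>
     markov_chain M U \<and>
     (\<forall>i. distr M borel (U i) = uniform01) \<and>
     (\<forall>i u v. measure M {\<omega> \<in> space M. U i \<omega> \<le> u \<and> U (Suc i) \<omega> \<le> v} = C u v)"

subsection \<open>The estimator and its limit law\<close>

definition lambda_hat ::
    "(nat \<Rightarrow> real \<Rightarrow> real) \<Rightarrow> nat \<Rightarrow> (nat \<Rightarrow> 'a \<Rightarrow> real) \<Rightarrow> nat \<Rightarrow> 'a \<Rightarrow> real" where
  "lambda_hat \<phi> k U n \<omega> = (1 / real n) * (\<Sum>i=1..n. \<phi> k (U i \<omega>) * \<phi> k (U (i - 1) \<omega>))"

definition unbiased :: "'a measure \<Rightarrow> ('a \<Rightarrow> real) \<Rightarrow> real \<Rightarrow> bool" where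
  "unbiased M T \<theta> \<longleftrightarrow> integrable M T \<and> (\<integral>\<omega>. T \<omega> \<partial>M) = \<theta>"

definition consistent :: "'a measure \<Rightarrow> (nat \<Rightarrow> 'a \<Rightarrow> real) \<Rightarrow> real \<Rightarrow> bool" where
  "consistent M T \<theta> \<longleftrightarrow> (\<forall>n. T n \<in> borel_measurable M) \<and>
     (\<forall>\<epsilon>>0. (\<lambda>n. measure M {\<omega> \<in> space M. \<bar>T n \<omega> - \<theta>\<bar> \<ge> \<epsilon>}) \<longlonglongrightarrow> 0)"

text \<open>The normal law with mean \<open>0\<close> and variance \<open>s \<ge> 0\<close>. The case \<open>s = 0\<close> is the point mass at
  \<open>0\<close>, since \<open>normal_density\<close> with standard deviation \<open>0\<close> is not a probability density.\<close>

definition centered_normal :: "real \<Rightarrow> real measure" where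
  "centered_normal s =
     (if s = 0 then return borel 0 else density lborel (normal_density 0 (sqrt s)))"

definition basis_coef :: "(nat \<Rightarrow> real \<Rightarrow> real) \<Rightarrow> nat \<Rightarrow> nat \<Rightarrow> real" where
  "basis_coef \<phi> k z = (LBINT x:{0<..<1}. \<phi> z x * (\<phi> k x)\<^sup>2)"

text \<open>The outer index of the last series is shifted: the series over \<open>m \<ge> 2\<close> with exponent
  \<open>m - 1\<close> becomes one over \<open>m \<ge> 0\<close> with exponent \<open>m + 1\<close>.\<close>

definition asymptotic_variance ::
    "(nat \<Rightarrow> real) \<Rightarrow> (nat \<Rightarrow> real \<Rightarrow> real) \<Rightarrow> nat \<Rightarrow> real" where
  "asymptotic_variance lam \<phi> k =
     1 - (lam k)\<^sup>2
     + (\<Sum>z. lam (Suc z) * (basis_coef \<phi> k (Suc z))\<^sup>2)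
     + 2 * (lam k)\<^sup>2 * ((LBINT x:{0<..<1}. (\<phi> k x) ^ 4) - 1)
     + 2 * (\<Sum>m. (lam k)\<^sup>2 * (\<Sum>z. lam (Suc z) ^ (m + 1) * (basis_coef \<phi> k (Suc z))\<^sup>2))"

text \<open>All series in \<open>asymptotic_variance\<close> converge (\<open>suminf\<close> is unspecified otherwise); the case
  \<open>m = 0\<close> of the second conjunct is the single series of the formula.\<close>

definition asymptotic_variance_converges ::
    "(nat \<Rightarrow> real) \<Rightarrow> (nat \<Rightarrow> real \<Rightarrow> real) \<Rightarrow> nat \<Rightarrow> bool" where
  "asymptotic_variance_converges lam \<phi> k \<longleftrightarrow>
     (\<forall>z\<ge>1. set_integrable lborel {0<..<1} (\<lambda>x. \<phi> z x * (\<phi> k x)\<^sup>2)) \<and>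
     (\<forall>m. summable (\<lambda>z. lam (Suc z) ^ (m + 1) * (basis_coef \<phi> k (Suc z))\<^sup>2)) \<and>
     summable (\<lambda>m. (lam k)\<^sup>2 * (\<Sum>z. lam (Suc z) ^ (m + 1) * (basis_coef \<phi> k (Suc z))\<^sup>2))"

end

theory Submission
  imports Defs
begin

text \<open>
  Write \<open>\<alpha> = lam k\<close>, let \<open>T\<close> be the transition operator \<open>T f u = \<integral> f v * c u v dv\<close> of the chain and put
  \<open>g = (\<phi> k)\<^sup>2\<close>. Integrating the uniformly convergent series of \<open>c\<close> term by term shows that each basis
  function is an eigenfunction, \<open>T (\<phi> z) = lam z * \<phi> z\<close>. In particular the products
  \<open>\<phi> k (U i) * \<phi> k (U (i + 1))\<close> have mean \<open>\<alpha>\<close>, which is unbiasedness, and \<open>\<bar>lam z\<bar> \<le> 1\<close>.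

  The fluctuations are treated by a martingale approximation. Given the past, the \<open>i\<close>-th product has mean
  \<open>\<alpha> * g (U i)\<close>, so subtracting it leaves a martingale difference plus the additive functional
  \<open>\<alpha> * (g - 1)\<close> of the chain. If \<open>g - 1 = h - T h\<close> (the Poisson equation), this functional is itself a
  martingale plus the boundary term \<open>h (U 0) - h (U n)\<close>. On finite combinations of basis functions
  the Poisson equation is solved by dividing the coefficients by \<open>1 - lam z\<close>; as no \<open>lam z\<close>
  equals \<open>1\<close> and the \<open>\<bar>lam z\<bar>\<close> take finitely many values or converge to \<open>0\<close>, these
  divisors are bounded away from \<open>0\<close>. Solving for the \<open>N\<close>-th Fourier partial sum \<open>1 + comb b N\<close> of \<open>g\<close> gives
  martingale differences \<open>D N i\<close> with variance \<open>V N\<close>. What is left over is the additive functional of the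
  remainder \<open>g - 1 - comb b N\<close>, and the same construction bounds the variance of such a functional by a
  constant times \<open>n\<close> times the squared norm of the remainder (\<open>variance_sum_bound\<close>). This is small uniformly in
  \<open>n\<close> after normalisation, since the Fourier series converges in mean square, so no limit in
  \<open>L\<^sup>2\<close> of the solutions of the Poisson equation has to be taken.

  For fixed \<open>N\<close> the normalised sums of \<open>D N i\<close> converge to a normal law by \<open>martingale_clt\<close>. Its usual
  hypothesis, a law of large numbers for conditional variances, is replaced by another use of
  the Poisson equation: the conditional variance is a function of \<open>U i\<close> that differs from its mean \<open>V N\<close>
  by a coboundary \<open>h - T h\<close>, up to a small error in \<open>L\<^sup>1\<close>, and a coboundary can be absorbed into
  the characteristic function by a correction of order \<open>1 / n\<close>. Consistency follows from the
  variance bound by the Markov inequality.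

  Computing \<open>V N\<close> in terms of Fourier coefficients (\<open>V_eq\<close>) and letting \<open>N\<close> grow yields the series
  of the theorem (\<open>V_tendsto\<close>). The geometric series in \<open>lam z\<close> needs \<open>\<bar>lam z\<bar> < 1\<close>. An eigenvalue
  \<open>lam z = -1\<close> makes \<open>\<phi> z\<close> change sign at each step, and reversibility then forces
  \<open>\<alpha> * b z = 0\<close> (\<open>lam_minus_1\<close>), so such terms do not contribute.

  If the density is positive almost everywhere and the variance were \<open>0\<close>, then \<open>d N\<close> would tend to \<open>0\<close>
  almost everywhere along a subsequence. Thus \<open>\<phi> k u * \<phi> k v\<close> would be a limit of sums of a function of \<open>u\<close> and
  a function of \<open>v\<close>, and this is only possible if \<open>\<phi> k\<close> is constant.
\<close>

section \<open>Square-integrable functions\<close>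

lemma abs_mult_le_sum_power2: "\<bar>x * y\<bar> \<le> x\<^sup>2 + y\<^sup>2" for x y :: real
proof -
  have "2 * (\<bar>x\<bar> * \<bar>y\<bar>) \<le> x\<^sup>2 + y\<^sup>2"
    using sum_squares_bound[of "\<bar>x\<bar>" "\<bar>y\<bar>"] by (simp add: mult.assoc)
  moreover have "0 \<le> \<bar>x\<bar> * \<bar>y\<bar>" by (intro mult_nonneg_nonneg) auto
  ultimately show ?thesis unfolding abs_mult by linarith
qed

definition square_integrable :: "'a measure \<Rightarrow> ('a \<Rightarrow> real) \<Rightarrow> bool" where
  "square_integrable M f \<longleftrightarrow> f \<in> borel_measurable M \<and> integrable M (\<lambda>x. (f x)\<^sup>2)"

lemma square_integrable_measurable [measurable_dest]:
  "square_integrable M f \<Longrightarrow> f \<in> borel_measurable M"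
  by (simp add: square_integrable_def)

lemma square_integrable_power2: "square_integrable M f \<Longrightarrow> integrable M (\<lambda>x. (f x)\<^sup>2)"
  by (simp add: square_integrable_def)

lemma square_integrable_mult:
  assumes "square_integrable M f" "square_integrable M g"
  shows "integrable M (\<lambda>x. f x * g x)"
proof (rule Bochner_Integration.integrable_bound)
  show "integrable M (\<lambda>x. (f x)\<^sup>2 + (g x)\<^sup>2)"
    using assms by (simp add: square_integrable_def)
  show "(\<lambda>x. f x * g x) \<in> borel_measurable M"
    using assms by (intro borel_measurable_times) (simp_all add: square_integrable_def)
  have "\<bar>f x * g x\<bar> \<le> (f x)\<^sup>2 + (g x)\<^sup>2" for x
    using sum_squares_bound[of "\<bar>f x\<bar>" "\<bar>g x\<bar>"] mult_nonneg_nonneg[of "\<bar>f x\<bar>" "\<bar>g x\<bar>"]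
    by (simp add: abs_mult del: mult_nonneg_nonneg zero_le_mult_iff)
  then show "AE x in M. norm (f x * g x) \<le> norm ((f x)\<^sup>2 + (g x)\<^sup>2)"
    by auto
qed

lemma square_integrable_add [intro]:
  assumes "square_integrable M f" "square_integrable M g"
  shows "square_integrable M (\<lambda>x. f x + g x)"
  using assms square_integrable_mult[OF assms]
  by (simp add: square_integrable_def power2_sum mult.assoc borel_measurable_add)

lemma square_integrable_cmult [intro]:
  "square_integrable M f \<Longrightarrow> square_integrable M (\<lambda>x. a * f x)"
  by (simp add: square_integrable_def power_mult_distrib borel_measurable_times)

lemma square_integrable_diff [intro]:
  assumes "square_integrable M f" "square_integrable M g"
  shows "square_integrable M (\<lambda>x. f x - g x)"
  using square_integrable_add[OF assms(1) square_integrable_cmult[OF assms(2), of "-1"]] by simp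

lemma square_integrable_zero: "square_integrable M (\<lambda>x. 0)"
  by (simp add: square_integrable_def)

lemma square_integrable_sum [intro]:
  "(\<And>i. i \<in> I \<Longrightarrow> square_integrable M (f i)) \<Longrightarrow> square_integrable M (\<lambda>x. \<Sum>i\<in>I. f i x)"
proof (induction I rule: infinite_finite_induct)
  case (insert i F)
  then show ?case by (simp add: square_integrable_add)
qed (simp_all add: square_integrable_zero)

lemma (in finite_measure) square_integrable_const [intro]: "square_integrable M (\<lambda>x. c)"
  by (simp add: square_integrable_def)

lemma (in finite_measure) square_integrable_bounded:
  assumes "f \<in> borel_measurable M" "\<And>x. \<bar>f x\<bar> \<le> B"
  shows "square_integrable M f"
  unfolding square_integrable_def
proof
  have "(f x)\<^sup>2 \<le> B\<^sup>2" for x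
    using assms(2)[of x] by (intro abs_le_square_iff[THEN iffD1]) auto
  then show "integrable M (\<lambda>x. (f x)\<^sup>2)"
    using assms(1) by (intro integrable_const_bound[of _ "B\<^sup>2"]) auto
qed (rule assms)

lemma (in finite_measure) square_integrable_integrable:
  "square_integrable M f \<Longrightarrow> integrable M f"
  using square_integrable_mult[of M f "\<lambda>x. 1"] square_integrable_const by simp

lemma (in prob_space) integral_abs_le_sqrt_integral_power2:
  assumes f: "square_integrable M f"
  shows "(\<integral>x. \<bar>f x\<bar> \<partial>M) \<le> sqrt (\<integral>x. (f x)\<^sup>2 \<partial>M)"
proof (rule real_le_rsqrt)
  have i: "integrable M (\<lambda>x. \<bar>f x\<bar>)" "integrable M (\<lambda>x. \<bar>f x\<bar>\<^sup>2)"
    using square_integrable_integrable[OF f] f by (auto simp: square_integrable_def)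
  show "(\<integral>x. \<bar>f x\<bar> \<partial>M)\<^sup>2 \<le> (\<integral>x. (f x)\<^sup>2 \<partial>M)"
    using variance_eq[OF i] variance_positive[of "\<lambda>x. \<bar>f x\<bar>"] by simp
qed

lemma integral_power2_add_le:
  assumes "square_integrable M f" "square_integrable M g"
  shows "(\<integral>x. (f x + g x)\<^sup>2 \<partial>M) \<le> 2 * (\<integral>x. (f x)\<^sup>2 \<partial>M) + 2 * (\<integral>x. (g x)\<^sup>2 \<partial>M)"
proof -
  have "(\<integral>x. (f x + g x)\<^sup>2 \<partial>M) \<le> (\<integral>x. 2 * (f x)\<^sup>2 + 2 * (g x)\<^sup>2 \<partial>M)"
  proof (rule integral_mono)
    show "integrable M (\<lambda>x. (f x + g x)\<^sup>2)"
      using square_integrable_add[OF assms] by (rule square_integrable_power2)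
    show "(f x + g x)\<^sup>2 \<le> 2 * (f x)\<^sup>2 + 2 * (g x)\<^sup>2" for x
      using sum_squares_bound[of "f x" "g x"] by (simp add: power2_sum)
  qed (use assms in \<open>simp add: square_integrable_def\<close>)
  also have "\<dots> = 2 * (\<integral>x. (f x)\<^sup>2 \<partial>M) + 2 * (\<integral>x. (g x)\<^sup>2 \<partial>M)"
    using assms by (simp add: square_integrable_def)
  finally show ?thesis .
qed

text \<open>Pythagoras. Orthogonality is only asked of each term against the sum of the preceding ones, which is
  what the Markov property provides.\<close>

lemma integral_power2_orthogonal_sum:
  fixes X :: "nat \<Rightarrow> 'a \<Rightarrow> real"
  assumes sq: "\<And>i. square_integrable M (X i)"
    and orth: "\<And>n. (\<integral>x. (\<Sum>i<n. X i x) * X n x \<partial>M) = 0"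
  shows "(\<integral>x. (\<Sum>i<n. X i x)\<^sup>2 \<partial>M) = (\<Sum>i<n. \<integral>x. (X i x)\<^sup>2 \<partial>M)"
proof (induction n)
  case (Suc n)
  have s: "square_integrable M (\<lambda>x. \<Sum>i<n. X i x)"
    using sq by auto
  have "(\<integral>x. (\<Sum>i<Suc n. X i x)\<^sup>2 \<partial>M) =
      (\<integral>x. (\<Sum>i<n. X i x)\<^sup>2 + (X n x)\<^sup>2 + 2 * ((\<Sum>i<n. X i x) * X n x) \<partial>M)"
    by (simp add: power2_sum mult.assoc)
  also have "\<dots> = (\<integral>x. (\<Sum>i<n. X i x)\<^sup>2 \<partial>M) + (\<integral>x. (X n x)\<^sup>2 \<partial>M)
      + 2 * (\<integral>x. (\<Sum>i<n. X i x) * X n x \<partial>M)"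
    using square_integrable_power2[OF s] square_integrable_power2[OF sq[of n]]
      square_integrable_mult[OF s sq[of n]] by simp
  finally show ?case using Suc orth by simp
qed simp

lemma norm_integral_le:
  fixes f :: "'a \<Rightarrow> 'b::{banach, second_countable_topology}" and g :: "'a \<Rightarrow> real"
  assumes "integrable M f" "integrable M g" "\<And>x. norm (f x) \<le> g x"
  shows "norm (\<integral>x. f x \<partial>M) \<le> (\<integral>x. g x \<partial>M)"
  by (rule order_trans[OF integral_norm_bound integral_mono]) (use assms in auto)

lemma integrable_complex_mult_real:
  fixes W :: "'a \<Rightarrow> complex"
  assumes W[measurable]: "W \<in> borel_measurable M" and W2: "square_integrable M (\<lambda>x. cmod (W x))"
    and X: "square_integrable M X"
  shows "integrable M (\<lambda>x. W x * complex_of_real (X x))"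
proof (rule Bochner_Integration.integrable_bound[OF square_integrable_mult[OF W2 X]])
  note [measurable] = square_integrable_measurable[OF X]
  show "(\<lambda>x. W x * complex_of_real (X x)) \<in> borel_measurable M" by measurable
qed (simp add: norm_mult)

section \<open>Limits, uniform convergence under the integral, and truncation\<close>

text \<open>A device for exchanging two limits: for each precision the error is bounded by a sequence whose limit is
  smaller than that precision, and the sequence may come from an approximation chosen for it.\<close>

lemma tendsto_by_approximation:
  fixes x :: "nat \<Rightarrow> 'a::real_normed_vector"
  assumes "\<And>e::real. e > 0 \<Longrightarrow>
    \<exists>b \<beta>. (\<forall>\<^sub>F n in sequentially. norm (x n - l) \<le> b n) \<and> b \<longlonglongrightarrow> \<beta> \<and> \<beta> < e"
  shows "x \<longlonglongrightarrow> l"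
proof (rule tendstoI)
  fix e :: real assume "e > 0"
  from assms[OF this] obtain b \<beta> where
    b: "\<forall>\<^sub>F n in sequentially. norm (x n - l) \<le> b n" "b \<longlonglongrightarrow> \<beta>" "\<beta> < e" by blast
  have "\<forall>\<^sub>F n in sequentially. b n < e"
    using order_tendstoD(2)[OF b(2,3)] .
  with b(1) show "\<forall>\<^sub>F n in sequentially. dist (x n) l < e"
    by eventually_elim (simp add: dist_norm)
qed

lemma norm_recursion_bound:
  fixes A :: "nat \<Rightarrow> 'a::real_normed_algebra_1"
  assumes step: "\<And>n. norm (A (Suc n) - q * A n) \<le> \<delta>" and q: "norm q \<le> 1"
  shows "norm (A n - q ^ n * A 0) \<le> real n * \<delta>"
proof (induction n)
  case (Suc n)
  have "A (Suc n) - q ^ Suc n * A 0 = (A (Suc n) - q * A n) + q * (A n - q ^ n * A 0)"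
    by (simp add: algebra_simps)
  also have "norm \<dots> \<le> \<delta> + norm q * norm (A n - q ^ n * A 0)"
    by (intro norm_triangle_le add_mono step norm_mult_ineq)
  also have "\<dots> \<le> \<delta> + 1 * (real n * \<delta>)"
    using q Suc by (intro add_left_mono mult_mono) auto
  finally show ?case by (simp add: algebra_simps)
qed simp

text \<open>The error in the integrals is at most \<open>\<integral> \<bar>f\<bar>\<close> times the uniform distance between \<open>S n\<close> and \<open>s\<close>.
  The parameter \<open>u\<close> gives uniformity of the result, so that the lemma can be applied once more to the limit
  function; a one-point parameter set yields plain convergence of integrals.\<close>

lemma integral_mult_uniform_limit:
  fixes f :: "'a \<Rightarrow> real" and s :: "'b \<Rightarrow> 'a \<Rightarrow> real"
  assumes lim: "uniform_limit (B \<times> A) (\<lambda>n p. S n (fst p) (snd p)) (\<lambda>p. s (fst p) (snd p)) sequentially"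
    and ae: "AE x in M. x \<in> A"
    and f: "integrable M f" and fS: "\<And>n u. u \<in> B \<Longrightarrow> integrable M (\<lambda>x. f x * S n u x)"
    and s: "\<And>u. u \<in> B \<Longrightarrow> s u \<in> borel_measurable M"
  shows "\<And>u. u \<in> B \<Longrightarrow> integrable M (\<lambda>x. f x * s u x)"
    and "uniform_limit B (\<lambda>n u. \<integral>x. f x * S n u x \<partial>M) (\<lambda>u. \<integral>x. f x * s u x \<partial>M) sequentially" (is ?lim)
proof -
  have close: "\<forall>\<^sub>F n in sequentially. \<forall>u\<in>B. \<forall>x\<in>A. \<bar>S n u x - s u x\<bar> < e" if "e > 0" for e
    using uniform_limitD[OF lim that] by (simp add: dist_real_def)
  from close[of 1] obtain n where n: "\<And>u x. u \<in> B \<Longrightarrow> x \<in> A \<Longrightarrow> \<bar>S n u x - s u x\<bar> < 1"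
    unfolding eventually_sequentially by auto
  show fs: "integrable M (\<lambda>x. f x * s u x)" if u: "u \<in> B" for u
  proof (rule Bochner_Integration.integrable_bound)
    show "integrable M (\<lambda>x. \<bar>f x * S n u x\<bar> + \<bar>f x\<bar>)"
      using f fS[OF u] by simp
    show "(\<lambda>x. f x * s u x) \<in> borel_measurable M"
      using f s[OF u] by measurable
    show "AE x in M. norm (f x * s u x) \<le> norm (\<bar>f x * S n u x\<bar> + \<bar>f x\<bar>)"
      using ae
    proof eventually_elim
      case (elim x)
      have "\<bar>f x * s u x\<bar> = \<bar>f x * S n u x - f x * (S n u x - s u x)\<bar>"
        by (simp add: algebra_simps)
      also have "\<dots> \<le> \<bar>f x * S n u x\<bar> + \<bar>f x\<bar> * \<bar>S n u x - s u x\<bar>"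
        unfolding abs_mult[of "f x" "S n u x - s u x", symmetric] by (rule abs_triangle_ineq4)
      also have "\<dots> \<le> \<bar>f x * S n u x\<bar> + \<bar>f x\<bar>"
        using n[OF u elim] by (simp add: mult_left_le)
      finally show ?case by simp
    qed
  qed
  show ?lim
    unfolding uniform_limit_iff
  proof (intro allI impI)
    fix e :: real assume "e > 0"
    define I where "I = (\<integral>x. \<bar>f x\<bar> \<partial>M)"
    have "I \<ge> 0" unfolding I_def by simp
    define d where "d = e / (I + 1)"
    have "d > 0" and dI: "d * I < e"
      using \<open>e > 0\<close> \<open>I \<ge> 0\<close> unfolding d_def by (auto simp: field_simps)
    show "\<forall>\<^sub>F n in sequentially. \<forall>u\<in>B. dist (\<integral>x. f x * S n u x \<partial>M) (\<integral>x. f x * s u x \<partial>M) < e"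
      using close[OF \<open>d > 0\<close>]
    proof eventually_elim
      case (elim n)
      show ?case
      proof
        fix u assume u: "u \<in> B"
        have "dist (\<integral>x. f x * S n u x \<partial>M) (\<integral>x. f x * s u x \<partial>M) = \<bar>\<integral>x. f x * S n u x - f x * s u x \<partial>M\<bar>"
          using fS[OF u] fs[OF u] by (simp add: dist_real_def)
        also have "\<dots> \<le> (\<integral>x. \<bar>f x * S n u x - f x * s u x\<bar> \<partial>M)"
          using integral_norm_bound[of M "\<lambda>x. f x * S n u x - f x * s u x"] by simp
        also have "\<dots> \<le> (\<integral>x. d * \<bar>f x\<bar> \<partial>M)"
        proof (rule integral_mono_AE)
          show "AE x in M. \<bar>f x * S n u x - f x * s u x\<bar> \<le> d * \<bar>f x\<bar>"
            using ae
          proof eventually_elim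
            case (elim x)
            then have "\<bar>S n u x - s u x\<bar> * \<bar>f x\<bar> \<le> d * \<bar>f x\<bar>"
              using \<open>\<forall>u\<in>B. \<forall>x\<in>A. \<bar>S n u x - s u x\<bar> < d\<close> u by (intro mult_right_mono) (auto intro: less_imp_le)
            then show ?case
              by (simp add: right_diff_distrib[symmetric] abs_mult mult.commute)
          qed
        qed (use f fS[OF u] fs[OF u] in auto)
        also have "\<dots> = d * I" by (simp add: I_def)
        finally show "dist (\<integral>x. f x * S n u x \<partial>M) (\<integral>x. f x * s u x \<partial>M) < e" using dI by simp
      qed
    qed
  qed
qed

lemma tendsto_integral_truncation:
  fixes f :: "'a \<Rightarrow> real"
  assumes f: "integrable M f"
  shows "(\<lambda>n. \<integral>x. \<bar>f x - max (- real n) (min (real n) (f x))\<bar> \<partial>M) \<longlonglongrightarrow> 0"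
proof -
  note [measurable] = borel_measurable_integrable[OF f]
  have "(\<lambda>n. \<integral>x. \<bar>f x - max (- real n) (min (real n) (f x))\<bar> \<partial>M) \<longlonglongrightarrow> (\<integral>x. 0 \<partial>M)"
  proof (rule integral_dominated_convergence)
    show "integrable M (\<lambda>x. \<bar>f x\<bar>)" using f by simp
    show "AE x in M. (\<lambda>n. \<bar>f x - max (- real n) (min (real n) (f x))\<bar>) \<longlonglongrightarrow> 0"
    proof (rule AE_I2, rule tendsto_eventually)
      fix x
      obtain N where "\<bar>f x\<bar> \<le> real N" using real_arch_simple by blast
      then show "\<forall>\<^sub>F n in sequentially. \<bar>f x - max (- real n) (min (real n) (f x))\<bar> = 0"
        by (intro eventually_sequentiallyI[of N]) (auto simp: max_def min_def)
    qed
    show "AE x in M. norm \<bar>f x - max (- real n) (min (real n) (f x))\<bar> \<le> \<bar>f x\<bar>" for n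
      by (rule AE_I2) (auto simp: max_def min_def)
  qed auto
  then show ?thesis by simp
qed

section \<open>A central limit theorem for martingale differences with a corrector\<close>

text \<open>The minimum combines the cubic and the quadratic estimate of the remainder. Its factor
  \<open>min \<bar>x\<bar> 1\<close> tends to \<open>0\<close> boundedly when \<open>x\<close> does, which lets second moments suffice in the limit theorem.\<close>

lemma iexp_taylor2:
  "cmod (iexp x - (1 + \<i> * complex_of_real x - (complex_of_real x)\<^sup>2 / 2)) \<le> x\<^sup>2 * min \<bar>x\<bar> 1"
proof -
  have e: "(\<Sum>k\<le>2. (\<i> * complex_of_real x)^k / fact k) = 1 + \<i> * complex_of_real x - (complex_of_real x)\<^sup>2 / 2"
    by (simp add: numeral_2_eq_2 power_mult_distrib)
  have "cmod (iexp x - (1 + \<i> * complex_of_real x - (complex_of_real x)\<^sup>2 / 2)) \<le> \<bar>x\<bar>^3 / 6"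
    using iexp_approx1[of x 2] unfolding e by (simp add: eval_nat_numeral)
  moreover have "cmod (iexp x - (1 + \<i> * complex_of_real x - (complex_of_real x)\<^sup>2 / 2)) \<le> x\<^sup>2"
    using iexp_approx2[of x 2] unfolding e by (simp add: eval_nat_numeral)
  moreover have "\<bar>x\<bar>^3 / 6 \<le> x\<^sup>2 * \<bar>x\<bar>"
  proof -
    have "\<bar>x\<bar>^3 = x\<^sup>2 * \<bar>x\<bar>"
      by (simp add: power3_eq_cube power2_eq_square)
    moreover have "0 \<le> x\<^sup>2 * \<bar>x\<bar>"
      by (intro mult_nonneg_nonneg) auto
    ultimately show ?thesis by linarith
  qed
  ultimately show ?thesis
    by (cases "\<bar>x\<bar> \<le> 1") (simp_all add: min_def)
qed

lemma iexp_diff_le: "cmod (iexp (x + y) - iexp x) \<le> \<bar>y\<bar>"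
proof -
  have "iexp (x + y) - iexp x = iexp x * (iexp y - 1)"
    by (simp add: ring_distribs exp_add)
  then show ?thesis
    using iexp_approx1[of y 0] by (simp add: norm_mult)
qed

lemma integrable_iexp_mult:
  fixes f X :: "'a \<Rightarrow> real"
  assumes "integrable M f" "X \<in> borel_measurable M"
  shows "integrable M (\<lambda>x. iexp (X x) * f x)"
proof (rule Bochner_Integration.integrable_bound[OF assms(1)])
  show "(\<lambda>x. iexp (X x) * f x) \<in> borel_measurable M"
    using assms by measurable
qed (simp add: norm_mult)

lemma norm_integral_iexp_mult_le:
  fixes f X :: "'a \<Rightarrow> real"
  assumes "integrable M f" "X \<in> borel_measurable M"
  shows "cmod (\<integral>x. iexp (X x) * f x \<partial>M) \<le> (\<integral>x. \<bar>f x\<bar> \<partial>M)"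
  by (rule norm_integral_le)
    (use assms integrable_iexp_mult[OF assms] in \<open>auto simp: norm_mult\<close>)

text \<open>One step of the recursion for characteristic functions. Here \<open>X\<close> is \<open>s\<close> times the current partial sum and
  \<open>D\<close> is the next difference. Expanding \<open>iexp (s * D)\<close> to second order, the linear term vanishes by \<open>mart\<close>.
  By \<open>corr\<close>, the factor \<open>D\<^sup>2\<close> can be replaced by \<open>V + g - h\<close>, where \<open>g\<close> and \<open>h\<close> are the values of the
  corrector before and after the step. Replacing the weight of \<open>h\<close> by the one after the step costs only
  \<open>\<bar>s\<bar> * K\<close>, so that the corrector terms telescope: the corrected
  characteristic function \<open>E W - s\<^sup>2 / 2 * E (W * h)\<close> is multiplied by \<open>1 - s\<^sup>2 * V / 2\<close> up to an error
  that is small compared with \<open>s\<^sup>2\<close>.\<close>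

lemma (in prob_space) martingale_clt_step:
  fixes X D g h :: "'a \<Rightarrow> real"
  assumes X[measurable]: "X \<in> borel_measurable M"
    and D: "square_integrable M D"
    and mart: "(\<integral>x. iexp (X x) * D x \<partial>M) = 0"
    and g: "integrable M g" and h: "integrable M h" and Dh: "integrable M (\<lambda>x. D x * h x)"
    and corr: "cmod (\<integral>x. iexp (X x) * ((D x)\<^sup>2 - V + h x - g x) \<partial>M) \<le> \<epsilon>"
    and K: "(\<integral>x. \<bar>g x\<bar> \<partial>M) \<le> K" "(\<integral>x. \<bar>D x * h x\<bar> \<partial>M) \<le> K"
    and V: "0 \<le> V"
  shows "cmod (((\<integral>x. iexp (X x + s * D x) \<partial>M) - s\<^sup>2 / 2 * (\<integral>x. iexp (X x + s * D x) * h x \<partial>M))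
      - (1 - s\<^sup>2 * V / 2) * ((\<integral>x. iexp (X x) \<partial>M) - s\<^sup>2 / 2 * (\<integral>x. iexp (X x) * g x \<partial>M)))
    \<le> s\<^sup>2 * (\<integral>x. (D x)\<^sup>2 * min \<bar>s * D x\<bar> 1 \<partial>M) + s\<^sup>2 / 2 * (\<epsilon> + \<bar>s\<bar> * K) + s^4 * V / 4 * K"
proof -
  note [measurable] = square_integrable_measurable[OF D] borel_measurable_integrable[OF g]
    borel_measurable_integrable[OF h]
  have D1: "integrable M D" and D2: "integrable M (\<lambda>x. (D x)\<^sup>2)"
    using D by (auto intro: square_integrable_integrable square_integrable_power2)
  let ?W = "\<lambda>x. iexp (X x)" and ?W' = "\<lambda>x. iexp (X x + s * D x)"
  \<comment> \<open>\<open>R\<close> is the Taylor remainder, \<open>\<theta>\<close> the cost of moving the weight of \<open>h\<close>, and \<open>\<eta>\<close> the error in \<open>corr\<close>.\<close>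
  define R where "R x = ?W' x - ?W x * (1 + \<i> * complex_of_real (s * D x) - (complex_of_real (s * D x))\<^sup>2 / 2)" for x
  define \<theta> where "\<theta> = (\<integral>x. (?W' x - ?W x) * h x \<partial>M)"
  define \<eta> where "\<eta> = (\<integral>x. ?W x * ((D x)\<^sup>2 - V + h x - g x) \<partial>M)"
  have iW: "integrable M (\<lambda>x. ?W x * f x)" "integrable M (\<lambda>x. ?W' x * f x)"
    if "integrable M f" for f :: "'a \<Rightarrow> real"
    by (intro integrable_iexp_mult that; measurable)+
  have iW1: "integrable M ?W" "integrable M ?W'"
    using iW[of "\<lambda>x. 1"] by simp_all
  have intD: "integrable M (\<lambda>x. (D x)\<^sup>2 * min \<bar>s * D x\<bar> 1)"
    by (rule Bochner_Integration.integrable_bound[OF D2]) (auto simp: abs_mult mult_left_le)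
  have Rle: "cmod (R x) \<le> s\<^sup>2 * ((D x)\<^sup>2 * min \<bar>s * D x\<bar> 1)" for x
  proof -
    have "R x = ?W x * (iexp (s * D x) - (1 + \<i> * complex_of_real (s * D x) - (complex_of_real (s * D x))\<^sup>2 / 2))"
      unfolding R_def by (simp add: ring_distribs exp_add)
    then have "cmod (R x) = cmod (iexp (s * D x) - (1 + \<i> * complex_of_real (s * D x) - (complex_of_real (s * D x))\<^sup>2 / 2))"
      by (simp add: norm_mult)
    also have "\<dots> \<le> (s * D x)\<^sup>2 * min \<bar>s * D x\<bar> 1"
      by (rule iexp_taylor2)
    finally show ?thesis by (simp add: power_mult_distrib mult.assoc)
  qed
  have [measurable]: "R \<in> borel_measurable M"
    unfolding R_def by measurable
  have iR: "integrable M R"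
    by (rule Bochner_Integration.integrable_bound[OF integrable_mult_right[OF intD, of "s\<^sup>2"]])
      (use Rle in \<open>auto intro: order_trans[OF _ abs_ge_self]\<close>)
  have R: "cmod (\<integral>x. R x \<partial>M) \<le> s\<^sup>2 * (\<integral>x. (D x)\<^sup>2 * min \<bar>s * D x\<bar> 1 \<partial>M)"
    using norm_integral_le[OF iR integrable_mult_right[OF intD, of "s\<^sup>2"]] Rle by simp
  have \<theta>: "cmod \<theta> \<le> \<bar>s\<bar> * K"
  proof -
    have i: "integrable M (\<lambda>x. (?W' x - ?W x) * h x)"
      using iW[OF h] by (simp add: left_diff_distrib)
    have "cmod \<theta> \<le> (\<integral>x. \<bar>s\<bar> * \<bar>D x * h x\<bar> \<partial>M)"
      unfolding \<theta>_def
    proof (rule norm_integral_le[OF i])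
      show "cmod ((?W' x - ?W x) * h x) \<le> \<bar>s\<bar> * \<bar>D x * h x\<bar>" for x
        using mult_right_mono[OF iexp_diff_le[of "X x" "s * D x"], of "\<bar>h x\<bar>"]
        by (simp add: norm_mult abs_mult mult.assoc)
    qed (use Dh in auto)
    also have "\<dots> \<le> \<bar>s\<bar> * K"
      using K(2) by (simp add: mult_left_mono)
    finally show ?thesis .
  qed
  have \<eta>: "cmod \<eta> \<le> \<epsilon>"
    unfolding \<eta>_def using corr by simp
  define G where "G = (\<integral>x. ?W x * g x \<partial>M)"
  have G: "cmod G \<le> K"
    unfolding G_def using norm_integral_iexp_mult_le[OF g X] K(1) by simp
  define E where "E = (\<integral>x. ?W x \<partial>M)"
  define H where "H = (\<integral>x. ?W' x * h x \<partial>M)"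
  have eW': "(\<integral>x. ?W' x \<partial>M) = E - s\<^sup>2 / 2 * (\<integral>x. ?W x * (D x)\<^sup>2 \<partial>M) + (\<integral>x. R x \<partial>M)"
  proof -
    have "(\<integral>x. ?W' x \<partial>M) = (\<integral>x. ?W x + \<i> * s * (?W x * D x) - s\<^sup>2 / 2 * (?W x * (D x)\<^sup>2) + R x \<partial>M)"
      by (rule arg_cong[where f = "integral\<^sup>L M"], rule ext)
        (simp add: R_def algebra_simps power_mult_distrib)
    also have "\<dots> = E + \<i> * s * (\<integral>x. ?W x * D x \<partial>M) - s\<^sup>2 / 2 * (\<integral>x. ?W x * (D x)\<^sup>2 \<partial>M) + (\<integral>x. R x \<partial>M)"
      using iW1 iW[OF D1] iW[OF D2] iR by (simp add: E_def)
    finally show ?thesis using mart by simp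
  qed
  have eD2: "(\<integral>x. ?W x * (D x)\<^sup>2 \<partial>M) = \<eta> + V * E - (H - \<theta>) + G"
  proof -
    have h': "H - \<theta> = (\<integral>x. ?W x * h x \<partial>M)"
      unfolding H_def \<theta>_def using iW[OF h] by (simp add: left_diff_distrib)
    have "\<eta> = (\<integral>x. ?W x * (D x)\<^sup>2 - V * ?W x + ?W x * h x - ?W x * g x \<partial>M)"
      unfolding \<eta>_def by (simp add: algebra_simps)
    also have "\<dots> = (\<integral>x. ?W x * (D x)\<^sup>2 \<partial>M) - V * E + (\<integral>x. ?W x * h x \<partial>M) - G"
      using iW1 iW[OF D2] iW[OF h] iW[OF g] by (simp add: E_def G_def)
    finally show ?thesis using h' by simp
  qed
  have "((\<integral>x. ?W' x \<partial>M) - s\<^sup>2 / 2 * H) - (1 - s\<^sup>2 * V / 2) * (E - s\<^sup>2 / 2 * G)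
      = (\<integral>x. R x \<partial>M) - s\<^sup>2 / 2 * (\<eta> + \<theta>) - s^4 * V / 4 * G"
    unfolding eW' eD2 by (simp add: field_simps power2_eq_square power4_eq_xxxx)
  also have "cmod \<dots> \<le> cmod (\<integral>x. R x \<partial>M) + cmod (s\<^sup>2 / 2 * (\<eta> + \<theta>)) + cmod (s^4 * V / 4 * G)"
    by (intro norm_triangle_le_diff add_right_mono norm_triangle_ineq4)
  also have "cmod (s\<^sup>2 / 2 * (\<eta> + \<theta>)) \<le> s\<^sup>2 / 2 * (\<epsilon> + \<bar>s\<bar> * K)"
    using norm_triangle_le[OF add_mono[OF \<eta> \<theta>]] by (simp add: norm_mult norm_divide norm_power mult_left_mono)
  also have "cmod (s^4 * V / 4 * G) \<le> s^4 * V / 4 * K"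
    using G V by (simp add: norm_mult norm_divide norm_power mult_left_mono)
  finally show ?thesis
    using R unfolding E_def G_def H_def by simp
qed

text \<open>With \<open>s = t / sqrt n\<close>, iterating the step \<open>n\<close> times gives \<open>(1 - t\<^sup>2 * V / (2 * n)) ^ n\<close>, since the errors
  add up to \<open>n * s\<^sup>2 = t\<^sup>2\<close> times a quantity that tends to \<open>\<epsilon> / 2\<close>, and \<open>\<epsilon>\<close> is arbitrary. The
  filtration enters only through integrals against functions of the partial sums.\<close>

lemma (in prob_space) martingale_clt:
  fixes D :: "nat \<Rightarrow> 'a \<Rightarrow> real"
  assumes D: "\<And>n. square_integrable M (D n)"
    and law: "\<And>n. distr M borel (D n) = distr M borel (D 0)"
    and mart: "\<And>s n. (\<integral>x. iexp (s * (\<Sum>i<n. D i x)) * D n x \<partial>M) = 0"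
    and V: "0 \<le> V"
    and corr: "\<And>\<epsilon>. \<epsilon> > 0 \<Longrightarrow> \<exists>h K. \<forall>n. integrable M (h n) \<and> integrable M (\<lambda>x. D n x * h (Suc n) x) \<and>
        (\<integral>x. \<bar>h n x\<bar> \<partial>M) \<le> K \<and> (\<integral>x. \<bar>D n x * h (Suc n) x\<bar> \<partial>M) \<le> K \<and>
        (\<forall>s. cmod (\<integral>x. iexp (s * (\<Sum>i<n. D i x)) * ((D n x)\<^sup>2 - V + h (Suc n) x - h n x) \<partial>M) \<le> \<epsilon>)"
  shows "(\<lambda>n. \<integral>x. iexp (t / sqrt (real n) * (\<Sum>i<n. D i x)) \<partial>M) \<longlonglongrightarrow> exp (- (t\<^sup>2 * V / 2))"
proof -
  note [measurable] = square_integrable_measurable[OF D]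
  define \<rho> where "\<rho> s = (\<integral>x. (D 0 x)\<^sup>2 * min \<bar>s * D 0 x\<bar> 1 \<partial>M)" for s
  have \<rho>: "(\<integral>x. (D n x)\<^sup>2 * min \<bar>s * D n x\<bar> 1 \<partial>M) = \<rho> s" for n s
  proof -
    have "(\<integral>x. (D n x)\<^sup>2 * min \<bar>s * D n x\<bar> 1 \<partial>M) = (\<integral>y. y\<^sup>2 * min \<bar>s * y\<bar> 1 \<partial>distr M borel (D n))"
      by (subst integral_distr) auto
    also have "\<dots> = \<rho> s"
      unfolding law[of n] \<rho>_def by (subst integral_distr) auto
    finally show ?thesis .
  qed
  have t0: "(\<lambda>n. t / sqrt (real n)) \<longlonglongrightarrow> 0"
    by (intro tendsto_divide_0[OF tendsto_const] filterlim_at_top_imp_at_infinity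
        filterlim_compose[OF sqrt_at_top filterlim_real_sequentially])
  have \<rho>0: "(\<lambda>n. \<rho> (t / sqrt (real n))) \<longlonglongrightarrow> 0"
  proof -
    have "(\<lambda>n. \<rho> (t / sqrt (real n))) \<longlonglongrightarrow> (\<integral>x. 0 \<partial>M)"
      unfolding \<rho>_def
    proof (rule integral_dominated_convergence)
      show "integrable M (\<lambda>x. (D 0 x)\<^sup>2)"
        using D by (rule square_integrable_power2)
      show "AE x in M. (\<lambda>n. (D 0 x)\<^sup>2 * min \<bar>t / sqrt (real n) * D 0 x\<bar> 1) \<longlonglongrightarrow> 0"
      proof (rule AE_I2)
        fix x
        have "(\<lambda>n. (D 0 x)\<^sup>2 * min \<bar>t / sqrt (real n) * D 0 x\<bar> 1) \<longlonglongrightarrow> (D 0 x)\<^sup>2 * min \<bar>0 * D 0 x\<bar> 1"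
          by (intro tendsto_intros t0)
        then show "(\<lambda>n. (D 0 x)\<^sup>2 * min \<bar>t / sqrt (real n) * D 0 x\<bar> 1) \<longlonglongrightarrow> 0" by simp
      qed
    qed (auto simp: abs_mult mult_left_le)
    then show ?thesis by simp
  qed
  have explim: "(\<lambda>n. complex_of_real (1 + (- (t\<^sup>2 * V / 2)) / real n) ^ n) \<longlonglongrightarrow> complex_of_real (exp (- (t\<^sup>2 * V / 2)))"
    unfolding of_real_power[symmetric]
    by (intro tendsto_of_real tendsto_exp_limit_sequentially)
  show ?thesis
  proof (rule tendsto_by_approximation)
    fix e :: real assume "e > 0"
    \<comment> \<open>The final error is \<open>t\<^sup>2 / 2 * \<epsilon>\<close>; adding \<open>1\<close> avoids a division by zero at \<open>t = 0\<close>.\<close>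
    define \<epsilon> where "\<epsilon> = e / (t\<^sup>2 + 1)"
    have "\<epsilon> > 0" and \<epsilon>e: "t\<^sup>2 / 2 * \<epsilon> < e"
      using \<open>e > 0\<close> unfolding \<epsilon>_def by (auto simp: field_simps add_pos_nonneg add_nonneg_pos)
    from corr[OF \<open>\<epsilon> > 0\<close>] obtain h K where
      h: "\<And>n. integrable M (h n)" "\<And>n. integrable M (\<lambda>x. D n x * h (Suc n) x)"
        "\<And>n. (\<integral>x. \<bar>h n x\<bar> \<partial>M) \<le> K" "\<And>n. (\<integral>x. \<bar>D n x * h (Suc n) x\<bar> \<partial>M) \<le> K"
        "\<And>n s. cmod (\<integral>x. iexp (s * (\<Sum>i<n. D i x)) * ((D n x)\<^sup>2 - V + h (Suc n) x - h n x) \<partial>M) \<le> \<epsilon>"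
      by blast
    note [measurable] = borel_measurable_integrable[OF h(1)]
    have "K \<ge> 0"
      using order_trans[OF Bochner_Integration.integral_nonneg h(3)[of 0]] by simp
    define A where "A s n = (\<integral>x. iexp (s * (\<Sum>i<n. D i x)) \<partial>M)
      - (complex_of_real s)\<^sup>2 / 2 * (\<integral>x. iexp (s * (\<Sum>i<n. D i x)) * h n x \<partial>M)" for s :: real and n
    define \<delta> where "\<delta> s = s\<^sup>2 * \<rho> s + s\<^sup>2 / 2 * (\<epsilon> + \<bar>s\<bar> * K) + s^4 * V / 4 * K" for s
    have step: "cmod (A s (Suc n) - (1 - (complex_of_real s)\<^sup>2 * complex_of_real V / 2) * A s n) \<le> \<delta> s" for s n
    proof -
      have e: "s * (\<Sum>i<Suc n. D i x) = s * (\<Sum>i<n. D i x) + s * D n x" for x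
        by (simp add: algebra_simps)
      show ?thesis
        unfolding A_def \<delta>_def e \<rho>[of n s, symmetric]
        by (rule martingale_clt_step[OF _ D mart h(1) h(1) h(2) h(5) h(3) h(4) V]) measurable
    qed
    have close: "cmod (A s n - (\<integral>x. iexp (s * (\<Sum>i<n. D i x)) \<partial>M)) \<le> s\<^sup>2 / 2 * K" for s n
    proof -
      have "cmod (\<integral>x. iexp (s * (\<Sum>i<n. D i x)) * h n x \<partial>M) \<le> K"
        by (rule order_trans[OF norm_integral_iexp_mult_le[OF h(1)] h(3)]) measurable
      then show ?thesis
        unfolding A_def by (simp add: norm_mult norm_divide norm_power mult_left_mono)
    qed
    have main: "cmod ((\<integral>x. iexp (s * (\<Sum>i<n. D i x)) \<partial>M) - (1 - s\<^sup>2 * V / 2)^n) \<le> n * \<delta> s + s\<^sup>2 * K"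
      if "s\<^sup>2 * V \<le> 4" for s n
    proof -
      define q where "q = complex_of_real (1 - s\<^sup>2 * V / 2)"
      have q: "cmod q \<le> 1"
        unfolding q_def norm_of_real using that V by (auto simp: abs_le_iff)
      have 1: "cmod (A s n - q ^ n * A s 0) \<le> n * \<delta> s"
        by (rule norm_recursion_bound) (use step q in \<open>simp_all add: q_def\<close>)
      have "cmod (A s 0 - 1) \<le> s\<^sup>2 / 2 * K"
        using close[of s 0] by (simp add: prob_space)
      then have 2: "cmod (q ^ n * (A s 0 - 1)) \<le> s\<^sup>2 / 2 * K"
        unfolding norm_mult norm_power
        by (intro order_trans[OF mult_left_le_one_le] norm_ge_zero zero_le_power power_le_one q)
      have "(\<integral>x. iexp (s * (\<Sum>i<n. D i x)) \<partial>M) - q ^ n =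
        (A s n - q ^ n * A s 0) + q ^ n * (A s 0 - 1) - (A s n - (\<integral>x. iexp (s * (\<Sum>i<n. D i x)) \<partial>M))"
        by (simp add: algebra_simps)
      also have "cmod \<dots> \<le> (n * \<delta> s + s\<^sup>2 / 2 * K) + s\<^sup>2 / 2 * K"
        by (intro order_trans[OF norm_triangle_ineq4] add_mono norm_triangle_le close 1 2)
      also have "(n * \<delta> s + s\<^sup>2 / 2 * K) + s\<^sup>2 / 2 * K = n * \<delta> s + s\<^sup>2 * K"
        by (simp add: field_simps)
      finally show ?thesis by (simp add: q_def)
    qed
    define b where "b n = (t\<^sup>2 * \<rho> (t / sqrt (real n)) + t\<^sup>2 / 2 * (\<epsilon> + \<bar>t / sqrt (real n)\<bar> * K)
        + t\<^sup>2 * (t / sqrt (real n))\<^sup>2 * V / 4 * K) + (t / sqrt (real n))\<^sup>2 * K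
        + cmod (complex_of_real (1 + (- (t\<^sup>2 * V / 2)) / real n) ^ n - exp (- (t\<^sup>2 * V / 2)))" for n
    show "\<exists>b \<beta>. (\<forall>\<^sub>F n in sequentially. norm ((\<integral>x. iexp (t / sqrt (real n) * (\<Sum>i<n. D i x)) \<partial>M)
          - exp (- (t\<^sup>2 * V / 2))) \<le> b n) \<and> b \<longlonglongrightarrow> \<beta> \<and> \<beta> < e"
    proof (intro exI conjI)
      have "(\<lambda>n. (t / sqrt (real n))\<^sup>2 * V) \<longlonglongrightarrow> 0\<^sup>2 * V"
        by (intro tendsto_intros t0)
      then have ev: "\<forall>\<^sub>F n in sequentially. (t / sqrt (real n))\<^sup>2 * V < 4"
        by (rule order_tendstoD) simp
      show "\<forall>\<^sub>F n in sequentially. norm ((\<integral>x. iexp (t / sqrt (real n) * (\<Sum>i<n. D i x)) \<partial>M)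
          - exp (- (t\<^sup>2 * V / 2))) \<le> b n"
        using ev eventually_gt_at_top[of 0]
      proof eventually_elim
        case (elim n)
        define s where "s = t / sqrt (real n)"
        have ns: "real n * s\<^sup>2 = t\<^sup>2" and ss: "s\<^sup>2 * V / 2 = t\<^sup>2 * V / 2 / n"
          using elim unfolding s_def by (auto simp: power_divide)
        have nd: "real n * \<delta> s = t\<^sup>2 * \<rho> s + t\<^sup>2 / 2 * (\<epsilon> + \<bar>s\<bar> * K) + t\<^sup>2 * s\<^sup>2 * V / 4 * K"
          unfolding \<delta>_def ns[symmetric] by (simp add: algebra_simps power4_eq_xxxx power2_eq_square)
        have "cmod ((\<integral>x. iexp (s * (\<Sum>i<n. D i x)) \<partial>M) - (1 - s\<^sup>2 * V / 2)^n) \<le> n * \<delta> s + s\<^sup>2 * K"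
          by (rule main) (use elim in \<open>simp add: s_def\<close>)
        moreover have "complex_of_real ((1 - s\<^sup>2 * V / 2)^n) = complex_of_real (1 + (- (t\<^sup>2 * V / 2)) / real n) ^ n"
        proof -
          have "1 - s\<^sup>2 * V / 2 = 1 + (- (t\<^sup>2 * V / 2)) / real n"
            using ss by simp
          then show ?thesis by (simp only: of_real_power)
        qed
        ultimately have "cmod ((\<integral>x. iexp (s * (\<Sum>i<n. D i x)) \<partial>M)
            - complex_of_real (1 + (- (t\<^sup>2 * V / 2)) / real n) ^ n) \<le> n * \<delta> s + s\<^sup>2 * K"
          by (simp only:)
        then show ?case
          unfolding b_def s_def[symmetric] nd[symmetric]
          by (rule norm_diff_triangle_le[OF _ order_refl])
      qed
      have "b \<longlonglongrightarrow> (t\<^sup>2 * 0 + t\<^sup>2 / 2 * (\<epsilon> + \<bar>0\<bar> * K) + t\<^sup>2 * 0\<^sup>2 * V / 4 * K) + 0\<^sup>2 * K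
         + cmod (complex_of_real (exp (- (t\<^sup>2 * V / 2))) - exp (- (t\<^sup>2 * V / 2)))"
        unfolding b_def by (intro tendsto_intros \<rho>0 t0 explim) simp_all
      then show "b \<longlonglongrightarrow> t\<^sup>2 / 2 * \<epsilon>" by simp
    qed (fact \<epsilon>e)
  qed
qed

section \<open>The uniform law on the unit interval and the Markov property of the chain\<close>

lemma uniform01_eq_density: "uniform01 = density lborel (indicator {0<..<1})"
  by (simp add: uniform01_def uniform_measure_def divide_ennreal_def)

lemma sets_uniform01 [measurable_cong, simp]: "sets uniform01 = sets borel"
  by (simp add: uniform01_def)

lemma space_uniform01 [simp]: "space uniform01 = UNIV"
  by (simp add: uniform01_def)

lemma prob_space_uniform01: "prob_space uniform01"
  unfolding uniform01_def by (rule prob_space_uniform_measure) auto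

interpretation unif: prob_space uniform01
  by (rule prob_space_uniform01)

interpretation unif_pair: pair_prob_space uniform01 uniform01 ..

lemma measure_uniform01_UNIV [simp]: "measure uniform01 UNIV = 1"
  using unif.prob_space by simp

lemma AE_uniform01:
  "(AE x in uniform01. P x) \<longleftrightarrow> (AE x in lborel. x \<in> {0<..<1} \<longrightarrow> P x)"
  unfolding uniform01_eq_density by (subst AE_density) (auto simp: indicator_def)

lemma integral_uniform01:
  fixes f :: "real \<Rightarrow> real"
  assumes [measurable]: "f \<in> borel_measurable borel"
  shows "(LBINT x:{0<..<1}. f x) = (\<integral>x. f x \<partial>uniform01)"
proof -
  have u: "uniform01 = density lborel (\<lambda>x. ennreal (indicator {0<..<1} x))"
    unfolding uniform01_eq_density by (simp add: ennreal_indicator)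
  show ?thesis
    unfolding u by (simp add: integral_density set_lebesgue_integral_def)
qed

lemma integrable_uniform01:
  fixes f :: "real \<Rightarrow> real"
  assumes [measurable]: "f \<in> borel_measurable borel"
  shows "set_integrable lborel {0<..<1} f \<longleftrightarrow> integrable uniform01 f"
proof -
  have u: "uniform01 = density lborel (\<lambda>x. ennreal (indicator {0<..<1} x))"
    unfolding uniform01_eq_density by (simp add: ennreal_indicator)
  show ?thesis
    unfolding u by (simp add: integrable_density set_integrable_def)
qed

lemma uniform01_pair_eq_density:
  "uniform01 \<Otimes>\<^sub>M uniform01 = density lborel (indicator ({0<..<1} \<times> {0<..<1}))"
proof -
  have "uniform01 \<Otimes>\<^sub>M uniform01
      = density (lborel \<Otimes>\<^sub>M lborel) (\<lambda>(x, y). indicator {0<..<1} x * indicator {0<..<1} y)"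
    unfolding uniform01_eq_density
    by (rule pair_measure_density)
      (auto intro: lborel.sigma_finite_measure_axioms unif.sigma_finite_measure_axioms[unfolded uniform01_eq_density])
  also have "\<dots> = density lborel (indicator ({0<..<1} \<times> {0<..<1}))"
    unfolding lborel_prod by (rule arg_cong2[where f = density]) (auto simp: indicator_def)
  finally show ?thesis .
qed

lemma sets_uniform01_pair: "sets (uniform01 \<Otimes>\<^sub>M uniform01) = sets borel"
  using sets_pair_measure_cong[OF sets_uniform01 sets_uniform01] unfolding borel_prod .

lemma AE_uniform01_pair:
  "(AE p in uniform01 \<Otimes>\<^sub>M uniform01. P p) \<longleftrightarrow> (AE p in lborel. p \<in> {0<..<1} \<times> {0<..<1} \<longrightarrow> P p)"
  unfolding uniform01_pair_eq_density
  by (subst AE_density) (auto simp: indicator_def borel_prod[symmetric])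

lemma subalgebra_past:
  assumes [measurable]: "\<And>i. U i \<in> borel_measurable M"
  shows "subalgebra M (past M U n)"
proof -
  have sub: "{U i -` B \<inter> space M | i B. i \<le> n \<and> B \<in> sets borel} \<subseteq> Pow (space M)"
    by auto
  have "sigma_sets (space M) {U i -` B \<inter> space M | i B. i \<le> n \<and> B \<in> sets borel} \<subseteq> sets M"
    by (intro sets.sigma_sets_subset) auto
  then show ?thesis
    using sub by (auto simp: subalgebra_def past_def)
qed

lemma measurable_past:
  assumes "i \<le> n"
  shows "U i \<in> borel_measurable (past M U n)"
proof (rule measurableI)
  have sub: "{U i -` B \<inter> space M | i B. i \<le> n \<and> B \<in> sets borel} \<subseteq> Pow (space M)"
    by auto
  fix A :: "real set" assume "A \<in> sets borel"
  then have "U i -` A \<inter> space M \<in> {U i -` B \<inter> space M | i B. i \<le> n \<and> B \<in> sets borel}"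
    using assms by auto
  then show "U i -` A \<inter> space (past M U n) \<in> sets (past M U n)"
    using sub by (simp add: past_def)
qed simp

locale copula_density_chain = prob_space M for M :: "'a measure" +
  fixes C c :: "real \<Rightarrow> real \<Rightarrow> real" and U :: "nat \<Rightarrow> 'a \<Rightarrow> real"
  assumes density_measurable: "(\<lambda>p. c (fst p) (snd p)) \<in> borel_measurable borel"
    and density: "copula_density C c"
    and chain: "copula_markov_chain M C U"
begin

text \<open>The density is nonnegative only almost everywhere. With its positive part, the measure with this
  density and integrals against it agree without exceptional sets.\<close>

definition kernel :: "real \<Rightarrow> real \<Rightarrow> real" where
  "kernel u v = max 0 (c u v)"

lemma kernel_nonneg: "0 \<le> kernel u v"
  by (simp add: kernel_def)

lemma kernel_measurable_prod: "(\<lambda>p. kernel (fst p) (snd p)) \<in> borel_measurable borel"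
  unfolding kernel_def using density_measurable by measurable

lemma kernel_measurable [measurable (raw)]:
  assumes [measurable]: "f \<in> borel_measurable N" "g \<in> borel_measurable N"
  shows "(\<lambda>x. kernel (f x) (g x)) \<in> borel_measurable N"
  using measurable_compose[OF _ kernel_measurable_prod, of "\<lambda>x. (f x, g x)" N] by simp

lemma U_measurable [measurable]: "U i \<in> borel_measurable M"
  using chain by (simp add: copula_markov_chain_def markov_chain_def)

lemma distr_U: "distr M borel (U i) = uniform01"
  using chain by (simp add: copula_markov_chain_def)

lemma AE_U:
  assumes "AE u in uniform01. P u"
  shows "AE x in M. P (U i x)"
  using assms unfolding distr_U[of i, symmetric] by (rule AE_distrD[rotated]) simp

lemma AE_kernel_eq: "AE p in uniform01 \<Otimes>\<^sub>M uniform01. kernel (fst p) (snd p) = c (fst p) (snd p)"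
  using density unfolding copula_density_def AE_uniform01_pair
  by (auto simp: kernel_def elim: AE_mp)

lemma AE_AE_kernel_eq: "AE u in uniform01. AE v in uniform01. kernel u v = c u v"
  using unif_pair.AE_pair[OF AE_kernel_eq] by simp

text \<open>The copula prescribes the measure of the quadrants \<open>{..a} \<times> {..b}\<close>, which generate the Borel sets and
  are stable under intersection.\<close>

lemma joint_law:
  "distr M borel (\<lambda>x. (U i x, U (Suc i) x))
    = density (uniform01 \<Otimes>\<^sub>M uniform01) (\<lambda>p. ennreal (kernel (fst p) (snd p)))"
proof (rule measure_eqI_generator_eq[where E = "range (\<lambda>p. {..p})" and \<Omega> = UNIV
      and A = "\<lambda>n. {..(real n, real n)}"])
  show "Int_stable (range (\<lambda>p::real\<times>real. {..p}))"
  proof (clarsimp simp: Int_stable_def)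
    fix a b a' b' :: real
    have "{..(a, b)} \<inter> {..(a', b')} = {..(min a a', min b b')}"
      by auto
    then show "{..(a, b)} \<inter> {..(a', b')} \<in> range atMost"
      by blast
  qed
  show "sets (distr M borel (\<lambda>x. (U i x, U (Suc i) x))) = sigma_sets UNIV (range (\<lambda>p. {..p}))"
    by (simp add: borel_eq_atMost)
  show "sets (density (uniform01 \<Otimes>\<^sub>M uniform01) (\<lambda>p. ennreal (kernel (fst p) (snd p))))
      = sigma_sets UNIV (range (\<lambda>p. {..p}))"
    unfolding sets_density sets_uniform01_pair by (simp add: borel_eq_atMost)
  show "(\<Union>n. {..(real n, real n)}) = UNIV"
  proof (intro set_eqI iffI UNIV_I)
    fix p :: "real \<times> real"
    obtain n where "max (fst p) (snd p) \<le> real n"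
      using real_arch_simple by blast
    then show "p \<in> (\<Union>n. {..(real n, real n)})"
      by (auto simp: less_eq_prod_def)
  qed
  show "emeasure (distr M borel (\<lambda>x. (U i x, U (Suc i) x))) {..(real n, real n)} \<noteq> \<infinity>" for n
    by (simp add: emeasure_distr)
  fix X :: "(real \<times> real) set" assume "X \<in> range (\<lambda>p. {..p})"
  then obtain a b where X: "X = {..(a, b)}" by auto
  \<comment> \<open>The integral formula for the copula holds on the closed unit square only, whence the clipping.\<close>
  define a' b' where "a' = max 0 (min 1 a)" and "b' = max 0 (min 1 b)"
  have clip: "x \<le> max 0 (min 1 y) \<longleftrightarrow> x \<le> y" if "0 < x" "x < 1" for x y :: real
    using that by (auto simp: max_def min_def)
  have "emeasure (distr M borel (\<lambda>x. (U i x, U (Suc i) x))) X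
      = emeasure M {x \<in> space M. U i x \<le> a \<and> U (Suc i) x \<le> b}"
    unfolding X by (subst emeasure_distr) (auto simp: less_eq_prod_def intro!: arg_cong[where f = "emeasure M"])
  also have "\<dots> = emeasure M {x \<in> space M. U i x \<le> a' \<and> U (Suc i) x \<le> b'}"
  proof (rule emeasure_eq_AE)
    have u: "AE u in uniform01. u \<in> {0<..<1}"
      by (simp add: AE_uniform01)
    show "AE x in M. x \<in> {x \<in> space M. U i x \<le> a \<and> U (Suc i) x \<le> b} \<longleftrightarrow>
        x \<in> {x \<in> space M. U i x \<le> a' \<and> U (Suc i) x \<le> b'}"
      using AE_U[OF u, of i] AE_U[OF u, of "Suc i"]
      by eventually_elim (auto simp: clip a'_def b'_def)
  qed auto
  also have "\<dots> = ennreal (C a' b')"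
    using chain by (simp add: copula_markov_chain_def emeasure_eq_measure)
  also have "C a' b' = (LBINT p:{0<..<a'} \<times> {0<..<b'}. c (fst p) (snd p))"
    using density by (simp add: copula_density_def a'_def b'_def)
  also have "ennreal \<dots> = (\<integral>\<^sup>+p. ennreal (indicator ({0<..<a'} \<times> {0<..<b'}) p * c (fst p) (snd p)) \<partial>lborel)"
    unfolding set_lebesgue_integral_def real_scaleR_def
  proof (rule nn_integral_eq_integral[symmetric])
    have sub: "{0<..<a'} \<times> {0<..<b'} \<subseteq> {0<..<1} \<times> {0<..<1::real}"
      by (auto simp: a'_def b'_def)
    have m: "{0<..<a'} \<times> {0<..<b'} \<in> sets (lborel :: (real \<times> real) measure)"
      by (simp add: borel_prod[symmetric])
    have "set_integrable lborel ({0<..<1} \<times> {0<..<1}) (\<lambda>p. c (fst p) (snd p))"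
      using density by (simp add: copula_density_def)
    from set_integrable_subset[OF this m sub]
    show "integrable lborel (\<lambda>p. indicator ({0<..<a'} \<times> {0<..<b'}) p * c (fst p) (snd p))"
      by (simp add: set_integrable_def)
    have "AE p in lborel. p \<in> {0<..<1} \<times> {0<..<1} \<longrightarrow> 0 \<le> c (fst p) (snd p)"
      using density by (simp add: copula_density_def)
    then show "AE p in lborel. 0 \<le> indicator ({0<..<a'} \<times> {0<..<b'}) p * c (fst p) (snd p)"
      by eventually_elim (use sub in \<open>auto simp: indicator_def\<close>)
  qed
  also have "\<dots> = (\<integral>\<^sup>+p. indicator ({0<..<1} \<times> {0<..<1}) p *
      (ennreal (kernel (fst p) (snd p)) * indicator X p) \<partial>lborel)"
  proof (rule nn_integral_cong_AE)
    \<comment> \<open>Open and half-open rectangles differ by the two lines removed here.\<close>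
    have "AE p in lborel. fst p \<noteq> a' \<and> snd p \<noteq> (b' :: real)"
    proof -
      have "AE p in lborel \<Otimes>\<^sub>M lborel. fst p \<noteq> a' \<and> snd p \<noteq> b'"
      proof (rule lborel_pair.AE_pair_measure)
        show "AE x in lborel. AE y in lborel. fst (x, y) \<noteq> a' \<and> snd (x, y) \<noteq> b'"
          using AE_lborel_singleton[of a'] AE_lborel_singleton[of b'] by auto
      qed measurable
      then show ?thesis unfolding lborel_prod .
    qed
    moreover have "AE p in lborel. p \<in> {0<..<1} \<times> {0<..<1} \<longrightarrow> 0 \<le> c (fst p) (snd p)"
      using density by (simp add: copula_density_def)
    ultimately show "AE p in lborel. ennreal (indicator ({0<..<a'} \<times> {0<..<b'}) p * c (fst p) (snd p)) =
        indicator ({0<..<1} \<times> {0<..<1}) p * (ennreal (kernel (fst p) (snd p)) * indicator X p)"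
    proof eventually_elim
      case (elim p)
      obtain u v where p: "p = (u, v)" by (cases p)
      have "p \<in> {0<..<a'} \<times> {0<..<b'} \<longleftrightarrow> p \<in> {0<..<1} \<times> {0<..<1} \<and> p \<in> X"
        using elim unfolding p X a'_def b'_def by (auto simp: less_eq_prod_def)
      then show ?case
        using elim by (auto simp: indicator_def kernel_def)
    qed
  qed
  also have "\<dots> = (\<integral>\<^sup>+p. ennreal (kernel (fst p) (snd p)) * indicator X p \<partial>(uniform01 \<Otimes>\<^sub>M uniform01))"
    unfolding uniform01_pair_eq_density
  proof (subst nn_integral_density)
    have [measurable]: "X \<in> sets borel" unfolding X by simp
    have sq: "{0<..<1::real} \<times> {0<..<1::real} \<in> sets borel"
      unfolding borel_prod[symmetric] by simp
    note [measurable] = kernel_measurable_prod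
    show "indicator ({0<..<1::real} \<times> {0<..<1::real}) \<in> borel_measurable lborel"
      by (rule borel_measurable_indicator) (simp add: sq)
    show "(\<lambda>p. ennreal (kernel (fst p) (snd p)) * indicator X p) \<in> borel_measurable lborel" by measurable
  qed simp
  also have "\<dots> = emeasure (density (uniform01 \<Otimes>\<^sub>M uniform01) (\<lambda>p. ennreal (kernel (fst p) (snd p)))) X"
  proof -
    have "X \<in> sets (borel \<Otimes>\<^sub>M borel)"
      unfolding X borel_prod by simp
    then have "X \<in> sets (uniform01 \<Otimes>\<^sub>M uniform01)"
      using sets_pair_measure_cong[OF sets_uniform01 sets_uniform01] by simp
    then show ?thesis
      by (subst emeasure_density) auto
  qed
  finally show "emeasure (distr M borel (\<lambda>x. (U i x, U (Suc i) x))) X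
      = emeasure (density (uniform01 \<Otimes>\<^sub>M uniform01) (\<lambda>p. ennreal (kernel (fst p) (snd p)))) X" .
qed auto

lemma integrable_kernel: "integrable (uniform01 \<Otimes>\<^sub>M uniform01) (\<lambda>p. kernel (fst p) (snd p))"
proof -
  have "prob_space (density (uniform01 \<Otimes>\<^sub>M uniform01) (\<lambda>p. ennreal (kernel (fst p) (snd p))))"
    unfolding joint_law[of 0, symmetric] by (rule prob_space_distr) simp
  then have "emeasure (density (uniform01 \<Otimes>\<^sub>M uniform01) (\<lambda>p. ennreal (kernel (fst p) (snd p)))) UNIV = 1"
    using prob_space.emeasure_space_1 by (fastforce simp: space_pair_measure)
  then have "(\<integral>\<^sup>+p. ennreal (kernel (fst p) (snd p)) \<partial>(uniform01 \<Otimes>\<^sub>M uniform01)) = 1"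
    using sets.top[of "uniform01 \<Otimes>\<^sub>M uniform01"]
    by (subst (asm) emeasure_density) (auto simp: space_pair_measure)
  then show ?thesis
    by (intro integrableI_nonneg) (auto simp: kernel_nonneg)
qed

lemma AE_integrable_kernel: "AE u in uniform01. integrable uniform01 (kernel u)"
  using unif_pair.AE_integrable_fst'[OF integrable_kernel] by simp

lemma measure_joint:
  assumes [measurable]: "A \<in> sets borel" "B \<in> sets borel"
  shows "measure M {x \<in> space M. U i x \<in> A \<and> U (Suc i) x \<in> B}
    = (\<integral>u. indicator A u * (\<integral>v. indicator B v * kernel u v \<partial>uniform01) \<partial>uniform01)"
proof -
  have AB[measurable]: "A \<times> B \<in> sets (borel \<Otimes>\<^sub>M borel)" by simp
  then have AB'[measurable]: "A \<times> B \<in> sets (uniform01 \<Otimes>\<^sub>M uniform01)"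
    using sets_pair_measure_cong[OF sets_uniform01 sets_uniform01] by simp
  have "measure M {x \<in> space M. U i x \<in> A \<and> U (Suc i) x \<in> B}
      = measure (distr M borel (\<lambda>x. (U i x, U (Suc i) x))) (A \<times> B)"
    by (subst measure_distr) (auto simp: borel_prod[symmetric] intro!: arg_cong[where f = "measure M"])
  also have "\<dots> = (\<integral>p. indicator (A \<times> B) p \<partial>distr M borel (\<lambda>x. (U i x, U (Suc i) x)))"
    by simp
  also have "\<dots> = (\<integral>p. kernel (fst p) (snd p) * indicator (A \<times> B) p \<partial>(uniform01 \<Otimes>\<^sub>M uniform01))"
    unfolding joint_law by (subst integral_density) (auto simp: kernel_nonneg)
  also have "\<dots> = (\<integral>u. (\<integral>v. kernel (fst (u, v)) (snd (u, v)) * indicator (A \<times> B) (u, v) \<partial>uniform01) \<partial>uniform01)"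
    by (rule unif_pair.integral_fst'[symmetric])
      (use integrable_mult_indicator[OF AB' integrable_kernel] in \<open>simp add: mult.commute\<close>)
  also have "\<dots> = (\<integral>u. indicator A u * (\<integral>v. indicator B v * kernel u v \<partial>uniform01) \<partial>uniform01)"
    by (simp add: indicator_times mult_ac flip: integral_mult_right_zero)
  finally show ?thesis .
qed

lemma kernel_set_integrable:
  assumes [measurable]: "B \<in> sets borel"
  shows "integrable uniform01 (\<lambda>u. \<integral>v. indicator B v * kernel u v \<partial>uniform01)"
proof -
  have "UNIV \<times> B \<in> sets (uniform01 \<Otimes>\<^sub>M uniform01)"
    by (intro pair_measureI) auto
  from unif_pair.integrable_fst'[OF integrable_mult_indicator[OF this integrable_kernel]]
  show ?thesis by (simp add: indicator_times)
qed

text \<open>The function \<open>\<integral> indicator B v * kernel u v dv\<close> of \<open>U n\<close> has the defining property of the conditional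
  probability of \<open>U (Suc n) \<in> B\<close> given \<open>U n\<close>, by the joint law; the Markov property says that conditioning on
  the whole past gives the same.\<close>

lemma markov_property:
  assumes A: "A \<in> sets (past M U n)" and B[measurable]: "B \<in> sets borel"
  shows "measure M (A \<inter> (U (Suc n) -` B \<inter> space M))
    = (\<integral>x. indicator A x * (\<integral>v. indicator B v * kernel (U n x) v \<partial>uniform01) \<partial>M)"
proof -
  define k where "k u = (\<integral>v. indicator B v * kernel u v \<partial>uniform01)" for u
  have [measurable]: "k \<in> borel_measurable borel" unfolding k_def by measurable
  define G where "G = vimage_algebra (space M) (U n) borel"
  let ?I = "indicator (U (Suc n) -` B \<inter> space M) :: 'a \<Rightarrow> real"
  have UB[measurable]: "U (Suc n) -` B \<inter> space M \<in> sets M" by measurable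
  have subF: "subalgebra M (past M U n)" by (rule subalgebra_past) simp
  have setsG: "sets G = {U n -` A \<inter> space M | A. A \<in> sets borel}"
    unfolding G_def by (rule sets_vimage_algebra2) simp
  have subG: "subalgebra M G"
    unfolding subalgebra_def setsG by (auto simp: G_def)
  interpret F: finite_measure_subalgebra M "past M U n"
    by unfold_locales (rule subF)
  interpret G: finite_measure_subalgebra M G
    by unfold_locales (rule subG)
  have UG: "U n \<in> borel_measurable G"
    unfolding G_def by (rule measurable_vimage_algebra1) simp
  have iI: "integrable M ?I"
    by (rule integrable_const_bound[of _ 1]) auto
  have ik: "integrable M (\<lambda>x. k (U n x))"
    by (rule integrable_distr[OF U_measurable])
      (use kernel_set_integrable[OF B] in \<open>simp add: distr_U k_def\<close>)
  have "AE x in M. real_cond_exp M G ?I x = k (U n x)"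
  proof (rule G.real_cond_exp_charact[OF _ iI ik])
    show "(\<lambda>x. k (U n x)) \<in> borel_measurable G"
      using UG by measurable
    fix E assume "E \<in> sets G"
    then obtain A where E: "E = U n -` A \<inter> space M" and [measurable]: "A \<in> sets borel"
      unfolding setsG by auto
    have "(\<integral>x\<in>E. ?I x \<partial>M) = (\<integral>x. indicator {x \<in> space M. U n x \<in> A \<and> U (Suc n) x \<in> B} x \<partial>M)"
      unfolding set_lebesgue_integral_def E by (rule Bochner_Integration.integral_cong) (auto simp: indicator_def)
    also have "\<dots> = measure M {x \<in> space M. U n x \<in> A \<and> U (Suc n) x \<in> B}"
      by (simp add: Int_absorb2)
    also have "\<dots> = (\<integral>u. indicator A u * k u \<partial>uniform01)"
      unfolding k_def by (rule measure_joint) auto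
    also have "\<dots> = (\<integral>x. indicator A (U n x) * k (U n x) \<partial>M)"
      unfolding distr_U[of n, symmetric] by (subst integral_distr) auto
    also have "\<dots> = (\<integral>x\<in>E. k (U n x) \<partial>M)"
      unfolding set_lebesgue_integral_def E by (rule Bochner_Integration.integral_cong) (auto simp: indicator_def)
    finally show "(\<integral>x\<in>E. ?I x \<partial>M) = (\<integral>x\<in>E. k (U n x) \<partial>M)" .
  qed
  moreover have "AE x in M. real_cond_exp M (past M U n) ?I x = real_cond_exp M G ?I x"
    using chain B unfolding copula_markov_chain_def markov_chain_def G_def by blast
  ultimately have ae: "AE x in M. real_cond_exp M (past M U n) ?I x = k (U n x)"
    by eventually_elim simp
  have [measurable]: "A \<in> sets M"
    using A subF by (auto simp: subalgebra_def)
  have "measure M (A \<inter> (U (Suc n) -` B \<inter> space M)) = (\<integral>x\<in>A. ?I x \<partial>M)"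
    unfolding set_lebesgue_integral_def by (simp add: indicator_inter_arith[symmetric] Int_absorb2)
  also have "\<dots> = (\<integral>x\<in>A. real_cond_exp M (past M U n) ?I x \<partial>M)"
    by (rule F.real_cond_exp_intA[OF iI A])
  also have "\<dots> = (\<integral>x\<in>A. k (U n x) \<partial>M)"
    by (rule set_lebesgue_integral_cong_AE) (use ae in auto)
  finally show ?thesis
    unfolding k_def set_lebesgue_integral_def by simp
qed

text \<open>Disintegration of the pair (past, next value). Rectangles are covered by \<open>markov_property\<close>; passing to the
  product \<open>\<sigma>\<close>-algebra makes Fubini available for arbitrary integrands.\<close>

lemma past_step_law:
  fixes n defines "F \<equiv> past M U n"
  shows "distr M (F \<Otimes>\<^sub>M borel) (\<lambda>x. (x, U (Suc n) x))
    = density (restr_to_subalg M F \<Otimes>\<^sub>M uniform01) (\<lambda>p. ennreal (kernel (U n (fst p)) (snd p)))"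
proof -
  have subF: "subalgebra M F" unfolding F_def by (rule subalgebra_past) simp
  have spF: "space F = space M" using subF by (simp add: subalgebra_def)
  have UF[measurable]: "U n \<in> borel_measurable F" unfolding F_def by (rule measurable_past) simp
  have idF[measurable]: "(\<lambda>x. x) \<in> measurable M F"
    by (rule measurable_from_subalg[OF subF]) simp
  let ?R = "restr_to_subalg M F"
  have [measurable_cong]: "sets ?R = sets F" by (rule sets_restr_to_subalg[OF subF])
  have sets_eq: "sets (?R \<Otimes>\<^sub>M uniform01) = sets (F \<Otimes>\<^sub>M borel)"
    by (rule sets_pair_measure_cong[OF sets_restr_to_subalg[OF subF] sets_uniform01])
  let ?E = "{a \<times> b | a b. a \<in> sets F \<and> b \<in> sets (borel :: real measure)}"
  show ?thesis
  proof (rule measure_eqI_generator_eq[where E = ?E and \<Omega> = "space F \<times> UNIV" and A = "\<lambda>_. space F \<times> UNIV"])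
    show "Int_stable ?E" by (rule Int_stable_pair_measure_generator)
    show "?E \<subseteq> Pow (space F \<times> UNIV)"
      using sets.sets_into_space by blast
    show "sets (distr M (F \<Otimes>\<^sub>M borel) (\<lambda>x. (x, U (Suc n) x))) = sigma_sets (space F \<times> UNIV) ?E"
      by (simp add: sets_pair_measure)
    show "sets (density (?R \<Otimes>\<^sub>M uniform01) (\<lambda>p. ennreal (kernel (U n (fst p)) (snd p)))) = sigma_sets (space F \<times> UNIV) ?E"
      unfolding sets_density sets_eq by (simp add: sets_pair_measure)
    show "range (\<lambda>_. space F \<times> UNIV) \<subseteq> ?E"
    proof -
      have "space F \<times> UNIV \<in> ?E"
        by (intro CollectI exI[of _ "space F"] exI[of _ "UNIV :: real set"]) simp
      then show ?thesis by blast
    qed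
    show "emeasure (distr M (F \<Otimes>\<^sub>M borel) (\<lambda>x. (x, U (Suc n) x))) (space F \<times> UNIV) \<noteq> \<infinity>" for i :: nat
      by (subst emeasure_distr) auto
    fix X assume "X \<in> ?E"
    then obtain A B where X: "X = A \<times> B" and A[measurable]: "A \<in> sets F" and B[measurable]: "B \<in> sets borel"
      by auto
    define k where "k u = (\<integral>v. indicator B v * kernel u v \<partial>uniform01)" for u
    have [measurable]: "k \<in> borel_measurable borel" unfolding k_def by measurable
    have knn: "0 \<le> k u" for u
      unfolding k_def by (rule Bochner_Integration.integral_nonneg) (simp add: kernel_nonneg)
    have AM[measurable]: "A \<in> sets M" using A subF by (auto simp: subalgebra_def)
    have ik: "integrable M (\<lambda>x. k (U n x))"
    by (rule integrable_distr[OF U_measurable])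
      (use kernel_set_integrable[OF B] in \<open>simp add: distr_U k_def\<close>)
    have "emeasure (distr M (F \<Otimes>\<^sub>M borel) (\<lambda>x. (x, U (Suc n) x))) X
        = emeasure M (A \<inter> (U (Suc n) -` B \<inter> space M))"
      unfolding X by (subst emeasure_distr) (auto intro!: arg_cong[where f = "emeasure M"])
    also have "\<dots> = ennreal (\<integral>x. indicator A x * k (U n x) \<partial>M)"
      unfolding k_def emeasure_eq_measure by (subst markov_property) (use A in \<open>simp_all add: F_def\<close>)
    also have "\<dots> = (\<integral>\<^sup>+x. ennreal (indicator A x * k (U n x)) \<partial>M)"
      by (rule nn_integral_eq_integral[symmetric])
        (use integrable_mult_indicator[OF AM ik] knn in auto)
    also have "\<dots> = (\<integral>\<^sup>+x. (\<integral>\<^sup>+v. ennreal (kernel (U n x) v) * indicator X (x, v) \<partial>uniform01) \<partial>M)"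
    proof (rule nn_integral_cong_AE)
      show "AE x in M. ennreal (indicator A x * k (U n x))
          = (\<integral>\<^sup>+v. ennreal (kernel (U n x) v) * indicator X (x, v) \<partial>uniform01)"
        using AE_U[OF AE_integrable_kernel, of n]
      proof eventually_elim
        case (elim x)
        have "integrable uniform01 (\<lambda>v. indicator B v * kernel (U n x) v)"
          using integrable_mult_indicator[OF _ elim, of B] by simp
        then have "ennreal (k (U n x)) = (\<integral>\<^sup>+v. ennreal (indicator B v * kernel (U n x) v) \<partial>uniform01)"
          unfolding k_def by (intro nn_integral_eq_integral[symmetric]) (auto simp: kernel_nonneg)
        also have "\<dots> = (\<integral>\<^sup>+v. ennreal (kernel (U n x) v) * indicator B v \<partial>uniform01)"
          by (rule nn_integral_cong) (auto simp: indicator_def)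
        finally show ?case
          unfolding X by (cases "x \<in> A") (simp_all add: indicator_times)
      qed
    qed
    also have "\<dots> = (\<integral>\<^sup>+x. (\<integral>\<^sup>+v. ennreal (kernel (U n x) v) * indicator X (x, v) \<partial>uniform01) \<partial>?R)"
      unfolding X by (rule nn_integral_subalgebra2[OF subF, symmetric]) measurable
    also have "\<dots> = (\<integral>\<^sup>+p. ennreal (kernel (U n (fst p)) (snd p)) * indicator X p \<partial>(?R \<Otimes>\<^sub>M uniform01))"
      unfolding X by (subst unif.nn_integral_fst[symmetric]) simp_all
    also have "\<dots> = emeasure (density (?R \<Otimes>\<^sub>M uniform01) (\<lambda>p. ennreal (kernel (U n (fst p)) (snd p)))) X"
      unfolding X by (subst emeasure_density) simp_all
    finally show "emeasure (distr M (F \<Otimes>\<^sub>M borel) (\<lambda>x. (x, U (Suc n) x))) X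
        = emeasure (density (?R \<Otimes>\<^sub>M uniform01) (\<lambda>p. ennreal (kernel (U n (fst p)) (snd p)))) X" .
  qed (auto)
qed

text \<open>The weight \<open>W\<close> is any function of the past for which the integral exists, bounded or not. Complex weights
  cover the characteristic functions, real ones the orthogonality relations.\<close>

lemma markov_step:
  fixes f :: "real \<Rightarrow> real \<Rightarrow> real" and W :: "'a \<Rightarrow> complex"
  assumes W: "W \<in> borel_measurable (past M U n)"
    and f: "(\<lambda>p. f (fst p) (snd p)) \<in> borel_measurable borel"
    and int: "integrable M (\<lambda>x. W x * f (U n x) (U (Suc n) x))"
    and g: "AE u in uniform01. (\<integral>v. f u v * kernel u v \<partial>uniform01) = g u"
    and g_meas[measurable]: "g \<in> borel_measurable borel"
  shows "(\<integral>x. W x * f (U n x) (U (Suc n) x) \<partial>M) = (\<integral>x. W x * g (U n x) \<partial>M)"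
proof -
  define F where "F = past M U n"
  have subF: "subalgebra M F" unfolding F_def by (rule subalgebra_past) simp
  have [measurable]: "U n \<in> borel_measurable F" unfolding F_def by (rule measurable_past) simp
  have [measurable]: "W \<in> borel_measurable F" using W by (simp add: F_def)
  have [measurable]: "(\<lambda>x. x) \<in> measurable M F"
    by (rule measurable_from_subalg[OF subF]) simp
  let ?R = "restr_to_subalg M F"
  have [measurable_cong]: "sets ?R = sets F" by (rule sets_restr_to_subalg[OF subF])
  have f'[measurable (raw)]: "(\<lambda>x. f (a x) (b x)) \<in> borel_measurable N"
    if [measurable]: "a \<in> borel_measurable N" "b \<in> borel_measurable N" for a b and N :: "'c measure"
    using measurable_compose[OF _ f, of "\<lambda>x. (a x, b x)" N] by simp
  define H where "H p = W (fst p) * f (U n (fst p)) (snd p)" for p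
  have [measurable]: "H \<in> borel_measurable (F \<Otimes>\<^sub>M borel)"
    unfolding H_def by measurable
  interpret R: prob_space ?R
    by (rule prob_space_restr_to_subalg[OF subF prob_space_axioms])
  interpret RU: pair_sigma_finite ?R uniform01 ..
  have "integrable (distr M (F \<Otimes>\<^sub>M borel) (\<lambda>x. (x, U (Suc n) x))) H"
    by (subst integrable_distr_eq) (use int in \<open>simp_all add: H_def\<close>)
  then have iH: "integrable (?R \<Otimes>\<^sub>M uniform01) (\<lambda>p. kernel (U n (fst p)) (snd p) *\<^sub>R H p)"
    unfolding F_def past_step_law unfolding F_def[symmetric]
    by (subst (asm) integrable_density) (simp_all add: kernel_nonneg)
  have "(\<integral>x. W x * f (U n x) (U (Suc n) x) \<partial>M)
      = (\<integral>p. H p \<partial>distr M (F \<Otimes>\<^sub>M borel) (\<lambda>x. (x, U (Suc n) x)))"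
    by (subst integral_distr) (simp_all add: H_def)
  also have "\<dots> = (\<integral>p. kernel (U n (fst p)) (snd p) *\<^sub>R H p \<partial>(?R \<Otimes>\<^sub>M uniform01))"
    unfolding F_def past_step_law unfolding F_def[symmetric]
    by (subst integral_density) (simp_all add: kernel_nonneg)
  also have "\<dots> = (\<integral>x. (\<integral>v. kernel (U n x) v *\<^sub>R H (x, v) \<partial>uniform01) \<partial>?R)"
    by (subst RU.integral_fst'[symmetric, OF iH]) simp
  also have "\<dots> = (\<integral>x. W x * (\<integral>v. f (U n x) v * kernel (U n x) v \<partial>uniform01) \<partial>?R)"
  proof (rule Bochner_Integration.integral_cong[OF refl])
    fix x
    have "(\<integral>v. kernel (U n x) v *\<^sub>R H (x, v) \<partial>uniform01)
        = (\<integral>v. W x * complex_of_real (f (U n x) v * kernel (U n x) v) \<partial>uniform01)"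
      by (rule arg_cong[where f = "integral\<^sup>L uniform01"]) (auto simp: H_def scaleR_conv_of_real mult_ac)
    then show "(\<integral>v. kernel (U n x) v *\<^sub>R H (x, v) \<partial>uniform01)
        = W x * (\<integral>v. f (U n x) v * kernel (U n x) v \<partial>uniform01)"
      by (simp only: integral_mult_right_zero integral_complex_of_real)
  qed
  also have "\<dots> = (\<integral>x. W x * (\<integral>v. f (U n x) v * kernel (U n x) v \<partial>uniform01) \<partial>M)"
    by (rule integral_subalgebra2[OF subF]) measurable
  also have "\<dots> = (\<integral>x. W x * g (U n x) \<partial>M)"
  proof (rule integral_cong_AE)
    have [measurable]: "W \<in> borel_measurable M"
      by (rule measurable_from_subalg[OF subF]) simp
    show "(\<lambda>x. W x * complex_of_real (\<integral>v. f (U n x) v * kernel (U n x) v \<partial>uniform01)) \<in> borel_measurable M"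
      by measurable
    show "(\<lambda>x. W x * complex_of_real (g (U n x))) \<in> borel_measurable M"
      by measurable
    show "AE x in M. W x * complex_of_real (\<integral>v. f (U n x) v * kernel (U n x) v \<partial>uniform01)
        = W x * complex_of_real (g (U n x))"
      using AE_U[OF g, of n] by eventually_elim simp
  qed
  finally show ?thesis .
qed

lemma distr_step: "distr M borel (\<lambda>x. (U n x, U (Suc n) x)) = distr M borel (\<lambda>x. (U 0 x, U (Suc 0) x))"
  unfolding joint_law ..

lemma distr_functional_step:
  fixes f :: "real \<Rightarrow> real \<Rightarrow> real"
  assumes f: "(\<lambda>p. f (fst p) (snd p)) \<in> borel_measurable borel"
  shows "distr M borel (\<lambda>x. f (U n x) (U (Suc n) x)) = distr M borel (\<lambda>x. f (U 0 x) (U (Suc 0) x))"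
proof -
  have eq: "distr M borel (\<lambda>x. f (U i x) (U (Suc i) x))
      = distr (distr M borel (\<lambda>x. (U i x, U (Suc i) x))) borel (\<lambda>p. f (fst p) (snd p))" for i
    by (subst distr_distr) (use f in \<open>simp_all add: o_def borel_prod[symmetric]\<close>)
  show ?thesis by (simp only: eq[of n] eq[of 0] distr_step[of n])
qed

lemma expectation_functional_step:
  fixes f :: "real \<Rightarrow> real \<Rightarrow> real"
  assumes f: "(\<lambda>p. f (fst p) (snd p)) \<in> borel_measurable borel"
  shows "(\<integral>x. f (U n x) (U (Suc n) x) \<partial>M) = (\<integral>x. f (U 0 x) (U (Suc 0) x) \<partial>M)"
proof -
  have eq: "(\<integral>x. f (U i x) (U (Suc i) x) \<partial>M) = (\<integral>y. y \<partial>distr M borel (\<lambda>x. f (U i x) (U (Suc i) x)))" for i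
    by (subst integral_distr)
      (use measurable_compose[OF _ f, of "\<lambda>x. (U i x, U (Suc i) x)" M] in \<open>simp_all add: borel_prod[symmetric]\<close>)
  show ?thesis by (simp only: eq[of n] eq[of 0] distr_functional_step[OF f, of n])
qed

lemma integrable_transition:
  fixes f :: "real \<Rightarrow> real \<Rightarrow> real"
  assumes f: "(\<lambda>p. f (fst p) (snd p)) \<in> borel_measurable borel"
    and int: "integrable M (\<lambda>x. f (U n x) (U (Suc n) x))"
  shows "integrable uniform01 (\<lambda>u. \<integral>v. f u v * kernel u v \<partial>uniform01)"
proof -
  have "integrable (distr M borel (\<lambda>x. (U n x, U (Suc n) x))) (\<lambda>p. f (fst p) (snd p))"
    by (subst integrable_distr_eq) (use f int in \<open>simp_all add: borel_prod[symmetric]\<close>)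
  then have "integrable (uniform01 \<Otimes>\<^sub>M uniform01) (\<lambda>p. kernel (fst p) (snd p) *\<^sub>R f (fst p) (snd p))"
    unfolding joint_law
    by (subst (asm) integrable_density)
      (use f kernel_measurable_prod in \<open>simp_all add: kernel_nonneg measurable_cong_sets[OF sets_uniform01_pair refl]\<close>)
  from unif_pair.integrable_fst'[OF this] show ?thesis
    by (simp add: mult.commute)
qed

lemma expectation_transition:
  fixes f :: "real \<Rightarrow> real \<Rightarrow> real"
  assumes f: "(\<lambda>p. f (fst p) (snd p)) \<in> borel_measurable borel"
    and int: "integrable M (\<lambda>x. f (U n x) (U (Suc n) x))"
  shows "(\<integral>x. f (U n x) (U (Suc n) x) \<partial>M) = (\<integral>u. (\<integral>v. f u v * kernel u v \<partial>uniform01) \<partial>uniform01)"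
proof -
  define q where "q u = (\<integral>v. f u v * kernel u v \<partial>uniform01)" for u
  have q: "integrable uniform01 q"
    unfolding q_def by (rule integrable_transition[OF f int])
  then have [measurable]: "q \<in> borel_measurable borel"
    using borel_measurable_integrable by fastforce
  have "complex_of_real (\<integral>x. f (U n x) (U (Suc n) x) \<partial>M) = (\<integral>x. 1 * complex_of_real (f (U n x) (U (Suc n) x)) \<partial>M)"
    by simp
  also have "\<dots> = (\<integral>x. 1 * complex_of_real (q (U n x)) \<partial>M)"
    by (rule markov_step[OF _ f]) (use integrable_of_real[OF int, where 'a = complex] in \<open>simp_all add: q_def[symmetric]\<close>)
  also have "\<dots> = complex_of_real (\<integral>x. q (U n x) \<partial>M)"
    by simp
  also have "(\<integral>x. q (U n x) \<partial>M) = (\<integral>u. q u \<partial>uniform01)"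
    unfolding distr_U[of n, symmetric] by (subst integral_distr) auto
  finally show ?thesis unfolding q_def by (simp only: of_real_eq_iff)
qed

end

section \<open>Fourier expansions in the basis\<close>

lemma L2_01_iff: "L2_01 f \<longleftrightarrow> square_integrable uniform01 f"
proof -
  have m: "borel_measurable uniform01 = (borel_measurable borel :: (real \<Rightarrow> real) set)"
    by (rule measurable_cong_sets) simp_all
  show ?thesis
  proof (cases "f \<in> borel_measurable borel")
  case True
  then have "(\<lambda>x. (f x)\<^sup>2) \<in> borel_measurable borel" by measurable
  from integrable_uniform01[OF this] True show ?thesis
    by (simp add: L2_01_def square_integrable_def)
next
  case False
  then show ?thesis by (simp add: L2_01_def square_integrable_def m)
qed
qed

locale orthonormal_basis =
  fixes \<phi> :: "nat \<Rightarrow> real \<Rightarrow> real"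
  assumes onb: "onb_with_one \<phi>"
begin

lemma basis_square_integrable: "1 \<le> z \<Longrightarrow> square_integrable uniform01 (\<phi> z)"
  using onb by (simp add: onb_with_one_def L2_01_iff)

lemma basis_measurable: "1 \<le> z \<Longrightarrow> \<phi> z \<in> borel_measurable borel"
  using square_integrable_measurable[OF basis_square_integrable] by simp

lemma basis_mean: "1 \<le> z \<Longrightarrow> (\<integral>x. \<phi> z x \<partial>uniform01) = 0"
  using onb integral_uniform01[OF basis_measurable] by (simp add: onb_with_one_def)

lemma basis_orthonormal:
  assumes "1 \<le> z" "1 \<le> w"
  shows "(\<integral>x. \<phi> z x * \<phi> w x \<partial>uniform01) = (if z = w then 1 else 0)"
  using onb assms integral_uniform01[OF borel_measurable_times[OF basis_measurable basis_measurable]]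
  by (simp add: onb_with_one_def)

lemma basis_norm: "1 \<le> z \<Longrightarrow> (\<integral>x. (\<phi> z x)\<^sup>2 \<partial>uniform01) = 1"
  using basis_orthonormal[of z z] by (simp add: power2_eq_square)

text \<open>Leaving out the constant function keeps these combinations of mean zero, as the Poisson equation requires.\<close>

definition comb :: "(nat \<Rightarrow> real) \<Rightarrow> nat \<Rightarrow> real \<Rightarrow> real" where
  "comb a N x = (\<Sum>z=1..N. a z * \<phi> z x)"

lemma comb_square_integrable: "square_integrable uniform01 (comb a N)"
  unfolding comb_def[abs_def]
  by (intro square_integrable_sum square_integrable_cmult basis_square_integrable) simp

lemma comb_measurable [measurable]: "comb a N \<in> borel_measurable borel"
  using square_integrable_measurable[OF comb_square_integrable] by simp

lemma integral_mult_comb: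
  assumes "square_integrable uniform01 f"
  shows "(\<integral>x. f x * comb a N x \<partial>uniform01) = (\<Sum>z=1..N. a z * (\<integral>x. f x * \<phi> z x \<partial>uniform01))"
proof -
  have "(\<integral>x. f x * comb a N x \<partial>uniform01) = (\<integral>x. (\<Sum>z=1..N. a z * (f x * \<phi> z x)) \<partial>uniform01)"
    by (simp add: comb_def sum_distrib_left mult_ac)
  also have "\<dots> = (\<Sum>z=1..N. \<integral>x. a z * (f x * \<phi> z x) \<partial>uniform01)"
    by (rule Bochner_Integration.integral_sum)
      (intro integrable_mult_right square_integrable_mult assms basis_square_integrable; simp)
  finally show ?thesis by simp
qed

lemma integral_comb: "(\<integral>x. comb a N x \<partial>uniform01) = 0"
  using integral_mult_comb[OF unif.square_integrable_const, of 1] by (simp add: basis_mean)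

lemma integral_basis_mult_comb:
  assumes "1 \<le> w"
  shows "(\<integral>x. \<phi> w x * comb a N x \<partial>uniform01) = (if w \<le> N then a w else 0)"
proof -
  have "(\<integral>x. \<phi> w x * comb a N x \<partial>uniform01) = (\<Sum>z=1..N. if w = z then a z else 0)"
    unfolding integral_mult_comb[OF basis_square_integrable[OF assms]]
    using assms by (intro sum.cong) (auto simp: basis_orthonormal)
  then show ?thesis using assms by simp
qed

lemma integral_comb_mult_comb:
  "(\<integral>x. comb b N x * comb a N x \<partial>uniform01) = (\<Sum>z=1..N. a z * b z)"
  unfolding integral_mult_comb[OF comb_square_integrable]
  by (rule sum.cong) (simp_all add: mult.commute[of "comb b N _"] integral_basis_mult_comb)

lemma integral_comb_power2: "(\<integral>x. (comb a N x)\<^sup>2 \<partial>uniform01) = (\<Sum>z=1..N. (a z)\<^sup>2)"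
  using integral_comb_mult_comb[of a N a] by (simp add: power2_eq_square)

definition coef :: "(real \<Rightarrow> real) \<Rightarrow> nat \<Rightarrow> real" where
  "coef f z = (\<integral>x. f x * \<phi> z x \<partial>uniform01)"

text \<open>Pythagoras around the Fourier partial sum. The last two summands are nonnegative and vanish for the
  Fourier coefficients, so this contains both the Bessel inequality and the best approximation property.\<close>

lemma integral_power2_diff_comb:
  assumes f: "square_integrable uniform01 f"
  shows "(\<integral>x. (f x - (r + comb a N x))\<^sup>2 \<partial>uniform01) =
    (\<integral>x. (f x)\<^sup>2 \<partial>uniform01) - (\<integral>x. f x \<partial>uniform01)\<^sup>2 - (\<Sum>z=1..N. (coef f z)\<^sup>2)
    + (r - (\<integral>x. f x \<partial>uniform01))\<^sup>2 + (\<Sum>z=1..N. (a z - coef f z)\<^sup>2)"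
proof -
  let ?c = "\<integral>x. f x \<partial>uniform01"
  note i = square_integrable_power2[OF f] unif.square_integrable_integrable[OF f]
    unif.square_integrable_integrable[OF comb_square_integrable]
    square_integrable_power2[OF comb_square_integrable] square_integrable_mult[OF f comb_square_integrable]
  have "(\<integral>x. (f x - (r + comb a N x))\<^sup>2 \<partial>uniform01) =
    (\<integral>x. (f x)\<^sup>2 + r\<^sup>2 + (comb a N x)\<^sup>2 + 2 * r * comb a N x - 2 * r * f x - 2 * (f x * comb a N x) \<partial>uniform01)"
    by (rule arg_cong[where f = "integral\<^sup>L uniform01"], rule ext) (simp add: power2_eq_square algebra_simps)
  also have "\<dots> = (\<integral>x. (f x)\<^sup>2 \<partial>uniform01) + r\<^sup>2 + (\<Sum>z=1..N. (a z)\<^sup>2) - 2 * r * ?c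
      - 2 * (\<Sum>z=1..N. a z * coef f z)"
    using i by (simp add: integral_comb integral_comb_power2 integral_mult_comb[OF f] measure_uniform01_UNIV coef_def)
  also have "\<dots> = (\<integral>x. (f x)\<^sup>2 \<partial>uniform01) - ?c\<^sup>2 - (\<Sum>z=1..N. (coef f z)\<^sup>2)
      + (r - ?c)\<^sup>2 + (\<Sum>z=1..N. (a z - coef f z)\<^sup>2)"
    by (simp add: power2_diff sum.distrib sum_subtractf sum_distrib_left algebra_simps)
  finally show ?thesis .
qed

text \<open>The partial sums are bounded by Bessel. The approximation of \<open>f\<close> granted by density of the span is no better than
  that by the Fourier partial sum of the same length, so they come arbitrarily close to the bound.\<close>

lemma parseval:
  assumes f: "square_integrable uniform01 f"
  shows "(\<lambda>z. (coef f (Suc z))\<^sup>2) sums ((\<integral>x. (f x)\<^sup>2 \<partial>uniform01) - (\<integral>x. f x \<partial>uniform01)\<^sup>2)"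
proof -
  define L where "L = (\<integral>x. (f x)\<^sup>2 \<partial>uniform01) - (\<integral>x. f x \<partial>uniform01)\<^sup>2"
  define S where "S N = (\<Sum>z<N. (coef f (Suc z))\<^sup>2)" for N
  have S: "S N = (\<Sum>z=1..N. (coef f z)\<^sup>2)" for N
    unfolding S_def by (simp add: sum.atLeast1_atMost_eq)
  have mono: "S n \<le> S N" if "n \<le> N" for n N
    unfolding S_def by (rule sum_mono2) (use that in auto)
  have le: "S N \<le> L" for N
  proof -
    have "0 \<le> (\<integral>x. (f x - ((\<integral>x. f x \<partial>uniform01) + comb (coef f) N x))\<^sup>2 \<partial>uniform01)"
      by simp
    then show ?thesis
      unfolding integral_power2_diff_comb[OF f] S L_def by simp
  qed
  have "S \<longlonglongrightarrow> L"
  proof (rule tendstoI)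
    fix e :: real assume "e > 0"
    then obtain N a where "(LBINT x:{0<..<1}. (f x - (a 0 + (\<Sum>z=1..N. a z * \<phi> z x)))\<^sup>2) < e"
      using onb f unfolding onb_with_one_def L2_01_iff by blast
    moreover have "(\<lambda>x. (f x - (a 0 + comb a N x))\<^sup>2) \<in> borel_measurable borel"
      using square_integrable_measurable[OF f] by simp
    ultimately have "(\<integral>x. (f x - (a 0 + comb a N x))\<^sup>2 \<partial>uniform01) < e"
      by (simp add: integral_uniform01 comb_def)
    then have "L - S N < e"
      unfolding integral_power2_diff_comb[OF f] S L_def
      using zero_le_power2[of "a 0 - (\<integral>x. f x \<partial>uniform01)"] sum_nonneg[of "{1..N}" "\<lambda>z. (a z - coef f z)\<^sup>2", OF zero_le_power2]
      by linarith
    then show "\<forall>\<^sub>F n in sequentially. dist (S n) L < e"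
      using le mono by (intro eventually_sequentiallyI[of N]) (force simp: dist_real_def)
  qed
  then show ?thesis
    unfolding sums_def S_def L_def .
qed

lemma remainder_tendsto_0:
  assumes f: "square_integrable uniform01 f"
  shows "(\<lambda>N. \<integral>x. (f x - ((\<integral>x. f x \<partial>uniform01) + comb (coef f) N x))\<^sup>2 \<partial>uniform01) \<longlonglongrightarrow> 0"
proof -
  let ?L = "(\<integral>x. (f x)\<^sup>2 \<partial>uniform01) - (\<integral>x. f x \<partial>uniform01)\<^sup>2"
  have "(\<lambda>N. ?L - (\<Sum>z<N. (coef f (Suc z))\<^sup>2)) \<longlonglongrightarrow> ?L - ?L"
    using parseval[OF f] unfolding sums_def by (intro tendsto_diff tendsto_const)
  then show ?thesis
    unfolding integral_power2_diff_comb[OF f] by (simp add: sum.atLeast1_atMost_eq)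
qed

text \<open>Truncation makes \<open>f\<close> square-integrable at small cost in \<open>L\<^sup>1\<close>; the Fourier series of the truncated function
  then converges in mean square, hence in \<open>L\<^sup>1\<close>. The constant term is the mean of \<open>f\<close> itself, as required for
  the Poisson equation, and not the mean of the truncation.\<close>

lemma comb_dense_L1:
  assumes f: "integrable uniform01 f" and "\<epsilon> > 0"
  shows "\<exists>a N. (\<integral>x. \<bar>f x - (\<integral>x. f x \<partial>uniform01) - comb a N x\<bar> \<partial>uniform01) < \<epsilon>"
proof -
  have [measurable]: "f \<in> borel_measurable borel"
    using borel_measurable_integrable[OF f] by simp
  have "\<epsilon> / 4 > 0" using \<open>\<epsilon> > 0\<close> by simp
  from order_tendstoD(2)[OF tendsto_integral_truncation[OF f] this]
  obtain n where n: "(\<integral>x. \<bar>f x - max (- real n) (min (real n) (f x))\<bar> \<partial>uniform01) < \<epsilon> / 4"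
    unfolding eventually_sequentially by blast
  define g where "g x = max (- real n) (min (real n) (f x))" for x
  have [measurable]: "g \<in> borel_measurable borel" unfolding g_def by measurable
  have g: "square_integrable uniform01 g"
    by (rule unif.square_integrable_bounded[of _ "real n"]) (auto simp: g_def max_def min_def)
  let ?c = "\<integral>x. f x \<partial>uniform01" and ?d = "\<integral>x. g x \<partial>uniform01"
  have gi: "integrable uniform01 g" by (rule unif.square_integrable_integrable[OF g])
  have fg: "(\<integral>x. \<bar>f x - g x\<bar> \<partial>uniform01) < \<epsilon> / 4" using n by (simp add: g_def)
  have "(\<epsilon> / 4)\<^sup>2 > 0" using \<open>\<epsilon> > 0\<close> by simp
  from order_tendstoD(2)[OF remainder_tendsto_0[OF g] this]
  obtain N where N: "(\<integral>x. (g x - (?d + comb (coef g) N x))\<^sup>2 \<partial>uniform01) < (\<epsilon> / 4)\<^sup>2"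
    unfolding eventually_sequentially by blast
  let ?r = "\<lambda>x. g x - (?d + comb (coef g) N x)"
  have r: "square_integrable uniform01 ?r"
    by (intro square_integrable_diff square_integrable_add g unif.square_integrable_const comb_square_integrable)
  have "(\<integral>x. \<bar>?r x\<bar> \<partial>uniform01) \<le> sqrt (\<integral>x. (?r x)\<^sup>2 \<partial>uniform01)"
    by (rule unif.integral_abs_le_sqrt_integral_power2[OF r])
  also have "\<dots> \<le> \<epsilon> / 4"
    using N \<open>\<epsilon> > 0\<close> by (intro real_le_lsqrt) auto
  finally have r1: "(\<integral>x. \<bar>?r x\<bar> \<partial>uniform01) \<le> \<epsilon> / 4" .
  have "\<bar>?c - ?d\<bar> = \<bar>\<integral>x. f x - g x \<partial>uniform01\<bar>"
    using f gi by simp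
  also have "\<dots> \<le> (\<integral>x. \<bar>f x - g x\<bar> \<partial>uniform01)"
    using integral_norm_bound[of uniform01 "\<lambda>x. f x - g x"] by simp
  finally have cd: "\<bar>?c - ?d\<bar> < \<epsilon> / 4" using fg by simp
  have ri: "integrable uniform01 ?r" by (rule unif.square_integrable_integrable[OF r])
  have ci: "integrable uniform01 (comb (coef g) N)"
    by (rule unif.square_integrable_integrable[OF comb_square_integrable])
  have "(\<integral>x. \<bar>f x - ?c - comb (coef g) N x\<bar> \<partial>uniform01)
      \<le> (\<integral>x. \<bar>f x - g x\<bar> + \<bar>?r x\<bar> + \<bar>?c - ?d\<bar> \<partial>uniform01)"
    by (rule integral_mono) (use f gi ri ci in auto)
  also have "\<dots> = (\<integral>x. \<bar>f x - g x\<bar> \<partial>uniform01) + (\<integral>x. \<bar>?r x\<bar> \<partial>uniform01) + \<bar>?c - ?d\<bar>"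
    using f gi ri by (simp add: measure_uniform01_UNIV)
  also have "\<dots> < \<epsilon>" using fg r1 cd \<open>\<epsilon> > 0\<close> by linarith
  finally show ?thesis by blast
qed

end

section \<open>Basis functions are eigenfunctions of the transition operator\<close>

locale basis_copula_chain = orthonormal_basis \<phi> + prob_space M
  for \<phi> :: "nat \<Rightarrow> real \<Rightarrow> real" and M :: "'a measure" +
  fixes lam :: "nat \<Rightarrow> real" and C :: "real \<Rightarrow> real \<Rightarrow> real" and U :: "nat \<Rightarrow> 'a \<Rightarrow> real"
  assumes conv: "series_converges lam \<phi>"
    and dens: "copula_density C (series_density lam \<phi>)"
    and ch: "copula_markov_chain M C U"
begin

lemma series_density_measurable:
  "(\<lambda>p. series_density lam \<phi> (fst p) (snd p)) \<in> borel_measurable borel"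
proof -
  have [measurable]: "\<phi> (Suc z) \<in> borel_measurable borel" for z
    by (rule basis_measurable) simp
  have "(\<lambda>p. series_density lam \<phi> (fst p) (snd p)) \<in> borel_measurable (borel \<Otimes>\<^sub>M borel)"
    unfolding series_density_def by measurable
  then show ?thesis by (simp add: borel_prod)
qed

sublocale copula_density_chain M C "series_density lam \<phi>" U
  by unfold_locales (fact series_density_measurable dens ch)+

lemma measurable_U_comp: "f \<in> borel_measurable borel \<Longrightarrow> (\<lambda>x. f (U i x)) \<in> borel_measurable M"
  by (rule measurable_compose[OF U_measurable])

lemma integral_U:
  fixes f :: "real \<Rightarrow> real"
  assumes "f \<in> borel_measurable borel"
  shows "(\<integral>x. f (U i x) \<partial>M) = (\<integral>u. f u \<partial>uniform01)"
  using assms unfolding distr_U[of i, symmetric] by (subst integral_distr) auto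

lemma integrable_U:
  fixes f :: "real \<Rightarrow> real"
  assumes "integrable uniform01 f"
  shows "integrable M (\<lambda>x. f (U i x))"
  by (rule integrable_distr[OF U_measurable]) (simp add: distr_U assms)

lemma square_integrable_U:
  assumes "square_integrable uniform01 f"
  shows "square_integrable M (\<lambda>x. f (U i x))"
proof -
  have "f \<in> borel_measurable borel"
    using square_integrable_measurable[OF assms] by simp
  then show ?thesis
    using integrable_U[OF square_integrable_power2[OF assms]] measurable_U_comp
    by (simp add: square_integrable_def)
qed

lemma series_density_commute: "series_density lam \<phi> u v = series_density lam \<phi> v u"
  by (simp add: series_density_def mult_ac)

lemma partial_sums_uniform_limit:
  "uniform_limit ({0<..<1} \<times> {0<..<1}) (\<lambda>N p. 1 + comb (\<lambda>z. lam z * \<phi> z (fst p)) N (snd p))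
    (\<lambda>p. series_density lam \<phi> (fst p) (snd p)) sequentially"
  using conv by (simp add: series_converges_def comb_def)

lemma series_density_section_measurable:
  "series_density lam \<phi> u \<in> borel_measurable borel"
  using measurable_compose[OF _ series_density_measurable, of "\<lambda>v. (u, v)" borel] by simp

text \<open>Term-by-term integration of the series for the density. The right-hand side is the transition
  operator applied to \<open>f\<close>, so the operator multiplies the \<open>z\<close>-th Fourier coefficient by \<open>lam z\<close>.\<close>

lemma integral_mult_series_density:
  assumes f: "square_integrable uniform01 f"
  shows "uniform_limit {0<..<1} (\<lambda>N u. (\<integral>v. f v \<partial>uniform01) + comb (\<lambda>z. lam z * coef f z) N u)
    (\<lambda>u. \<integral>v. f v * series_density lam \<phi> u v \<partial>uniform01) sequentially"
proof -
  let ?S = "\<lambda>N u v. 1 + comb (\<lambda>z. lam z * \<phi> z u) N v"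
  have fi: "integrable uniform01 f" by (rule unif.square_integrable_integrable[OF f])
  have S: "square_integrable uniform01 (?S N u)" for N u
    by (intro square_integrable_add unif.square_integrable_const comb_square_integrable)
  have "(\<integral>v. f v * ?S N u v \<partial>uniform01) = (\<integral>v. f v \<partial>uniform01) + comb (\<lambda>z. lam z * coef f z) N u" for N u
  proof -
    have "(\<integral>v. f v * ?S N u v \<partial>uniform01)
        = (\<integral>v. f v \<partial>uniform01) + (\<integral>v. f v * comb (\<lambda>z. lam z * \<phi> z u) N v \<partial>uniform01)"
      using fi square_integrable_mult[OF f comb_square_integrable] by (simp add: distrib_left)
    then show ?thesis
      unfolding integral_mult_comb[OF f] by (simp add: comb_def coef_def mult_ac)
  qed
  then show ?thesis
    using integral_mult_uniform_limit(2)[OF partial_sums_uniform_limit _ fi square_integrable_mult[OF f S]]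
      series_density_section_measurable
    by (simp add: AE_uniform01)
qed

lemma AE_kernel_integral:
  "AE u in uniform01. u \<in> {0<..<1} \<and>
    (\<forall>f \<in> borel_measurable borel. (\<integral>v. f v * kernel u v \<partial>uniform01) = (\<integral>v. f v * series_density lam \<phi> u v \<partial>uniform01))"
proof -
  have "AE u in uniform01. u \<in> {0<..<1}" by (simp add: AE_uniform01)
  then show ?thesis
    using AE_AE_kernel_eq
  proof eventually_elim
    case (elim u)
    note [measurable] = series_density_section_measurable
    show ?case
      using elim by (auto intro!: integral_cong_AE elim!: AE_mp)
  qed
qed

text \<open>All Fourier coefficients of \<open>\<phi> z\<close> but the \<open>z\<close>-th vanish, so the sequence of partial sums is eventually
  constant.\<close>

lemma eigenfunction:
  assumes "1 \<le> z"
  shows "AE u in uniform01. (\<integral>v. \<phi> z v * kernel u v \<partial>uniform01) = lam z * \<phi> z u"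
  using AE_kernel_integral
proof eventually_elim
  case (elim u)
  have "(\<lambda>N. (\<integral>v. \<phi> z v \<partial>uniform01) + comb (\<lambda>w. lam w * coef (\<phi> z) w) N u)
      \<longlonglongrightarrow> (\<integral>v. \<phi> z v * series_density lam \<phi> u v \<partial>uniform01)"
    using tendsto_uniform_limitI[OF integral_mult_series_density[OF basis_square_integrable[OF assms]]] elim by blast
  moreover have "(\<lambda>N. (\<integral>v. \<phi> z v \<partial>uniform01) + comb (\<lambda>w. lam w * coef (\<phi> z) w) N u)
      \<longlonglongrightarrow> lam z * \<phi> z u"
  proof (rule tendsto_eventually, rule eventually_sequentiallyI[of z])
    fix N assume "z \<le> N"
    have "comb (\<lambda>w. lam w * coef (\<phi> z) w) N u = (\<Sum>w=1..N. if z = w then lam w * \<phi> w u else 0)"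
      unfolding comb_def coef_def using assms by (intro sum.cong) (auto simp: basis_orthonormal)
    then show "(\<integral>v. \<phi> z v \<partial>uniform01) + comb (\<lambda>w. lam w * coef (\<phi> z) w) N u = lam z * \<phi> z u"
      using assms \<open>z \<le> N\<close> by (simp add: basis_mean)
  qed
  ultimately show ?case
    using elim basis_measurable[OF assms] LIMSEQ_unique by metis
qed

lemma step_basis_complex:
  fixes W :: "'a \<Rightarrow> complex"
  assumes z: "1 \<le> z" and W: "W \<in> borel_measurable (past M U n)"
    and int: "integrable M (\<lambda>x. W x * \<phi> z (U (Suc n) x))"
  shows "(\<integral>x. W x * \<phi> z (U (Suc n) x) \<partial>M) = (\<integral>x. W x * (lam z * \<phi> z (U n x)) \<partial>M)"
proof -
  note [measurable] = basis_measurable[OF z]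
  have "(\<integral>x. W x * (\<lambda>u v. \<phi> z v) (U n x) (U (Suc n) x) \<partial>M)
      = (\<integral>x. W x * (\<lambda>u. lam z * \<phi> z u) (U n x) \<partial>M)"
    by (rule markov_step[OF W]) (use int eigenfunction[OF z] in \<open>simp_all add: borel_prod[symmetric]\<close>)
  then show ?thesis by simp
qed

lemma step_basis:
  fixes W :: "'a \<Rightarrow> real"
  assumes z: "1 \<le> z" and W[measurable]: "W \<in> borel_measurable (past M U n)"
    and int: "integrable M (\<lambda>x. W x * \<phi> z (U (Suc n) x))"
  shows "(\<integral>x. W x * \<phi> z (U (Suc n) x) \<partial>M) = lam z * (\<integral>x. W x * \<phi> z (U n x) \<partial>M)"
proof -
  have "complex_of_real (\<integral>x. W x * \<phi> z (U (Suc n) x) \<partial>M)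
      = (\<integral>x. complex_of_real (W x) * \<phi> z (U (Suc n) x) \<partial>M)"
    by (simp flip: integral_complex_of_real)
  also have "\<dots> = (\<integral>x. complex_of_real (W x) * (lam z * \<phi> z (U n x)) \<partial>M)"
    by (rule step_basis_complex[OF z]) (use integrable_of_real[OF int, where 'a = complex] in simp_all)
  also have "\<dots> = complex_of_real (\<integral>x. lam z * (W x * \<phi> z (U n x)) \<partial>M)"
    unfolding integral_complex_of_real[symmetric] by (simp add: mult_ac)
  finally have "(\<integral>x. W x * \<phi> z (U (Suc n) x) \<partial>M) = (\<integral>x. lam z * (W x * \<phi> z (U n x)) \<partial>M)"
    by (simp only: of_real_eq_iff)
  then show ?thesis by simp
qed

lemma past_comp:
  "i \<le> n \<Longrightarrow> f \<in> borel_measurable borel \<Longrightarrow> (\<lambda>x. f (U i x)) \<in> borel_measurable (past M U n)"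
  using measurable_compose[OF measurable_past] by blast

lemma expectation_basis_basis:
  assumes "1 \<le> z" "1 \<le> w"
  shows "(\<integral>x. \<phi> z (U n x) * \<phi> w (U (Suc n) x) \<partial>M) = (if z = w then lam z else 0)"
proof -
  have "(\<integral>x. \<phi> z (U n x) * \<phi> w (U (Suc n) x) \<partial>M) = lam w * (\<integral>x. \<phi> z (U n x) * \<phi> w (U n x) \<partial>M)"
    by (rule step_basis) (intro assms past_comp basis_measurable order_refl
        square_integrable_mult square_integrable_U basis_square_integrable)+
  also have "(\<integral>x. \<phi> z (U n x) * \<phi> w (U n x) \<partial>M) = (if z = w then 1 else 0)"
    using integral_U[of "\<lambda>u. \<phi> z u * \<phi> w u" n] assms
    by (simp add: basis_orthonormal borel_measurable_times basis_measurable)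
  finally show ?thesis by simp
qed

lemma expectation_increment_power2:
  assumes "1 \<le> z"
  shows "(\<integral>x. (\<phi> z (U (Suc n) x) + s * \<phi> z (U n x))\<^sup>2 \<partial>M) = 1 + s\<^sup>2 + 2 * s * lam z"
proof -
  note sq = square_integrable_U[OF basis_square_integrable[OF assms]]
  have p2: "(\<integral>x. (\<phi> z (U i x))\<^sup>2 \<partial>M) = 1" for i
    using integral_U[of "\<lambda>u. (\<phi> z u)\<^sup>2" i] assms
    by (simp add: basis_norm borel_measurable_power basis_measurable)
  have "(\<integral>x. (\<phi> z (U (Suc n) x) + s * \<phi> z (U n x))\<^sup>2 \<partial>M)
      = (\<integral>x. (\<phi> z (U (Suc n) x))\<^sup>2 + s\<^sup>2 * (\<phi> z (U n x))\<^sup>2 + 2 * s * (\<phi> z (U n x) * \<phi> z (U (Suc n) x)) \<partial>M)"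
    by (simp add: power2_sum power_mult_distrib mult_ac)
  also have "\<dots> = 1 + s\<^sup>2 + 2 * s * lam z"
    using square_integrable_power2[OF sq] square_integrable_mult[OF sq sq] assms
    by (simp add: p2 expectation_basis_basis)
  finally show ?thesis .
qed

text \<open>Both \<open>2 + 2 * lam z\<close> and \<open>2 - 2 * lam z\<close> are second moments.\<close>

lemma abs_lam_le_1:
  assumes "1 \<le> z"
  shows "\<bar>lam z\<bar> \<le> 1"
proof -
  have "0 \<le> (\<integral>x. (\<phi> z (U (Suc 0) x) + s * \<phi> z (U 0 x))\<^sup>2 \<partial>M)" for s
    by simp
  from this[of 1] this[of "-1"] show ?thesis
    unfolding expectation_increment_power2[OF assms] by simp
qed

text \<open>Reversibility: the density is symmetric.\<close>

lemma expectation_swap: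
  fixes f :: "real \<Rightarrow> real \<Rightarrow> real"
  assumes f: "(\<lambda>p. f (fst p) (snd p)) \<in> borel_measurable borel"
  shows "(\<integral>x. f (U n x) (U (Suc n) x) \<partial>M) = (\<integral>x. f (U (Suc n) x) (U n x) \<partial>M)"
proof -
  have f'[measurable (raw)]: "(\<lambda>x. f (a x) (b x)) \<in> borel_measurable N"
    if [measurable]: "a \<in> borel_measurable N" "b \<in> borel_measurable N" for a b and N :: "'c measure"
    using measurable_compose[OF _ f, of "\<lambda>x. (a x, b x)" N] by simp
  have sym: "kernel u v = kernel v u" for u v
    unfolding kernel_def by (simp add: series_density_commute)
  have E: "(\<integral>x. g (U n x) (U (Suc n) x) \<partial>M)
      = (\<integral>p. kernel (fst p) (snd p) * g (fst p) (snd p) \<partial>(uniform01 \<Otimes>\<^sub>M uniform01))"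
    if g: "(\<lambda>p. g (fst p) (snd p)) \<in> borel_measurable borel" for g :: "real \<Rightarrow> real \<Rightarrow> real"
  proof -
    have "(\<integral>x. g (U n x) (U (Suc n) x) \<partial>M)
        = (\<integral>p. g (fst p) (snd p) \<partial>distr M borel (\<lambda>x. (U n x, U (Suc n) x)))"
      by (subst integral_distr) (use g in \<open>simp_all add: borel_prod[symmetric]\<close>)
    also have "\<dots> = (\<integral>p. kernel (fst p) (snd p) *\<^sub>R g (fst p) (snd p) \<partial>(uniform01 \<Otimes>\<^sub>M uniform01))"
      unfolding joint_law
      by (rule integral_density) (use g kernel_measurable_prod in \<open>simp_all add: kernel_nonneg measurable_cong_sets[OF sets_uniform01_pair refl]\<close>)
    finally show ?thesis by simp
  qed
  have "(\<integral>x. f (U (Suc n) x) (U n x) \<partial>M)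
      = (\<integral>p. kernel (fst p) (snd p) * f (snd p) (fst p) \<partial>(uniform01 \<Otimes>\<^sub>M uniform01))"
    by (rule E) (simp add: borel_prod[symmetric])
  also have "\<dots> = (\<integral>(x, y). (\<lambda>p. kernel (fst p) (snd p) * f (fst p) (snd p)) (y, x) \<partial>(uniform01 \<Otimes>\<^sub>M uniform01))"
    by (rule Bochner_Integration.integral_cong[OF refl]) (auto simp: sym)
  also have "\<dots> = (\<integral>p. kernel (fst p) (snd p) * f (fst p) (snd p) \<partial>(uniform01 \<Otimes>\<^sub>M uniform01))"
    by (rule unif_pair.integral_product_swap) measurable
  also have "\<dots> = (\<integral>x. f (U n x) (U (Suc n) x) \<partial>M)"
    by (rule E[OF f, symmetric])
  finally show ?thesis by simp
qed

lemma lambda_hat_eq: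
  "lambda_hat \<phi> k U n x = 1 / real n * (\<Sum>i<n. \<phi> k (U i x) * \<phi> k (U (Suc i) x))"
  by (simp add: lambda_hat_def sum.atLeast1_atMost_eq mult.commute)

lemma lambda_hat_measurable:
  assumes "1 \<le> k" shows "lambda_hat \<phi> k U n \<in> borel_measurable M"
proof -
  note [measurable] = basis_measurable[OF assms]
  show ?thesis unfolding lambda_hat_eq[abs_def] by measurable
qed

lemma lambda_hat_unbiased:
  assumes k: "1 \<le> k" and n: "1 \<le> n"
  shows "unbiased M (lambda_hat \<phi> k U n) (lam k)"
proof -
  have i: "integrable M (\<lambda>x. \<phi> k (U i x) * \<phi> k (U (Suc i) x))" for i
    by (intro square_integrable_mult square_integrable_U basis_square_integrable k)
  show ?thesis
    unfolding unbiased_def lambda_hat_eq[abs_def]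
    using i n by (simp add: Bochner_Integration.integral_sum expectation_basis_basis[OF k k])
qed

text \<open>A positive density makes the joint law and Lebesgue measure on the square equivalent.\<close>

lemma AE_AE_if_AE_joint:
  assumes pos: "AE p in lborel. p \<in> {0<..<1} \<times> {0<..<1} \<longrightarrow> 0 < series_density lam \<phi> (fst p) (snd p)"
    and P: "AE p in distr M borel (\<lambda>x. (U 0 x, U (Suc 0) x)). P (fst p) (snd p)"
  shows "AE u in uniform01. AE v in uniform01. P u v"
proof -
  have "AE p in uniform01 \<Otimes>\<^sub>M uniform01. 0 < ennreal (kernel (fst p) (snd p)) \<longrightarrow> P (fst p) (snd p)"
    using P unfolding joint_law by (subst (asm) AE_density) auto
  moreover have "AE p in uniform01 \<Otimes>\<^sub>M uniform01. 0 < series_density lam \<phi> (fst p) (snd p)"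
    unfolding AE_uniform01_pair by (rule pos)
  ultimately have "AE p in uniform01 \<Otimes>\<^sub>M uniform01. P (fst p) (snd p)"
    by eventually_elim (simp add: kernel_def)
  from unif_pair.AE_pair[OF this] show ?thesis by simp
qed

lemma basis_not_AE_constant:
  assumes z: "1 \<le> z" shows "\<not> (AE u in uniform01. \<phi> z u = r)"
proof
  assume ae: "AE u in uniform01. \<phi> z u = r"
  note [measurable] = basis_measurable[OF z]
  have "(\<integral>u. \<phi> z u \<partial>uniform01) = (\<integral>u. r \<partial>uniform01)"
    by (rule integral_cong_AE) (use ae in auto)
  then have "r = 0" using z by (simp add: basis_mean)
  have "(\<integral>u. (\<phi> z u)\<^sup>2 \<partial>uniform01) = (\<integral>u. r\<^sup>2 \<partial>uniform01)"
    by (rule integral_cong_AE) (use ae in auto)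
  then show False using z \<open>r = 0\<close> by (simp add: basis_norm)
qed

text \<open>For \<open>lam z = 1\<close> the increments \<open>\<phi> z (U 1) - \<phi> z (U 0)\<close> have second moment \<open>2 - 2 * lam z = 0\<close>. With a
  positive density, \<open>\<phi> z u = \<phi> z v\<close> for almost all \<open>u\<close> and \<open>v\<close>, so \<open>\<phi> z\<close> is constant.\<close>

lemma lam_ne_1_if_positive:
  assumes pos: "AE p in lborel. p \<in> {0<..<1} \<times> {0<..<1} \<longrightarrow> 0 < series_density lam \<phi> (fst p) (snd p)"
    and z: "1 \<le> z"
  shows "lam z \<noteq> 1"
proof
  assume "lam z = 1"
  note [measurable] = basis_measurable[OF z]
  note zsq = square_integrable_U[OF basis_square_integrable[OF z]]
  have "(\<integral>x. (\<phi> z (U (Suc 0) x) + - 1 * \<phi> z (U 0 x))\<^sup>2 \<partial>M) = 0"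
    unfolding expectation_increment_power2[OF z] using \<open>lam z = 1\<close> by simp
  then have "AE x in M. (\<phi> z (U (Suc 0) x) + - 1 * \<phi> z (U 0 x))\<^sup>2 = 0"
    by (subst (asm) integral_nonneg_eq_0_iff_AE)
      (intro square_integrable_power2 square_integrable_add square_integrable_cmult zsq, auto)
  then have "AE p in distr M borel (\<lambda>x. (U 0 x, U (Suc 0) x)). \<phi> z (snd p) = \<phi> z (fst p)"
    by (subst AE_distr_iff) (simp_all add: borel_prod[symmetric])
  from AE_AE_if_AE_joint[OF pos this]
  have "AE u in uniform01. AE v in uniform01. \<phi> z v = \<phi> z u" .
  then obtain u where "AE v in uniform01. \<phi> z v = \<phi> z u"
    using eventually_happens'[OF unif.ae_filter_bot] by blast
  then show False using basis_not_AE_constant[OF z] by blast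
qed

end

section \<open>The Poisson equation and the variance of additive functionals\<close>

text \<open>In either case the absolute values above \<open>1/2\<close> form a finite set, so the bound is
  \<open>1/2\<close> or the largest of them other than \<open>1\<close>.\<close>

lemma spectral_gap:
  fixes x :: "nat \<Rightarrow> real"
  assumes "finite ((\<lambda>z. \<bar>x z\<bar>) ` {1..}) \<or> (\<lambda>z. \<bar>x z\<bar>) \<longlonglongrightarrow> 0"
    and le1: "\<And>z. 1 \<le> z \<Longrightarrow> \<bar>x z\<bar> \<le> 1"
  obtains \<rho> where "0 \<le> \<rho>" "\<rho> < 1" "\<And>z. 1 \<le> z \<Longrightarrow> \<bar>x z\<bar> \<noteq> 1 \<Longrightarrow> \<bar>x z\<bar> \<le> \<rho>"
proof -
  have "\<exists>I. finite ((\<lambda>z. \<bar>x z\<bar>) ` I) \<and> I \<subseteq> {1..} \<and> (\<forall>z\<ge>1. z \<notin> I \<longrightarrow> \<bar>x z\<bar> \<le> 1/2)"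
    using assms(1)
  proof
    assume "(\<lambda>z. \<bar>x z\<bar>) \<longlonglongrightarrow> 0"
    then have "\<forall>\<^sub>F z in sequentially. \<bar>x z\<bar> < 1/2" by (rule order_tendstoD) simp
    then obtain N where "\<And>z. N \<le> z \<Longrightarrow> \<bar>x z\<bar> < 1/2" unfolding eventually_sequentially by blast
    then show ?thesis by (intro exI[of _ "{1..<N}"]) (auto simp: not_less intro: less_imp_le)
  qed (intro exI[of _ "{1..}"]; auto)
  then obtain I where I: "finite ((\<lambda>z. \<bar>x z\<bar>) ` I)" "I \<subseteq> {1..}" "\<And>z. 1 \<le> z \<Longrightarrow> z \<notin> I \<Longrightarrow> \<bar>x z\<bar> \<le> 1/2"
    by blast
  define S where "S = insert (1/2) ((\<lambda>z. \<bar>x z\<bar>) ` I - {1})"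
  have S: "finite S" "S \<noteq> {}" using I(1) by (auto simp: S_def)
  show ?thesis
  proof (rule that[of "Max S"])
    have "1/2 \<le> Max S" using S by (intro Max_ge) (auto simp: S_def)
    then show "0 \<le> Max S" by simp
    show "Max S < 1"
      using S I(2) le1 by (subst Max_less_iff) (force simp: S_def intro: le_neq_trans)+
    show "\<bar>x z\<bar> \<le> Max S" if "1 \<le> z" "\<bar>x z\<bar> \<noteq> 1" for z
    proof (cases "z \<in> I")
      case True
      then show ?thesis using S that by (intro Max_ge) (auto simp: S_def)
    next
      case False
      then show ?thesis using I(3)[OF that(1)] \<open>1/2 \<le> Max S\<close> by simp
    qed
  qed
qed

locale ergodic_copula_chain = basis_copula_chain +
  assumes gap: "finite ((\<lambda>z. \<bar>lam z\<bar>) ` {1..}) \<or> (\<lambda>z. \<bar>lam z\<bar>) \<longlonglongrightarrow> 0"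
    and lam_ne_1: "1 \<le> z \<Longrightarrow> lam z \<noteq> 1"
begin

text \<open>An eigenvalue of modulus \<open>1\<close> can only be \<open>-1\<close>, which is far from \<open>1\<close>; the others are covered by the
  spectral gap.\<close>

lemma poisson_gap:
  obtains \<kappa> where "0 < \<kappa>" "\<And>z. 1 \<le> z \<Longrightarrow> \<kappa> \<le> 1 - lam z"
proof -
  obtain \<rho> where \<rho>: "0 \<le> \<rho>" "\<rho> < 1" "\<And>z. 1 \<le> z \<Longrightarrow> \<bar>lam z\<bar> \<noteq> 1 \<Longrightarrow> \<bar>lam z\<bar> \<le> \<rho>"
    using spectral_gap[OF gap abs_lam_le_1] by metis
  show ?thesis
  proof (rule that[of "1 - \<rho>"])
    show "1 - \<rho> \<le> 1 - lam z" if "1 \<le> z" for z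
    proof (cases "\<bar>lam z\<bar> = 1")
      case True
      then show ?thesis using lam_ne_1[OF that] \<rho> by (auto simp: abs_if split: if_splits)
    next
      case False
      then show ?thesis using \<rho>(3)[OF that] by (simp add: abs_le_iff)
    qed
  qed (use \<rho> in simp)
qed

text \<open>\<open>poisson a N\<close> solves the Poisson equation for \<open>comb a N\<close>, and \<open>poisson_step a N\<close> is its image under the
  transition operator.\<close>

definition poisson :: "(nat \<Rightarrow> real) \<Rightarrow> nat \<Rightarrow> real \<Rightarrow> real" where
  "poisson a = comb (\<lambda>z. a z / (1 - lam z))"

definition poisson_step :: "(nat \<Rightarrow> real) \<Rightarrow> nat \<Rightarrow> real \<Rightarrow> real" where
  "poisson_step a = comb (\<lambda>z. lam z * (a z / (1 - lam z)))"

lemma poisson_square_integrable: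
  "square_integrable uniform01 (poisson a N)" "square_integrable uniform01 (poisson_step a N)"
  unfolding poisson_def poisson_step_def by (rule comb_square_integrable)+

lemma poisson_measurable [measurable]:
  "poisson a N \<in> borel_measurable borel" "poisson_step a N \<in> borel_measurable borel"
  unfolding poisson_def poisson_step_def by measurable

lemma poisson_equation: "poisson a N u - poisson_step a N u = comb a N u"
proof -
  have "a z / (1 - lam z) - lam z * (a z / (1 - lam z)) = a z" if "z \<in> {1..N}" for z
  proof -
    have "a z / (1 - lam z) - lam z * (a z / (1 - lam z)) = (1 - lam z) * (a z / (1 - lam z))"
      by (simp only: left_diff_distrib mult_1)
    then show ?thesis using lam_ne_1[of z] that by simp
  qed
  then show ?thesis
    unfolding poisson_def poisson_step_def comb_def sum_subtractf[symmetric]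
    by (intro sum.cong refl) (metis left_diff_distrib mult.commute)
qed

lemma poisson_norm_le:
  "(\<integral>u. (poisson_step a N u)\<^sup>2 \<partial>uniform01) \<le> (\<integral>u. (poisson a N u)\<^sup>2 \<partial>uniform01)"
  unfolding poisson_def poisson_step_def integral_comb_power2
proof (rule sum_mono)
  fix z assume "z \<in> {1..N}"
  then have "(lam z)\<^sup>2 \<le> 1"
    using abs_lam_le_1[of z] by (simp add: abs_square_le_1)
  then show "(lam z * (a z / (1 - lam z)))\<^sup>2 \<le> (a z / (1 - lam z))\<^sup>2"
    unfolding power_mult_distrib[of "lam z"] by (intro mult_left_le_one_le) auto
qed

lemma step_poisson:
  fixes W :: "'a \<Rightarrow> complex"
  assumes W: "W \<in> borel_measurable (past M U n)" and W2: "square_integrable M (\<lambda>x. cmod (W x))"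
  shows "(\<integral>x. W x * poisson a N (U (Suc n) x) \<partial>M) = (\<integral>x. W x * poisson_step a N (U n x) \<partial>M)"
proof -
  have WM: "W \<in> borel_measurable M"
    by (rule measurable_from_subalg[OF subalgebra_past W]) simp
  have int: "integrable M (\<lambda>x. W x * complex_of_real (\<phi> z (U i x)))" if "z \<in> {1..N}" for z i
    using that by (intro integrable_complex_mult_real[OF WM W2] square_integrable_U basis_square_integrable) auto
  have expand: "(\<integral>x. W x * comb c N (U i x) \<partial>M)
      = (\<Sum>z=1..N. c z * (\<integral>x. W x * \<phi> z (U i x) \<partial>M))" for c i
  proof -
    have "(\<integral>x. W x * comb c N (U i x) \<partial>M)
        = (\<integral>x. (\<Sum>z=1..N. complex_of_real (c z) * (W x * \<phi> z (U i x))) \<partial>M)"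
      unfolding comb_def by (simp add: sum_distrib_left mult_ac)
    also have "\<dots> = (\<Sum>z=1..N. \<integral>x. complex_of_real (c z) * (W x * \<phi> z (U i x)) \<partial>M)"
      using int by (intro Bochner_Integration.integral_sum integrable_mult_right) auto
    finally show ?thesis by simp
  qed
  have "(\<integral>x. W x * complex_of_real (lam z * \<phi> z (U n x)) \<partial>M)
      = lam z * (\<integral>x. W x * \<phi> z (U n x) \<partial>M)" for z
  proof -
    have "(\<integral>x. W x * complex_of_real (lam z * \<phi> z (U n x)) \<partial>M)
        = (\<integral>x. complex_of_real (lam z) * (W x * \<phi> z (U n x)) \<partial>M)"
      by (simp add: mult_ac)
    then show ?thesis by simp
  qed
  then have "(\<integral>x. W x * \<phi> z (U (Suc n) x) \<partial>M) = lam z * (\<integral>x. W x * \<phi> z (U n x) \<partial>M)" if "z \<in> {1..N}" for z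
    using step_basis_complex[OF _ W int[OF that]] that by simp
  then show ?thesis
    unfolding poisson_def poisson_step_def expand
    by (intro sum.cong refl) (simp add: mult_ac)
qed

text \<open>With \<open>h = poisson a N\<close>, the sum is that of the orthogonal differences \<open>h (U (i + 1)) - T h (U i)\<close> plus the
  boundary term \<open>h (U 0) - h (U n)\<close>, each with second moment at most \<open>4 * \<integral> h\<^sup>2\<close>.\<close>

lemma variance_comb_sum_le:
  "(\<integral>x. (\<Sum>i<n. comb a N (U i x))\<^sup>2 \<partial>M) \<le> 16 * real n * (\<integral>u. (poisson a N u)\<^sup>2 \<partial>uniform01)"
proof (cases "n = 0")
  case False
  define H where "H = (\<integral>u. (poisson a N u)\<^sup>2 \<partial>uniform01)"
  define \<xi> where "\<xi> i x = poisson a N (U (Suc i) x) - poisson_step a N (U i x)" for i x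
  note sq = square_integrable_U[OF poisson_square_integrable(1)] square_integrable_U[OF poisson_square_integrable(2)]
  have \<xi>: "square_integrable M (\<xi> i)" for i
    unfolding \<xi>_def by (intro square_integrable_diff sq)
  have pH: "(\<integral>x. (poisson a N (U i x))\<^sup>2 \<partial>M) = H" for i
    unfolding H_def by (rule integral_U) measurable
  have pH': "(\<integral>x. (poisson_step a N (U i x))\<^sup>2 \<partial>M) \<le> H" for i
    using poisson_norm_le[of a N] unfolding H_def by (subst integral_U) measurable
  have neg: "square_integrable M (\<lambda>x. - f x)" if "square_integrable M f" for f
    using square_integrable_cmult[OF that, of "-1"] by simp
  have \<xi>2: "(\<integral>x. (\<xi> i x)\<^sup>2 \<partial>M) \<le> 4 * H" for i
    using integral_power2_add_le[OF sq(1) neg[OF sq(2)], of a N "Suc i" a N i] pH[of "Suc i"] pH'[of i]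
    by (simp add: \<xi>_def)
  have orth: "(\<integral>x. (\<Sum>i<m. \<xi> i x) * \<xi> m x \<partial>M) = 0" for m
  proof -
    let ?S = "\<lambda>x. \<Sum>i<m. \<xi> i x"
    have S: "square_integrable M ?S" using \<xi> by auto
    have Sp: "?S \<in> borel_measurable (past M U m)"
      unfolding \<xi>_def by (intro borel_measurable_sum borel_measurable_diff past_comp) auto
    have "complex_of_real (\<integral>x. ?S x * poisson a N (U (Suc m) x) \<partial>M)
        = complex_of_real (\<integral>x. ?S x * poisson_step a N (U m x) \<partial>M)"
      using step_poisson[of "\<lambda>x. complex_of_real (?S x)" m a N] Sp square_integrable_power2[OF S] square_integrable_measurable[OF S]
      unfolding integral_complex_of_real[symmetric]
      by (simp add: square_integrable_def del: of_real_sum)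
    then show ?thesis
      using square_integrable_mult[OF S sq(1)] square_integrable_mult[OF S sq(2)]
      by (simp add: \<xi>_def[of m] right_diff_distrib del: of_real_sum)
  qed
  have decomp: "(\<Sum>i<m. comb a N (U i x)) = (\<Sum>i<m. \<xi> i x) + (poisson a N (U 0 x) + - poisson a N (U m x))" for x m
    by (induction m) (simp_all add: \<xi>_def poisson_equation[symmetric])
  have "(\<integral>x. (\<Sum>i<n. comb a N (U i x))\<^sup>2 \<partial>M)
      \<le> 2 * (\<integral>x. (\<Sum>i<n. \<xi> i x)\<^sup>2 \<partial>M) + 2 * (\<integral>x. (poisson a N (U 0 x) + - poisson a N (U n x))\<^sup>2 \<partial>M)"
    unfolding decomp by (intro integral_power2_add_le square_integrable_sum square_integrable_add neg \<xi> sq)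
  also have "\<dots> \<le> 2 * (\<Sum>i<n. 4 * H) + 2 * (4 * H)"
    unfolding integral_power2_orthogonal_sum[OF \<xi> orth]
    using integral_power2_add_le[OF sq(1) neg[OF sq(1)], of a N 0 a N n]
    by (intro add_mono mult_left_mono sum_mono \<xi>2) (simp_all add: pH)
  also have "\<dots> = 8 * (real n + 1) * H" by (simp add: algebra_simps)
  also have "\<dots> \<le> 16 * real n * H"
    using False by (intro mult_right_mono) (auto simp: H_def)
  finally show ?thesis unfolding H_def .
qed simp

text \<open>The bound for Fourier partial sums carries over: for fixed \<open>n\<close>, the contribution of the remainder is at most
  \<open>2 * n\<^sup>2\<close> times its squared norm, which vanishes as the partial sums grow. Dividing coefficients by
  \<open>1 - lam z \<ge> \<kappa>\<close> costs the factor \<open>1 / \<kappa>\<^sup>2\<close>.\<close>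

lemma variance_sum_bound:
  obtains K where "0 \<le> K"
    "\<And>f n. square_integrable uniform01 f \<Longrightarrow> (\<integral>u. f u \<partial>uniform01) = 0 \<Longrightarrow>
      (\<integral>x. (\<Sum>i<n. f (U i x))\<^sup>2 \<partial>M) \<le> K * real n * (\<integral>u. (f u)\<^sup>2 \<partial>uniform01)"
proof -
  obtain \<kappa> where \<kappa>: "0 < \<kappa>" "\<And>z. 1 \<le> z \<Longrightarrow> \<kappa> \<le> 1 - lam z"
    by (rule poisson_gap) blast
  show ?thesis
  proof (rule that[of "32 / \<kappa>\<^sup>2"])
    fix f n assume f: "square_integrable uniform01 f" and f0: "(\<integral>u. f u \<partial>uniform01) = 0"
    let ?F = "\<integral>u. (f u)\<^sup>2 \<partial>uniform01"
    define r where "r N u = f u - ((\<integral>u. f u \<partial>uniform01) + comb (coef f) N u)" for N u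
    have r: "square_integrable uniform01 (r N)" for N
      unfolding r_def by (intro square_integrable_diff f square_integrable_add unif.square_integrable_const comb_square_integrable)
    have bessel: "(\<Sum>z=1..N. (coef f z)\<^sup>2) \<le> ?F" for N
    proof -
      have "0 \<le> (\<integral>u. (r N u)\<^sup>2 \<partial>uniform01)" by simp
      then show ?thesis
        unfolding r_def integral_power2_diff_comb[OF f] by (simp add: f0)
    qed
    have pb: "(\<integral>u. (poisson (coef f) N u)\<^sup>2 \<partial>uniform01) \<le> ?F / \<kappa>\<^sup>2" for N
    proof -
      have "(\<Sum>z=1..N. (coef f z / (1 - lam z))\<^sup>2) \<le> (\<Sum>z=1..N. (coef f z)\<^sup>2 / \<kappa>\<^sup>2)"
      proof (rule sum_mono)
        fix z assume "z \<in> {1..N}"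
        then have "\<kappa>\<^sup>2 \<le> (1 - lam z)\<^sup>2" using \<kappa> by (intro power_mono) auto
        then show "(coef f z / (1 - lam z))\<^sup>2 \<le> (coef f z)\<^sup>2 / \<kappa>\<^sup>2"
          unfolding power_divide using \<kappa> by (intro divide_left_mono mult_pos_pos) auto
      qed
      also have "\<dots> \<le> ?F / \<kappa>\<^sup>2"
        unfolding sum_divide_distrib[symmetric] using bessel by (intro divide_right_mono) auto
      finally show ?thesis unfolding poisson_def integral_comb_power2 .
    qed
    have bound: "(\<integral>x. (\<Sum>i<n. f (U i x))\<^sup>2 \<partial>M)
        \<le> 32 / \<kappa>\<^sup>2 * real n * ?F + 2 * (real n * (real n * (\<integral>u. (r N u)\<^sup>2 \<partial>uniform01)))" for N
    proof -
      note sqr = square_integrable_U[OF r[of N]] and sqc = square_integrable_U[OF comb_square_integrable[of "coef f" N]]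
      have [measurable]: "r N \<in> borel_measurable borel"
        using square_integrable_measurable[OF r] by simp
      have "(\<integral>x. (\<Sum>i<n. f (U i x))\<^sup>2 \<partial>M)
          = (\<integral>x. ((\<Sum>i<n. comb (coef f) N (U i x)) + (\<Sum>i<n. r N (U i x)))\<^sup>2 \<partial>M)"
        by (simp add: r_def f0 sum_subtractf)
      also have "\<dots> \<le> 2 * (\<integral>x. (\<Sum>i<n. comb (coef f) N (U i x))\<^sup>2 \<partial>M) + 2 * (\<integral>x. (\<Sum>i<n. r N (U i x))\<^sup>2 \<partial>M)"
        by (intro integral_power2_add_le square_integrable_sum sqr sqc)
      also have "(\<integral>x. (\<Sum>i<n. comb (coef f) N (U i x))\<^sup>2 \<partial>M) \<le> 16 * real n * (?F / \<kappa>\<^sup>2)"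
        using pb[of N] by (intro order_trans[OF variance_comb_sum_le] mult_left_mono) auto
      also have "(\<integral>x. (\<Sum>i<n. r N (U i x))\<^sup>2 \<partial>M) \<le> (\<integral>x. real n * (\<Sum>i<n. (r N (U i x))\<^sup>2) \<partial>M)"
      proof (rule integral_mono)
        show "integrable M (\<lambda>x. (\<Sum>i<n. r N (U i x))\<^sup>2)"
          by (intro square_integrable_power2 square_integrable_sum sqr)
        show "integrable M (\<lambda>x. real n * (\<Sum>i<n. (r N (U i x))\<^sup>2))"
          by (intro integrable_mult_right Bochner_Integration.integrable_sum square_integrable_power2 sqr)
        show "(\<Sum>i<n. r N (U i x))\<^sup>2 \<le> real n * (\<Sum>i<n. (r N (U i x))\<^sup>2)" for x
          using sum_squared_le_sum_of_squares[of "\<lambda>i. r N (U i x)" "{..<n}"] by (simp add: mult.commute)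
      qed
      also have "\<dots> = real n * (\<Sum>i<n. \<integral>x. (r N (U i x))\<^sup>2 \<partial>M)"
        using square_integrable_power2[OF sqr] by (simp add: Bochner_Integration.integral_sum)
      also have "(\<Sum>i<n. \<integral>x. (r N (U i x))\<^sup>2 \<partial>M) = real n * (\<integral>u. (r N u)\<^sup>2 \<partial>uniform01)"
        by (subst integral_U[where f = "\<lambda>u. (r N u)\<^sup>2"]) simp_all
      finally show ?thesis by simp
    qed
    have "(\<lambda>N. 32 / \<kappa>\<^sup>2 * real n * ?F + 2 * (real n * (real n * (\<integral>u. (r N u)\<^sup>2 \<partial>uniform01))))
        \<longlonglongrightarrow> 32 / \<kappa>\<^sup>2 * real n * ?F + 2 * (real n * (real n * 0))"
      unfolding r_def by (intro tendsto_intros remainder_tendsto_0 f)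
    from LIMSEQ_le_const[OF this] bound
    show "(\<integral>x. (\<Sum>i<n. f (U i x))\<^sup>2 \<partial>M) \<le> 32 / \<kappa>\<^sup>2 * real n * ?F" by auto
  qed simp
qed

end

section \<open>The martingale part of the estimator\<close>

locale estimator_chain = ergodic_copula_chain +
  fixes k :: nat
  assumes k: "1 \<le> k" and fourth: "integrable uniform01 (\<lambda>x. (\<phi> k x) ^ 4)"
begin

abbreviation "\<alpha> \<equiv> lam k"

text \<open>The numbers \<open>basis_coef \<phi> k z\<close> of the theorem, as Fourier coefficients of \<open>(\<phi> k)\<^sup>2\<close>.\<close>

definition b :: "nat \<Rightarrow> real" where "b = coef (\<lambda>x. (\<phi> k x)\<^sup>2)"

lemma phi_measurable [measurable]: "\<phi> k \<in> borel_measurable borel"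
  by (rule basis_measurable[OF k])

lemma phi2_square_integrable: "square_integrable uniform01 (\<lambda>x. (\<phi> k x)\<^sup>2)"
  unfolding square_integrable_def using fourth by (simp flip: power_mult)

lemma phi_phi_square_integrable:
  "square_integrable M (\<lambda>x. \<phi> k (U n x) * \<phi> k (U (Suc n) x))"
  unfolding square_integrable_def power_mult_distrib
  by (intro conjI square_integrable_mult square_integrable_U[OF phi2_square_integrable]) measurable

text \<open>The increment of the approximating martingale over a step from \<open>u\<close> to \<open>v\<close>: the deviation of
  \<open>\<phi> k u * \<phi> k v\<close> from its conditional mean, plus \<open>\<alpha>\<close> times that of the solution of the Poisson equation for the
  \<open>N\<close>-th Fourier partial sum of \<open>(\<phi> k)\<^sup>2 - 1\<close>.\<close>

definition d :: "nat \<Rightarrow> real \<Rightarrow> real \<Rightarrow> real" where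
  "d N u v = \<phi> k u * \<phi> k v - \<alpha> * (\<phi> k u)\<^sup>2 + \<alpha> * (poisson b N v - poisson_step b N u)"

lemma d_measurable [measurable (raw)]:
  assumes [measurable]: "f \<in> borel_measurable L" "g \<in> borel_measurable L"
  shows "(\<lambda>x. d N (f x) (g x)) \<in> borel_measurable L"
  unfolding d_def by measurable

lemma d_measurable_prod: "(\<lambda>p. d N (fst p) (snd p)) \<in> borel_measurable borel"
  unfolding borel_prod[symmetric] by measurable

abbreviation D :: "nat \<Rightarrow> nat \<Rightarrow> 'a \<Rightarrow> real" where
  "D N n x \<equiv> d N (U n x) (U (Suc n) x)"

lemma d_square_integrable: "square_integrable M (\<lambda>x. D N n x)"
  unfolding d_def
  by (intro square_integrable_add square_integrable_diff square_integrable_cmult phi_phi_square_integrable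
      square_integrable_U[OF phi2_square_integrable] square_integrable_U[OF poisson_square_integrable(1)]
      square_integrable_U[OF poisson_square_integrable(2)])

lemma d_martingale:
  fixes W :: "'a \<Rightarrow> complex"
  assumes W[measurable]: "W \<in> borel_measurable (past M U n)" and W2: "square_integrable M (\<lambda>x. cmod (W x))"
  shows "(\<integral>x. W x * D N n x \<partial>M) = 0"
proof -
  have WM: "W \<in> borel_measurable M"
    by (rule measurable_from_subalg[OF subalgebra_past W]) simp
  note iW = integrable_complex_mult_real[OF WM W2]
  note sq = square_integrable_U[OF phi2_square_integrable, of n]
    square_integrable_U[OF poisson_square_integrable(1), of b N "Suc n"]
    square_integrable_U[OF poisson_square_integrable(2), of b N n]
  have [measurable]: "U n \<in> borel_measurable (past M U n)"
    by (rule measurable_past) simp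
  have 1: "(\<integral>x. (W x * \<phi> k (U n x)) * \<phi> k (U (Suc n) x) \<partial>M) = (\<integral>x. (W x * \<phi> k (U n x)) * (\<alpha> * \<phi> k (U n x)) \<partial>M)"
    by (rule step_basis_complex[OF k])
      (use iW[OF phi_phi_square_integrable[of n]] in \<open>simp_all add: mult.assoc\<close>)
  have "(\<integral>x. W x * D N n x \<partial>M)
      = (\<integral>x. W x * complex_of_real (\<phi> k (U n x) * \<phi> k (U (Suc n) x)) - \<alpha> * (W x * complex_of_real ((\<phi> k (U n x))\<^sup>2))
        + \<alpha> * (W x * poisson b N (U (Suc n) x)) - \<alpha> * (W x * poisson_step b N (U n x)) \<partial>M)"
    by (simp add: d_def algebra_simps)
  also have "\<dots> = (\<integral>x. W x * complex_of_real (\<phi> k (U n x) * \<phi> k (U (Suc n) x)) \<partial>M)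
        - \<alpha> * (\<integral>x. W x * complex_of_real ((\<phi> k (U n x))\<^sup>2) \<partial>M)
        + \<alpha> * (\<integral>x. W x * poisson b N (U (Suc n) x) \<partial>M) - \<alpha> * (\<integral>x. W x * poisson_step b N (U n x) \<partial>M)"
    using iW[OF phi_phi_square_integrable[of n]] iW[OF sq(1)] iW[OF sq(2)] iW[OF sq(3)]
    by (simp del: of_real_mult of_real_power)
  also have "(\<integral>x. W x * complex_of_real (\<phi> k (U n x) * \<phi> k (U (Suc n) x)) \<partial>M)
      = \<alpha> * (\<integral>x. W x * complex_of_real ((\<phi> k (U n x))\<^sup>2) \<partial>M)"
    using 1 unfolding integral_mult_right_zero[symmetric] by (simp add: power2_eq_square mult_ac)
  finally show ?thesis
    using step_poisson[OF W W2] by simp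
qed

definition V :: "nat \<Rightarrow> real" where
  "V N = (\<integral>x. (D N 0 x)\<^sup>2 \<partial>M)"

lemma V_nonneg: "0 \<le> V N"
  by (simp add: V_def)

lemma integral_d_power2: "(\<integral>x. (D N n x)\<^sup>2 \<partial>M) = V N"
  unfolding V_def
  by (rule expectation_functional_step[where f = "\<lambda>u v. (d N u v)\<^sup>2"]) (use d_measurable_prod in measurable)

lemma past_sum_measurable:
  "(\<lambda>x. \<Sum>i<n. D N i x) \<in> borel_measurable (past M U n)"
proof (intro borel_measurable_sum d_measurable)
  fix i assume i: "i \<in> {..<n}"
  show "(\<lambda>x. U i x) \<in> borel_measurable (past M U n)"
    by (rule measurable_past) (use i in simp)
  show "(\<lambda>x. U (Suc i) x) \<in> borel_measurable (past M U n)"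
    by (rule measurable_past) (use i in simp)
qed

text \<open>The corrector of \<open>martingale_clt\<close> is a solution of the Poisson equation once more, now for a combination of
  basis functions that approximates the conditional variance \<open>v\<close> minus its mean \<open>V N\<close>. As \<open>d N\<close> is merely
  square-integrable, \<open>v\<close> is merely integrable, and the approximation is in \<open>L\<^sup>1\<close>.\<close>

lemma clt_d:
  "(\<lambda>n. \<integral>x. iexp (t / sqrt (real n) * (\<Sum>i<n. D N i x)) \<partial>M)
    \<longlonglongrightarrow> exp (- (t\<^sup>2 * V N / 2))"
proof (rule martingale_clt)
  show "square_integrable M (\<lambda>x. D N n x)" for n
    by (rule d_square_integrable)
  show "distr M borel (\<lambda>x. D N n x) = distr M borel (\<lambda>x. D N 0 x)" for n
    by (rule distr_functional_step[OF d_measurable_prod])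
  have Wp: "(\<lambda>x. iexp (s * (\<Sum>i<n. D N i x))) \<in> borel_measurable (past M U n)" for s n
    by (rule measurable_compose[OF past_sum_measurable, where g = "\<lambda>x. iexp (s * x)"]) measurable
  have W2: "square_integrable M (\<lambda>x. cmod (iexp (s * (\<Sum>i<n. D N i x))))" for s n
    by (simp add: square_integrable_const)
  show "(\<integral>x. iexp (s * (\<Sum>i<n. D N i x)) * D N n x \<partial>M) = 0" for s n
    by (rule d_martingale[OF Wp W2])
  show "0 \<le> V N" by (rule V_nonneg)
  fix \<epsilon> :: real assume "\<epsilon> > 0"
  define v where "v u = (\<integral>w. (d N u w)\<^sup>2 * kernel u w \<partial>uniform01)" for u
  have [measurable]: "v \<in> borel_measurable borel" unfolding v_def by measurable
  have d2p: "(\<lambda>p. (d N (fst p) (snd p))\<^sup>2) \<in> borel_measurable borel"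
    using d_measurable_prod by measurable
  have d2i: "integrable M (\<lambda>x. (D N n x)\<^sup>2)" for n
    by (rule square_integrable_power2[OF d_square_integrable])
  have vi: "integrable uniform01 v"
    unfolding v_def by (rule integrable_transition[OF d2p d2i])
  have step_v: "(\<integral>x. W x * complex_of_real ((D N n x)\<^sup>2) \<partial>M) = (\<integral>x. W x * v (U n x) \<partial>M)"
    if W[measurable]: "W \<in> borel_measurable (past M U n)" and W1: "\<And>x. cmod (W x) = 1" for W :: "'a \<Rightarrow> complex" and n
  proof -
    have WM[measurable]: "W \<in> borel_measurable M"
      by (rule measurable_from_subalg[OF subalgebra_past W]) simp
    have "integrable M (\<lambda>x. W x * complex_of_real ((D N n x)\<^sup>2))"
      by (rule Bochner_Integration.integrable_bound[OF d2i[of n]]) (auto simp: norm_mult norm_power W1)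
    then show ?thesis
      by (intro markov_step[OF W d2p]) (auto simp: v_def)
  qed
  have vV: "(\<integral>u. v u \<partial>uniform01) = V N"
  proof -
    have "complex_of_real (\<integral>u. v u \<partial>uniform01) = (\<integral>x. 1 * complex_of_real (v (U 0 x)) \<partial>M)"
      by (simp add: integral_U[of v])
    also have "\<dots> = (\<integral>x. 1 * complex_of_real ((D N 0 x)\<^sup>2) \<partial>M)"
      by (rule step_v[symmetric]) auto
    also have "\<dots> = complex_of_real (V N)"
      unfolding V_def by (simp only: mult_1 integral_complex_of_real)
    finally show ?thesis by (simp only: of_real_eq_iff)
  qed
  obtain a N' where aN: "(\<integral>u. \<bar>v u - (\<integral>u. v u \<partial>uniform01) - comb a N' u\<bar> \<partial>uniform01) < \<epsilon>"
    using comb_dense_L1[OF vi \<open>\<epsilon> > 0\<close>] by blast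
  define h where "h n x = poisson a N' (U n x)" for n x
  define H where "H = (\<integral>u. \<bar>poisson a N' u\<bar> \<partial>uniform01)"
  define K where "K = H + (V N + (\<integral>u. (poisson a N' u)\<^sup>2 \<partial>uniform01))"
  have sqh: "square_integrable M (h n)" for n
    unfolding h_def by (rule square_integrable_U[OF poisson_square_integrable(1)])
  have h2: "(\<integral>x. (h n x)\<^sup>2 \<partial>M) = (\<integral>u. (poisson a N' u)\<^sup>2 \<partial>uniform01)" for n
    unfolding h_def by (rule integral_U) measurable
  have "0 \<le> H" and "0 \<le> (\<integral>u. (poisson a N' u)\<^sup>2 \<partial>uniform01)"
    by (simp_all add: H_def)
  show "\<exists>h K. \<forall>n. integrable M (h n) \<and>
      integrable M (\<lambda>x. D N n x * h (Suc n) x) \<and>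
      (\<integral>x. \<bar>h n x\<bar> \<partial>M) \<le> K \<and> (\<integral>x. \<bar>D N n x * h (Suc n) x\<bar> \<partial>M) \<le> K \<and>
      (\<forall>s. cmod (\<integral>x. iexp (s * (\<Sum>i<n. D N i x))
        * ((D N n x)\<^sup>2 - V N + h (Suc n) x - h n x) \<partial>M) \<le> \<epsilon>)"
  proof (intro exI[of _ h] exI[of _ K] allI conjI)
    fix n
    show hi: "integrable M (h n)" by (rule square_integrable_integrable[OF sqh])
    show dh: "integrable M (\<lambda>x. D N n x * h (Suc n) x)"
      by (rule square_integrable_mult[OF d_square_integrable sqh])
    have "(\<integral>x. \<bar>h n x\<bar> \<partial>M) = H"
      unfolding h_def H_def by (rule integral_U) measurable
    then show "(\<integral>x. \<bar>h n x\<bar> \<partial>M) \<le> K"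
      using V_nonneg[of N] \<open>0 \<le> (\<integral>u. (poisson a N' u)\<^sup>2 \<partial>uniform01)\<close> by (simp add: K_def)
    have "(\<integral>x. \<bar>D N n x * h (Suc n) x\<bar> \<partial>M)
        \<le> (\<integral>x. (D N n x)\<^sup>2 + (h (Suc n) x)\<^sup>2 \<partial>M)"
    proof (rule integral_mono)
      show "integrable M (\<lambda>x. (D N n x)\<^sup>2 + (h (Suc n) x)\<^sup>2)"
        using d2i square_integrable_power2[OF sqh] by simp
      show "\<bar>D N n x * h (Suc n) x\<bar>
          \<le> (D N n x)\<^sup>2 + (h (Suc n) x)\<^sup>2" for x
        by (rule abs_mult_le_sum_power2)
    qed (use dh in simp)
    also have "\<dots> = V N + (\<integral>u. (poisson a N' u)\<^sup>2 \<partial>uniform01)"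
      using d2i square_integrable_power2[OF sqh] by (simp add: integral_d_power2 h2)
    finally show "(\<integral>x. \<bar>D N n x * h (Suc n) x\<bar> \<partial>M) \<le> K"
      using \<open>0 \<le> H\<close> by (simp add: K_def)
    fix s
    define W where "W x = iexp (s * (\<Sum>i<n. D N i x))" for x
    have W: "W \<in> borel_measurable (past M U n)" unfolding W_def by (rule Wp)
    have W1: "cmod (W x) = 1" for x by (simp add: W_def)
    have W2': "square_integrable M (\<lambda>x. cmod (W x))" unfolding W_def by (rule W2)
    have WM[measurable]: "W \<in> borel_measurable M"
      by (rule measurable_from_subalg[OF subalgebra_past W]) simp
    have iW: "integrable M (\<lambda>x. W x * complex_of_real (f x))" if "integrable M f" for f
      by (rule Bochner_Integration.integrable_bound[OF that])
        (use borel_measurable_integrable[OF that] in \<open>auto simp: norm_mult W1\<close>)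
    have iv: "integrable M (\<lambda>x. v (U n x))" by (rule integrable_U[OF vi])
    have iP: "integrable M (\<lambda>x. poisson_step a N' (U n x))"
      by (intro integrable_U unif.square_integrable_integrable poisson_square_integrable)
    have hi': "integrable M (h (Suc n))" by (rule square_integrable_integrable[OF sqh])
    have "(\<integral>x. W x * ((D N n x)\<^sup>2 - V N + h (Suc n) x - h n x) \<partial>M)
        = (\<integral>x. W x * complex_of_real ((D N n x)\<^sup>2) - W x * complex_of_real (V N)
          + W x * complex_of_real (h (Suc n) x) - W x * complex_of_real (h n x) \<partial>M)"
      by (simp add: algebra_simps)
    also have "\<dots> = (\<integral>x. W x * complex_of_real ((D N n x)\<^sup>2) \<partial>M)
        - (\<integral>x. W x * complex_of_real (V N) \<partial>M)
        + (\<integral>x. W x * complex_of_real (h (Suc n) x) \<partial>M) - (\<integral>x. W x * complex_of_real (h n x) \<partial>M)"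
      using iW[OF d2i[of n]] iW[of "\<lambda>_. V N"] iW[OF hi] iW[OF hi']
      by (simp del: of_real_power integral_mult_left_zero)
    also have "\<dots> = (\<integral>x. W x * complex_of_real (v (U n x)) \<partial>M)
        - (\<integral>x. W x * complex_of_real (V N) \<partial>M)
        + (\<integral>x. W x * complex_of_real (poisson_step a N' (U n x)) \<partial>M) - (\<integral>x. W x * complex_of_real (h n x) \<partial>M)"
      unfolding step_v[OF W W1] using step_poisson[OF W W2', of a N'] by (simp add: h_def)
    also have "\<dots> = (\<integral>x. W x * complex_of_real (v (U n x)) - W x * complex_of_real (V N)
        + W x * complex_of_real (poisson_step a N' (U n x)) - W x * complex_of_real (h n x) \<partial>M)"
      using iW[OF iv] iW[of "\<lambda>_. V N"] iW[OF hi] iW[OF iP]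
      by (simp del: integral_mult_left_zero)
    also have "\<dots> = (\<integral>x. W x * complex_of_real (v (U n x) - V N - comb a N' (U n x)) \<partial>M)"
      unfolding poisson_equation[symmetric] by (simp add: h_def algebra_simps)
    also have "cmod \<dots> \<le> (\<integral>x. \<bar>v (U n x) - V N - comb a N' (U n x)\<bar> \<partial>M)"
    proof (rule norm_integral_le)
      have i: "integrable M (\<lambda>x. v (U n x) - V N - comb a N' (U n x))"
        using iv integrable_U[OF unif.square_integrable_integrable[OF comb_square_integrable]] by simp
      show "integrable M (\<lambda>x. W x * complex_of_real (v (U n x) - V N - comb a N' (U n x)))"
        by (rule iW[OF i])
      show "integrable M (\<lambda>x. \<bar>v (U n x) - V N - comb a N' (U n x)\<bar>)"
        using i by simp
    qed (simp add: norm_mult W1 del: of_real_diff)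
    also have "\<dots> = (\<integral>u. \<bar>v u - V N - comb a N' u\<bar> \<partial>uniform01)"
      by (rule integral_U) measurable
    also have "\<dots> \<le> \<epsilon>" using aN by (simp add: vV)
    finally show "cmod (\<integral>x. iexp (s * (\<Sum>i<n. D N i x))
        * ((D N n x)\<^sup>2 - V N + h (Suc n) x - h n x) \<partial>M) \<le> \<epsilon>"
      unfolding W_def .
  qed
qed

end

section \<open>Identification of the asymptotic variance\<close>

context estimator_chain
begin

lemma integral_phi2: "(\<integral>u. (\<phi> k u)\<^sup>2 \<partial>uniform01) = 1"
  by (rule basis_norm[OF k])

lemma integral_phi2_power2: "(\<integral>u. ((\<phi> k u)\<^sup>2)\<^sup>2 \<partial>uniform01) = (\<integral>u. (\<phi> k u) ^ 4 \<partial>uniform01)"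
  by (simp flip: power_mult)

lemma b_sums: "(\<lambda>z. (b (Suc z))\<^sup>2) sums ((\<integral>u. (\<phi> k u) ^ 4 \<partial>uniform01) - 1)"
  using parseval[OF phi2_square_integrable] by (simp add: b_def integral_phi2 integral_phi2_power2)

text \<open>The expectation is \<open>\<integral> g * T g\<close> for \<open>g = (\<phi> k)\<^sup>2\<close>. The Fourier series of \<open>T g\<close> converges uniformly, so it
  can be integrated against \<open>g\<close> term by term; in this way convergence of the series comes out as well.\<close>

lemma phi2_mult_phi2_sums:
  "(\<lambda>z. lam (Suc z) * (b (Suc z))\<^sup>2) sums ((\<integral>x. (\<phi> k (U 0 x))\<^sup>2 * (\<phi> k (U (Suc 0) x))\<^sup>2 \<partial>M) - 1)"
proof -
  let ?g = "\<lambda>u. (\<phi> k u)\<^sup>2"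
  define c where "c u = (\<integral>v. ?g v * series_density lam \<phi> u v \<partial>uniform01)" for u
  define cN where "cN N u = 1 + comb (\<lambda>z. lam z * b z) N u" for N u
  have c_meas[measurable]: "c \<in> borel_measurable borel"
  proof -
    have "(\<lambda>(u, v). ?g v * series_density lam \<phi> u v) \<in> borel_measurable (borel \<Otimes>\<^sub>M uniform01)"
    proof -
      have "(\<lambda>p. series_density lam \<phi> (fst p) (snd p)) \<in> borel_measurable (borel \<Otimes>\<^sub>M uniform01)"
        using series_density_measurable
        by (simp add: measurable_cong_sets[OF sets_pair_measure_cong[OF refl sets_uniform01] refl] borel_prod)
      then show ?thesis
        by (simp add: case_prod_beta)
    qed
    then show ?thesis
      unfolding c_def by (rule unif.borel_measurable_lebesgue_integral)
  qed
  have lim: "uniform_limit {0<..<1} cN c sequentially"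
    using integral_mult_series_density[OF phi2_square_integrable]
    unfolding c_def cN_def b_def integral_phi2 .
  have lim': "uniform_limit ((UNIV :: unit set) \<times> {0<..<1}) (\<lambda>N p. cN N (snd p)) (\<lambda>p. c (snd p)) sequentially"
    unfolding uniform_limit_iff
  proof (intro allI impI)
    fix e :: real assume "e > 0"
    from uniform_limitD[OF lim this]
    show "\<forall>\<^sub>F N in sequentially. \<forall>p\<in>(UNIV :: unit set) \<times> {0<..<1}. dist (cN N (snd p)) (c (snd p)) < e"
      by eventually_elim auto
  qed
  have cNsq: "square_integrable uniform01 (cN N)" for N
    unfolding cN_def by (intro square_integrable_add unif.square_integrable_const comb_square_integrable)
  have gi: "integrable uniform01 ?g" by (rule unif.square_integrable_integrable[OF phi2_square_integrable])
  have "uniform_limit (UNIV :: unit set) (\<lambda>N _. \<integral>u. ?g u * cN N u \<partial>uniform01) (\<lambda>_. \<integral>u. ?g u * c u \<partial>uniform01) sequentially"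
    by (rule integral_mult_uniform_limit(2)[OF lim' _ gi square_integrable_mult[OF phi2_square_integrable cNsq]])
      (auto simp: AE_uniform01)
  from tendsto_uniform_limitI[OF this UNIV_I]
  have "(\<lambda>N. \<integral>u. ?g u * cN N u \<partial>uniform01) \<longlonglongrightarrow> (\<integral>u. ?g u * c u \<partial>uniform01)" .
  moreover have "(\<integral>u. ?g u * cN N u \<partial>uniform01) = 1 + (\<Sum>z<N. lam (Suc z) * (b (Suc z))\<^sup>2)" for N
  proof -
    have "(\<integral>u. ?g u * cN N u \<partial>uniform01) = (\<integral>u. ?g u \<partial>uniform01) + (\<integral>u. ?g u * comb (\<lambda>z. lam z * b z) N u \<partial>uniform01)"
      unfolding cN_def using gi square_integrable_mult[OF phi2_square_integrable comb_square_integrable]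
      by (simp add: distrib_left)
    also have "\<dots> = 1 + (\<Sum>z=1..N. lam z * b z * b z)"
      unfolding integral_mult_comb[OF phi2_square_integrable] by (simp add: integral_phi2 b_def coef_def)
    finally show ?thesis
      by (simp add: sum.atLeast1_atMost_eq power2_eq_square mult.assoc)
  qed
  moreover have "(\<integral>u. ?g u * c u \<partial>uniform01) = (\<integral>x. ?g (U 0 x) * ?g (U (Suc 0) x) \<partial>M)"
  proof -
    have "(\<integral>x. ?g (U 0 x) * ?g (U (Suc 0) x) \<partial>M)
        = (\<integral>u. (\<integral>v. (?g u * ?g v) * kernel u v \<partial>uniform01) \<partial>uniform01)"
    proof (rule expectation_transition[where f = "\<lambda>u v. ?g u * ?g v"])
      show "(\<lambda>p. ?g (fst p) * ?g (snd p)) \<in> borel_measurable borel"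
        unfolding borel_prod[symmetric] by measurable
      show "integrable M (\<lambda>x. ?g (U 0 x) * ?g (U (Suc 0) x))"
        by (intro square_integrable_mult square_integrable_U phi2_square_integrable)
    qed
    also have "\<dots> = (\<integral>u. ?g u * c u \<partial>uniform01)"
    proof (rule integral_cong_AE)
      show "AE u in uniform01. (\<integral>v. (?g u * ?g v) * kernel u v \<partial>uniform01) = ?g u * c u"
        using AE_kernel_integral
      proof eventually_elim
        case (elim u)
        have gm: "?g \<in> borel_measurable borel" by measurable
        have "(\<integral>v. (?g u * ?g v) * kernel u v \<partial>uniform01) = ?g u * (\<integral>v. ?g v * kernel u v \<partial>uniform01)"
          by (simp add: mult.assoc)
        also have "(\<integral>v. ?g v * kernel u v \<partial>uniform01) = c u"
          unfolding c_def by (rule bspec[OF conjunct2[OF elim] gm])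
        finally show ?case .
      qed
    qed measurable
    finally show ?thesis by simp
  qed
  ultimately have "(\<lambda>N. 1 + (\<Sum>z<N. lam (Suc z) * (b (Suc z))\<^sup>2)) \<longlonglongrightarrow> (\<integral>x. ?g (U 0 x) * ?g (U (Suc 0) x) \<partial>M)"
    by simp
  from tendsto_diff[OF this tendsto_const[of 1]] show ?thesis
    by (simp add: sums_def)
qed

text \<open>Let \<open>X\<close> collect the terms of \<open>d N\<close> that involve the new value, and \<open>m (U 0)\<close> its conditional mean. Then \<open>V N\<close> is the
  second moment of \<open>X\<close> minus that of \<open>m (U 0)\<close>, and every integral that arises is diagonal in the basis.
  With \<open>y = b / (1 - lam)\<close>, the coefficients combine by
  \<open>2 * y * b + y\<^sup>2 - 2 * lam * y * b - lam\<^sup>2 * y\<^sup>2 = 3 * b\<^sup>2 + 2 * lam / (1 - lam) * b\<^sup>2\<close>.\<close>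

lemma V_eq:
  "V N = (\<integral>x. (\<phi> k (U 0 x))\<^sup>2 * (\<phi> k (U (Suc 0) x))\<^sup>2 \<partial>M)
    + \<alpha>\<^sup>2 * ((\<Sum>z=1..N. 3 * (b z)\<^sup>2 + 2 * (lam z / (1 - lam z) * (b z)\<^sup>2)) - (\<integral>u. (\<phi> k u) ^ 4 \<partial>uniform01))"
proof -
  define p q where "p = poisson b N" and "q = poisson_step b N"
  define X where "X x = \<phi> k (U 0 x) * \<phi> k (U (Suc 0) x) + \<alpha> * p (U (Suc 0) x)" for x
  define m where "m u = \<alpha> * (\<phi> k u)\<^sup>2 + \<alpha> * q u" for u
  have psq: "square_integrable uniform01 p" and qsq: "square_integrable uniform01 q"
    unfolding p_def q_def by (rule poisson_square_integrable)+
  have [measurable]: "p \<in> borel_measurable borel" "q \<in> borel_measurable borel"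
    unfolding p_def q_def by measurable
  have [measurable]: "m \<in> borel_measurable borel" unfolding m_def by measurable
  have msq: "square_integrable uniform01 m"
    unfolding m_def by (intro square_integrable_add square_integrable_cmult phi2_square_integrable qsq)
  have msqM: "square_integrable M (\<lambda>x. m (U 0 x))" by (rule square_integrable_U[OF msq])
  have Xsq: "square_integrable M X"
    unfolding X_def by (intro square_integrable_add square_integrable_cmult phi_phi_square_integrable square_integrable_U[OF psq])
  have d_eq: "D N 0 x = X x - m (U 0 x)" for x
    by (simp add: d_def X_def m_def p_def q_def algebra_simps)
  have dm: "(\<integral>x. m (U 0 x) * (X x - m (U 0 x)) \<partial>M) = 0"
  proof -
    have "(\<integral>x. complex_of_real (m (U 0 x)) * complex_of_real (D N 0 x) \<partial>M) = 0"
    proof (rule d_martingale)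
      show "(\<lambda>x. complex_of_real (m (U 0 x))) \<in> borel_measurable (past M U 0)"
        by (intro borel_measurable_of_real past_comp) auto
      show "square_integrable M (\<lambda>x. cmod (complex_of_real (m (U 0 x))))"
        using msqM square_integrable_measurable[OF msqM] by (simp add: square_integrable_def)
    qed
    then have "complex_of_real (\<integral>x. m (U 0 x) * D N 0 x \<partial>M) = 0"
      unfolding integral_complex_of_real[symmetric] of_real_mult .
    then show ?thesis unfolding d_eq by (simp only: of_real_eq_0_iff)
  qed
  have V1: "V N = (\<integral>x. (X x)\<^sup>2 \<partial>M) - (\<integral>x. (m (U 0 x))\<^sup>2 \<partial>M)"
  proof -
    note i = square_integrable_power2[OF Xsq] square_integrable_power2[OF msqM] square_integrable_mult[OF msqM Xsq]
    have "V N = (\<integral>x. (X x)\<^sup>2 - (m (U 0 x))\<^sup>2 - 2 * (m (U 0 x) * (X x - m (U 0 x))) \<partial>M)"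
      unfolding V_def d_eq by (simp add: power2_eq_square algebra_simps)
    also have "\<dots> = (\<integral>x. (X x)\<^sup>2 \<partial>M) - (\<integral>x. (m (U 0 x))\<^sup>2 \<partial>M) - 2 * (\<integral>x. m (U 0 x) * (X x - m (U 0 x)) \<partial>M)"
      using i square_integrable_mult[OF msqM square_integrable_diff[OF Xsq msqM]] by simp
    finally show ?thesis using dm by simp
  qed
  have cross: "(\<integral>x. \<phi> k (U 0 x) * \<phi> k (U (Suc 0) x) * p (U (Suc 0) x) \<partial>M) = \<alpha> * (\<integral>u. (\<phi> k u)\<^sup>2 * p u \<partial>uniform01)"
  proof -
    have "(\<integral>x. \<phi> k (U 0 x) * \<phi> k (U (Suc 0) x) * p (U (Suc 0) x) \<partial>M)
        = (\<integral>x. (\<phi> k (U 0 x) * p (U 0 x)) * \<phi> k (U (Suc 0) x) \<partial>M)"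
      using expectation_swap[of "\<lambda>u v. \<phi> k u * \<phi> k v * p v" 0]
      by (simp add: borel_prod[symmetric] mult_ac)
    also have "\<dots> = \<alpha> * (\<integral>x. (\<phi> k (U 0 x) * p (U 0 x)) * \<phi> k (U 0 x) \<partial>M)"
    proof (rule step_basis[OF k])
      show "(\<lambda>x. \<phi> k (U 0 x) * p (U 0 x)) \<in> borel_measurable (past M U 0)"
        by (intro borel_measurable_times past_comp) auto
      show "integrable M (\<lambda>x. \<phi> k (U 0 x) * p (U 0 x) * \<phi> k (U (Suc 0) x))"
        using square_integrable_mult[OF phi_phi_square_integrable[of 0] square_integrable_U[OF psq, of 0]]
        by (simp add: mult_ac)
    qed
    also have "(\<integral>x. (\<phi> k (U 0 x) * p (U 0 x)) * \<phi> k (U 0 x) \<partial>M) = (\<integral>u. (\<phi> k u)\<^sup>2 * p u \<partial>uniform01)"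
      by (subst integral_U[where f = "\<lambda>u. (\<phi> k u * p u) * \<phi> k u"]) (simp_all add: power2_eq_square mult_ac)
    finally show ?thesis .
  qed
  have X2: "(\<integral>x. (X x)\<^sup>2 \<partial>M) = (\<integral>x. (\<phi> k (U 0 x))\<^sup>2 * (\<phi> k (U (Suc 0) x))\<^sup>2 \<partial>M)
      + 2 * \<alpha>\<^sup>2 * (\<integral>u. (\<phi> k u)\<^sup>2 * p u \<partial>uniform01) + \<alpha>\<^sup>2 * (\<integral>u. (p u)\<^sup>2 \<partial>uniform01)"
  proof -
    note i = square_integrable_power2[OF phi_phi_square_integrable[of 0]]
      square_integrable_power2[OF square_integrable_U[OF psq, of "Suc 0"]]
      square_integrable_mult[OF phi_phi_square_integrable[of 0] square_integrable_U[OF psq, of "Suc 0"]]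
    have "(\<integral>x. (X x)\<^sup>2 \<partial>M) = (\<integral>x. (\<phi> k (U 0 x) * \<phi> k (U (Suc 0) x))\<^sup>2
        + 2 * \<alpha> * (\<phi> k (U 0 x) * \<phi> k (U (Suc 0) x) * p (U (Suc 0) x)) + \<alpha>\<^sup>2 * (p (U (Suc 0) x))\<^sup>2 \<partial>M)"
      unfolding X_def by (simp add: power2_eq_square algebra_simps)
    also have "\<dots> = (\<integral>x. (\<phi> k (U 0 x) * \<phi> k (U (Suc 0) x))\<^sup>2 \<partial>M)
        + 2 * \<alpha> * (\<integral>x. \<phi> k (U 0 x) * \<phi> k (U (Suc 0) x) * p (U (Suc 0) x) \<partial>M) + \<alpha>\<^sup>2 * (\<integral>x. (p (U (Suc 0) x))\<^sup>2 \<partial>M)"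
      using i by simp
    also have "(\<integral>x. (p (U (Suc 0) x))\<^sup>2 \<partial>M) = (\<integral>u. (p u)\<^sup>2 \<partial>uniform01)"
      by (rule integral_U) measurable
    finally show ?thesis
      unfolding cross power_mult_distrib by (simp add: power2_eq_square[of \<alpha>])
  qed
  have m2: "(\<integral>x. (m (U 0 x))\<^sup>2 \<partial>M) = \<alpha>\<^sup>2 * (\<integral>u. (\<phi> k u) ^ 4 \<partial>uniform01)
      + 2 * \<alpha>\<^sup>2 * (\<integral>u. (\<phi> k u)\<^sup>2 * q u \<partial>uniform01) + \<alpha>\<^sup>2 * (\<integral>u. (q u)\<^sup>2 \<partial>uniform01)"
  proof -
    note i = square_integrable_power2[OF qsq] square_integrable_mult[OF phi2_square_integrable qsq] fourth
    have "(\<integral>x. (m (U 0 x))\<^sup>2 \<partial>M) = (\<integral>u. (m u)\<^sup>2 \<partial>uniform01)"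
      by (rule integral_U) measurable
    also have "\<dots> = (\<integral>u. \<alpha>\<^sup>2 * (\<phi> k u) ^ 4 + 2 * \<alpha>\<^sup>2 * ((\<phi> k u)\<^sup>2 * q u) + \<alpha>\<^sup>2 * (q u)\<^sup>2 \<partial>uniform01)"
      unfolding m_def by (simp add: power2_eq_square power4_eq_xxxx algebra_simps)
    finally show ?thesis using i by simp
  qed
  define y where "y z = b z / (1 - lam z)" for z
  have b_eq: "(\<integral>u. (\<phi> k u)\<^sup>2 * \<phi> z u \<partial>uniform01) = b z" for z
    by (simp add: b_def coef_def)
  have b_y: "b z = y z * (1 - lam z)" if "z \<in> {1..N}" for z
    using lam_ne_1[of z] that by (simp add: y_def)
  have "2 * (\<integral>u. (\<phi> k u)\<^sup>2 * p u \<partial>uniform01) + (\<integral>u. (p u)\<^sup>2 \<partial>uniform01)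
      - 2 * (\<integral>u. (\<phi> k u)\<^sup>2 * q u \<partial>uniform01) - (\<integral>u. (q u)\<^sup>2 \<partial>uniform01)
      = 2 * (\<Sum>z=1..N. y z * b z) + (\<Sum>z=1..N. (y z)\<^sup>2)
        - 2 * (\<Sum>z=1..N. lam z * y z * b z) - (\<Sum>z=1..N. (lam z * y z)\<^sup>2)"
    unfolding p_def q_def poisson_def poisson_step_def integral_comb_power2
      integral_mult_comb[OF phi2_square_integrable] b_eq y_def by simp
  also have "\<dots> = (\<Sum>z=1..N. 2 * (y z * b z) + (y z)\<^sup>2 - 2 * (lam z * y z * b z) - (lam z * y z)\<^sup>2)"
    by (simp add: sum.distrib sum_subtractf sum_distrib_left)
  also have "\<dots> = (\<Sum>z=1..N. 3 * (b z)\<^sup>2 + 2 * (lam z / (1 - lam z) * (b z)\<^sup>2))"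
  proof (rule sum.cong[OF refl])
    fix z assume z: "z \<in> {1..N}"
    have "lam z / (1 - lam z) * (b z)\<^sup>2 = lam z * y z * b z"
      by (simp add: y_def power2_eq_square)
    then show "2 * (y z * b z) + (y z)\<^sup>2 - 2 * (lam z * y z * b z) - (lam z * y z)\<^sup>2
        = 3 * (b z)\<^sup>2 + 2 * (lam z / (1 - lam z) * (b z)\<^sup>2)"
      by (simp only: b_y[OF z]) (simp add: power2_eq_square algebra_simps)
  qed
  finally have S: "2 * (\<integral>u. (\<phi> k u)\<^sup>2 * p u \<partial>uniform01) + (\<integral>u. (p u)\<^sup>2 \<partial>uniform01)
      - 2 * (\<integral>u. (\<phi> k u)\<^sup>2 * q u \<partial>uniform01) - (\<integral>u. (q u)\<^sup>2 \<partial>uniform01)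
      = (\<Sum>z=1..N. 3 * (b z)\<^sup>2 + 2 * (lam z / (1 - lam z) * (b z)\<^sup>2))" .
  show ?thesis
    unfolding V1 X2 m2 S[symmetric] by (simp add: algebra_simps)
qed

lemma poisson_series_summable: "summable (\<lambda>z. lam (Suc z) / (1 - lam (Suc z)) * (b (Suc z))\<^sup>2)"
proof -
  obtain \<kappa> where \<kappa>: "0 < \<kappa>" "\<And>z. 1 \<le> z \<Longrightarrow> \<kappa> \<le> 1 - lam z"
    by (rule poisson_gap) blast
  show ?thesis
  proof (rule summable_comparison_test')
    show "summable (\<lambda>z. 1 / \<kappa> * (b (Suc z))\<^sup>2)"
      using sums_summable[OF b_sums] by (rule summable_mult)
    show "norm (lam (Suc z) / (1 - lam (Suc z)) * (b (Suc z))\<^sup>2) \<le> 1 / \<kappa> * (b (Suc z))\<^sup>2" for z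
    proof -
      have "\<bar>lam (Suc z) / (1 - lam (Suc z))\<bar> \<le> 1 / \<kappa>"
        unfolding abs_divide using \<kappa>(1) \<kappa>(2)[of "Suc z"] abs_lam_le_1[of "Suc z"]
        by (intro frac_le) auto
      then show ?thesis by (simp only: real_norm_def abs_mult) (simp add: mult_right_mono del: times_divide_eq_left)
    qed
  qed
qed

text \<open>If \<open>lam z = -1\<close>, then \<open>\<phi> z (U 1) = - \<phi> z (U 0)\<close> almost surely. The expectation of
  \<open>\<phi> k (U 0) * \<phi> k (U 1) * \<phi> z (U i)\<close> is \<open>\<alpha> * b z\<close> for \<open>i = 0\<close> by conditioning, and for \<open>i = 1\<close>
  by reversibility, and these two values are opposite.\<close>

lemma lam_minus_1:
  assumes z: "1 \<le> z" and "lam z = -1"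
  shows "\<alpha> * b z = 0"
proof -
  note zsq = square_integrable_U[OF basis_square_integrable[OF z]]
  note [measurable] = basis_measurable[OF z]
  have int: "integrable M (\<lambda>x. \<phi> k (U 0 x) * \<phi> k (U (Suc 0) x) * \<phi> z (U i x))" for i
    by (rule square_integrable_mult[OF phi_phi_square_integrable zsq])
  have 0: "(\<integral>x. \<phi> k (U 0 x) * \<phi> k (U (Suc 0) x) * \<phi> z (U 0 x) \<partial>M) = \<alpha> * b z"
  proof -
    have "(\<integral>x. (\<phi> k (U 0 x) * \<phi> z (U 0 x)) * \<phi> k (U (Suc 0) x) \<partial>M)
        = \<alpha> * (\<integral>x. (\<phi> k (U 0 x) * \<phi> z (U 0 x)) * \<phi> k (U 0 x) \<partial>M)"
    proof (rule step_basis[OF k])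
      show "(\<lambda>x. \<phi> k (U 0 x) * \<phi> z (U 0 x)) \<in> borel_measurable (past M U 0)"
        by (intro borel_measurable_times past_comp) auto
      show "integrable M (\<lambda>x. \<phi> k (U 0 x) * \<phi> z (U 0 x) * \<phi> k (U (Suc 0) x))"
        using int[of 0] by (simp add: mult_ac)
    qed
    moreover have "(\<integral>x. (\<phi> k (U 0 x) * \<phi> z (U 0 x)) * \<phi> k (U 0 x) \<partial>M) = b z"
      by (subst integral_U[where f = "\<lambda>u. (\<phi> k u * \<phi> z u) * \<phi> k u"])
        (simp_all add: b_def coef_def power2_eq_square mult_ac)
    ultimately show ?thesis by (simp add: mult_ac)
  qed
  have 1: "(\<integral>x. \<phi> k (U 0 x) * \<phi> k (U (Suc 0) x) * \<phi> z (U (Suc 0) x) \<partial>M) = \<alpha> * b z"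
    using expectation_swap[of "\<lambda>u v. \<phi> k u * \<phi> k v * \<phi> z v" 0] 0
    by (simp add: borel_prod[symmetric] mult_ac)
  have "(\<integral>x. (\<phi> z (U (Suc 0) x) + 1 * \<phi> z (U 0 x))\<^sup>2 \<partial>M) = 0"
    unfolding expectation_increment_power2[OF z] using assms by simp
  then have "AE x in M. (\<phi> z (U (Suc 0) x) + 1 * \<phi> z (U 0 x))\<^sup>2 = 0"
    by (subst (asm) integral_nonneg_eq_0_iff_AE)
      (intro square_integrable_power2 square_integrable_add square_integrable_cmult zsq, auto)
  then have "AE x in M. \<phi> k (U 0 x) * \<phi> k (U (Suc 0) x) * \<phi> z (U (Suc 0) x)
      = - (\<phi> k (U 0 x) * \<phi> k (U (Suc 0) x) * \<phi> z (U 0 x))"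
    by eventually_elim (simp add: eq_neg_iff_add_eq_0[symmetric])
  then have "(\<integral>x. \<phi> k (U 0 x) * \<phi> k (U (Suc 0) x) * \<phi> z (U (Suc 0) x) \<partial>M)
      = (\<integral>x. - (\<phi> k (U 0 x) * \<phi> k (U (Suc 0) x) * \<phi> z (U 0 x)) \<partial>M)"
    by (rule integral_cong_AE[rotated 2]) measurable
  then show ?thesis using 0 1 by simp
qed

lemma lam_power_series_summable: "summable (\<lambda>z. lam (Suc z) ^ (m + 1) * (b (Suc z))\<^sup>2)"
proof (rule summable_comparison_test'[OF sums_summable[OF b_sums]])
  show "norm (lam (Suc z) ^ (m + 1) * (b (Suc z))\<^sup>2) \<le> (b (Suc z))\<^sup>2" for z
    using power_le_one[OF abs_ge_zero abs_lam_le_1[of "Suc z"], of "m + 1"]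
    unfolding real_norm_def abs_mult power_abs power2_abs by (intro mult_left_le_one_le) auto
qed

text \<open>The partial sums over \<open>m\<close> are geometric, so only the tail \<open>\<Sum>z. lam z ^ n * r z\<close> has to vanish. Wherever \<open>b z\<close> is
  not \<open>0\<close>, \<open>lam_minus_1\<close> excludes the eigenvalue \<open>-1\<close>, and the tail decays like \<open>\<rho> ^ n\<close> by the spectral gap.
  For \<open>\<alpha> = 0\<close> an eigenvalue \<open>-1\<close> would make the terms oscillate.\<close>

lemma covariance_series_sums:
  assumes "\<alpha> \<noteq> 0"
  shows "(\<lambda>m. \<Sum>z. lam (Suc z) ^ (m + 1) * (b (Suc z))\<^sup>2)
    sums (\<Sum>z. lam (Suc z) / (1 - lam (Suc z)) * (b (Suc z))\<^sup>2)"
proof -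
  obtain \<kappa> where \<kappa>: "0 < \<kappa>" "\<And>z. 1 \<le> z \<Longrightarrow> \<kappa> \<le> 1 - lam z"
    by (rule poisson_gap) blast
  obtain \<rho> where \<rho>: "0 \<le> \<rho>" "\<rho> < 1" "\<And>z. 1 \<le> z \<Longrightarrow> \<bar>lam z\<bar> \<noteq> 1 \<Longrightarrow> \<bar>lam z\<bar> \<le> \<rho>"
    using spectral_gap[OF gap abs_lam_le_1] by metis
  define r where "r z = lam (Suc z) / (1 - lam (Suc z)) * (b (Suc z))\<^sup>2" for z
  define B where "B = (\<Sum>z. (b (Suc z))\<^sup>2)"
  have rs: "summable r" unfolding r_def by (rule poisson_series_summable)
  have Bs: "summable (\<lambda>z. \<rho> ^ n / \<kappa> * (b (Suc z))\<^sup>2)" for n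
    by (rule summable_mult[OF sums_summable[OF b_sums]])
  have tail: "\<bar>lam (Suc z) ^ n * r z\<bar> \<le> \<rho> ^ n / \<kappa> * (b (Suc z))\<^sup>2" for z n
  proof (cases "b (Suc z) = 0")
    case False
    then have "lam (Suc z) \<noteq> -1" using lam_minus_1[of "Suc z"] assms by auto
    then have "\<bar>lam (Suc z)\<bar> \<noteq> 1" using lam_ne_1[of "Suc z"] by (auto simp: abs_if split: if_splits)
    then have "\<bar>lam (Suc z)\<bar> \<le> \<rho>" using \<rho>(3)[of "Suc z"] by simp
    then have "\<bar>lam (Suc z)\<bar> ^ n \<le> \<rho> ^ n" by (intro power_mono) auto
    moreover have "\<bar>lam (Suc z) / (1 - lam (Suc z))\<bar> \<le> 1 / \<kappa>"
      unfolding abs_divide using \<kappa>(1) \<kappa>(2)[of "Suc z"] abs_lam_le_1[of "Suc z"]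
      by (intro frac_le) auto
    ultimately have "\<bar>lam (Suc z)\<bar> ^ n * \<bar>lam (Suc z) / (1 - lam (Suc z))\<bar> * (b (Suc z))\<^sup>2 \<le> \<rho> ^ n * (1 / \<kappa>) * (b (Suc z))\<^sup>2"
      using \<rho> \<kappa> by (intro mult_mono mult_nonneg_nonneg) auto
    then show ?thesis by (simp add: r_def abs_mult power_abs)
  qed (simp add: r_def)
  have ts: "summable (\<lambda>z. lam (Suc z) ^ n * r z)" for n
    by (rule summable_comparison_test'[OF Bs[of n]]) (use tail in simp)
  have partial: "(\<Sum>m<n. \<Sum>z. lam (Suc z) ^ (m + 1) * (b (Suc z))\<^sup>2) = (\<Sum>z. r z) - (\<Sum>z. lam (Suc z) ^ n * r z)" for n
  proof -
    have "(\<Sum>m<n. \<Sum>z. lam (Suc z) ^ (m + 1) * (b (Suc z))\<^sup>2) = (\<Sum>z. \<Sum>m<n. lam (Suc z) ^ (m + 1) * (b (Suc z))\<^sup>2)"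
      by (rule suminf_sum[symmetric]) (rule lam_power_series_summable)
    also have "\<dots> = (\<Sum>z. r z - lam (Suc z) ^ n * r z)"
    proof (rule arg_cong[where f = suminf], rule ext)
      fix z
      have ne: "lam (Suc z) \<noteq> 1" by (rule lam_ne_1) simp
      have "(\<Sum>m<n. lam (Suc z) ^ (m + 1) * (b (Suc z))\<^sup>2) = lam (Suc z) * (\<Sum>m<n. lam (Suc z) ^ m) * (b (Suc z))\<^sup>2"
        by (simp add: sum_distrib_left sum_distrib_right mult_ac)
      also have "(\<Sum>m<n. lam (Suc z) ^ m) = (1 - lam (Suc z) ^ n) / (1 - lam (Suc z))"
        using ne by (simp add: sum_gp_strict)
      finally show "(\<Sum>m<n. lam (Suc z) ^ (m + 1) * (b (Suc z))\<^sup>2) = r z - lam (Suc z) ^ n * r z"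
        by (simp add: r_def diff_divide_distrib algebra_simps)
    qed
    also have "\<dots> = (\<Sum>z. r z) - (\<Sum>z. lam (Suc z) ^ n * r z)"
      by (rule suminf_diff[OF rs ts, symmetric])
    finally show ?thesis .
  qed
  have "(\<lambda>n. \<Sum>z. lam (Suc z) ^ n * r z) \<longlonglongrightarrow> 0"
  proof (rule Lim_null_comparison)
    show "\<forall>\<^sub>F n in sequentially. norm (\<Sum>z. lam (Suc z) ^ n * r z) \<le> \<rho> ^ n / \<kappa> * B"
    proof (rule always_eventually, rule allI)
      fix n
      have "norm (\<Sum>z. lam (Suc z) ^ n * r z) \<le> (\<Sum>z. \<rho> ^ n / \<kappa> * (b (Suc z))\<^sup>2)"
        by (rule norm_suminf_le[OF _ Bs]) (use tail in simp)
      then show "norm (\<Sum>z. lam (Suc z) ^ n * r z) \<le> \<rho> ^ n / \<kappa> * B"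
        unfolding B_def suminf_mult[OF sums_summable[OF b_sums]] .
    qed
    have "(\<lambda>n. \<rho> ^ n / \<kappa> * B) \<longlonglongrightarrow> 0 / \<kappa> * B"
      using \<rho> \<kappa> by (intro tendsto_intros LIMSEQ_realpow_zero) auto
    then show "(\<lambda>n. \<rho> ^ n / \<kappa> * B) \<longlonglongrightarrow> 0" by simp
  qed
  then have "(\<lambda>n. (\<Sum>z. r z) - (\<Sum>z. lam (Suc z) ^ n * r z)) \<longlonglongrightarrow> (\<Sum>z. r z) - 0"
    by (intro tendsto_intros)
  then show ?thesis
    unfolding sums_def partial r_def[symmetric] by simp
qed

lemma basis_coef_eq: "1 \<le> z \<Longrightarrow> basis_coef \<phi> k z = b z"
  unfolding basis_coef_def b_def coef_def
  by (subst integral_uniform01) (auto simp: mult.commute intro!: borel_measurable_times basis_measurable)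

lemma asymptotic_variance_converges: "asymptotic_variance_converges lam \<phi> k"
  unfolding asymptotic_variance_converges_def
proof (intro conjI allI impI)
  fix z :: nat assume z: "1 \<le> z"
  note [measurable] = basis_measurable[OF z]
  show "set_integrable lborel {0<..<1} (\<lambda>x. \<phi> z x * (\<phi> k x)\<^sup>2)"
    by (subst integrable_uniform01)
      (use square_integrable_mult[OF basis_square_integrable[OF z] phi2_square_integrable] in auto)
next
  show "summable (\<lambda>z. lam (Suc z) ^ (m + 1) * (basis_coef \<phi> k (Suc z))\<^sup>2)" for m
    using lam_power_series_summable[of m] by (simp add: basis_coef_eq)
next
  show "summable (\<lambda>m. \<alpha>\<^sup>2 * (\<Sum>z. lam (Suc z) ^ (m + 1) * (basis_coef \<phi> k (Suc z))\<^sup>2))"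
  proof (cases "\<alpha> = 0")
    case False
    from sums_summable[OF covariance_series_sums[OF this]] show ?thesis
      by (intro summable_mult) (simp add: basis_coef_eq)
  qed simp
qed

text \<open>Parseval gives \<open>\<Sum> (b z)\<^sup>2 = F - 1\<close> with \<open>F = \<integral> (\<phi> k) ^ 4\<close>, and with \<open>G = \<Sum> lam z / (1 - lam z) * (b z)\<^sup>2\<close>
  both sides become \<open>1 + \<Sum> lam z * (b z)\<^sup>2 + \<alpha>\<^sup>2 * (3 * (F - 1) + 2 * G - F)\<close>.\<close>

lemma V_tendsto: "V \<longlonglongrightarrow> asymptotic_variance lam \<phi> k"
proof -
  let ?Q = "\<integral>x. (\<phi> k (U 0 x))\<^sup>2 * (\<phi> k (U (Suc 0) x))\<^sup>2 \<partial>M"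
  let ?F = "\<integral>u. (\<phi> k u) ^ 4 \<partial>uniform01"
  define G where "G = (\<Sum>z. lam (Suc z) / (1 - lam (Suc z)) * (b (Suc z))\<^sup>2)"
  have "(\<lambda>z. 3 * (b (Suc z))\<^sup>2 + 2 * (lam (Suc z) / (1 - lam (Suc z)) * (b (Suc z))\<^sup>2)) sums (3 * (?F - 1) + 2 * G)"
    unfolding G_def by (intro sums_add sums_mult b_sums summable_sums poisson_series_summable)
  then have "(\<lambda>N. \<Sum>z=1..N. 3 * (b z)\<^sup>2 + 2 * (lam z / (1 - lam z) * (b z)\<^sup>2)) \<longlonglongrightarrow> 3 * (?F - 1) + 2 * G"
    by (simp add: sums_def sum.atLeast1_atMost_eq)
  then have "V \<longlonglongrightarrow> ?Q + \<alpha>\<^sup>2 * ((3 * (?F - 1) + 2 * G) - ?F)"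
    unfolding V_eq[abs_def] by (intro tendsto_intros)
  moreover have "asymptotic_variance lam \<phi> k = ?Q + \<alpha>\<^sup>2 * ((3 * (?F - 1) + 2 * G) - ?F)"
  proof -
    have fm: "(\<lambda>x. \<phi> k x ^ 4) \<in> borel_measurable borel" by measurable
    have Q: "(\<Sum>z. lam (Suc z) * (basis_coef \<phi> k (Suc z))\<^sup>2) = ?Q - 1"
      using sums_unique[OF phi2_mult_phi2_sums] by (simp add: basis_coef_eq)
    have T: "(\<Sum>m. \<alpha>\<^sup>2 * (\<Sum>z. lam (Suc z) ^ (m + 1) * (basis_coef \<phi> k (Suc z))\<^sup>2)) = \<alpha>\<^sup>2 * G"
    proof (cases "\<alpha> = 0")
      case False
      from sums_unique[OF sums_mult[OF covariance_series_sums[OF this], of "\<alpha>\<^sup>2"]] show ?thesis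
        by (simp add: basis_coef_eq G_def)
    qed simp
    show ?thesis
      unfolding asymptotic_variance_def Q T integral_uniform01[OF fm] by (simp add: algebra_simps)
  qed
  ultimately show ?thesis by simp
qed

lemma asymptotic_variance_nonneg: "0 \<le> asymptotic_variance lam \<phi> k"
  using LIMSEQ_le_const[OF V_tendsto] V_nonneg by blast

end

section \<open>Positivity of the asymptotic variance\<close>

context estimator_chain
begin

text \<open>Variance \<open>0\<close> means \<open>V N \<longlonglongrightarrow> 0\<close>, so \<open>d N\<close> tends to \<open>0\<close> almost everywhere along a subsequence. In the difference
  of \<open>d N u v\<close> and \<open>d N u0 v\<close> the part of the Poisson solution that depends on \<open>v\<close> cancels, and what remains is
  \<open>(\<phi> k u - \<phi> k u0) * \<phi> k v\<close> plus a term free of \<open>v\<close>. Hence either \<open>\<phi> k u = \<phi> k u0\<close> or \<open>\<phi> k\<close> is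
  constant; in both cases \<open>\<phi> k\<close> is constant almost everywhere, against mean \<open>0\<close> and norm \<open>1\<close>.\<close>

lemma asymptotic_variance_pos:
  assumes pos: "AE p in lborel. p \<in> {0<..<1} \<times> {0<..<1} \<longrightarrow> 0 < series_density lam \<phi> (fst p) (snd p)"
  shows "0 < asymptotic_variance lam \<phi> k"
proof (rule ccontr)
  assume "\<not> 0 < asymptotic_variance lam \<phi> k"
  then have "asymptotic_variance lam \<phi> k = 0" using asymptotic_variance_nonneg by simp
  then have V0: "V \<longlonglongrightarrow> 0" using V_tendsto by simp
  let ?J = "distr M borel (\<lambda>x. (U 0 x, U (Suc 0) x))"
  have dm: "(\<lambda>p. (d N (fst p) (snd p))\<^sup>2) \<in> borel_measurable borel" for N
    using d_measurable_prod by measurable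
  have UU: "(\<lambda>x. (U 0 x, U (Suc 0) x)) \<in> borel_measurable M"
    unfolding borel_prod[symmetric] by measurable
  have int: "integrable ?J (\<lambda>p. (d N (fst p) (snd p))\<^sup>2)" for N
    by (subst integrable_distr_eq[OF UU dm])
      (use square_integrable_power2[OF d_square_integrable, of N 0] in simp)
  have "(\<integral>p. norm ((d N (fst p) (snd p))\<^sup>2) \<partial>?J) = V N" for N
    unfolding V_def by (subst integral_distr[OF UU]) (use dm in simp_all)
  then have "(\<lambda>N. \<integral>p. norm ((d N (fst p) (snd p))\<^sup>2) \<partial>?J) \<longlonglongrightarrow> 0" using V0 by simp
  from tendsto_L1_AE_subseq[OF int this] obtain r :: "nat \<Rightarrow> nat"
    where r: "AE p in ?J. (\<lambda>n. (d (r n) (fst p) (snd p))\<^sup>2) \<longlonglongrightarrow> 0" by blast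
  have "AE p in ?J. (\<lambda>n. d (r n) (fst p) (snd p)) \<longlonglongrightarrow> 0"
    using r
  proof eventually_elim
    case (elim p)
    from tendsto_real_sqrt[OF elim] show ?case
      by (simp add: tendsto_rabs_zero_iff)
  qed
  from AE_AE_if_AE_joint[OF pos this]
  have ae: "AE u in uniform01. AE v in uniform01. (\<lambda>n. d (r n) u v) \<longlonglongrightarrow> 0" .
  then obtain u0 where u0: "AE v in uniform01. (\<lambda>n. d (r n) u0 v) \<longlonglongrightarrow> 0"
    using eventually_happens'[OF unif.ae_filter_bot] by blast
  have "AE u in uniform01. \<phi> k u = \<phi> k u0"
    using ae
  proof eventually_elim
    case (elim u)
    show ?case
    proof (rule ccontr)
      assume ne: "\<phi> k u \<noteq> \<phi> k u0"
      define e where "e n = - \<alpha> * ((\<phi> k u)\<^sup>2 - (\<phi> k u0)\<^sup>2) - \<alpha> * (poisson_step b (r n) u - poisson_step b (r n) u0)" for n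
      have lim: "AE v in uniform01. e \<longlonglongrightarrow> - ((\<phi> k u - \<phi> k u0) * \<phi> k v)"
        using elim u0
      proof eventually_elim
        case (elim v)
        have "(\<lambda>n. d (r n) u v - d (r n) u0 v - (\<phi> k u - \<phi> k u0) * \<phi> k v) \<longlonglongrightarrow> 0 - 0 - (\<phi> k u - \<phi> k u0) * \<phi> k v"
          by (intro tendsto_diff elim tendsto_const)
        moreover have "d (r n) u v - d (r n) u0 v - (\<phi> k u - \<phi> k u0) * \<phi> k v = e n" for n
          by (simp add: d_def e_def algebra_simps)
        ultimately show ?case by simp
      qed
      then obtain v0 where v0: "e \<longlonglongrightarrow> - ((\<phi> k u - \<phi> k u0) * \<phi> k v0)"
        using eventually_happens'[OF unif.ae_filter_bot] by blast
      have "AE v in uniform01. \<phi> k v = \<phi> k v0"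
        using lim
      proof eventually_elim
        case (elim v)
        from LIMSEQ_unique[OF elim v0] ne show ?case by simp
      qed
      then show False using basis_not_AE_constant[OF k] by blast
    qed
  qed
  then show False using basis_not_AE_constant[OF k] by blast
qed

end

section \<open>Consistency and asymptotic normality\<close>

lemma real_distribution_centered_normal:
  assumes "0 \<le> s" shows "real_distribution (centered_normal s)"
proof (cases "s = 0")
  case True
  then show ?thesis
    by (auto simp: centered_normal_def real_distribution_def real_distribution_axioms_def intro: prob_space_return)
next
  case False
  then have "prob_space (density lborel (normal_density 0 (sqrt s)))"
    using assms by (intro prob_space_normal_density) simp
  then show ?thesis
    using False by (simp add: centered_normal_def real_distribution_def real_distribution_axioms_def)
qed

lemma char_centered_normal:
  assumes "0 \<le> s" shows "char (centered_normal s) t = exp (- (t\<^sup>2 * s / 2))"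
proof (cases "s = 0")
  case True
  then show ?thesis by (simp add: char_def centered_normal_def integral_return)
next
  case False
  define \<sigma> where "\<sigma> = sqrt s"
  have \<sigma>: "0 < \<sigma>" "\<sigma>\<^sup>2 = s" using False assms by (auto simp: \<sigma>_def)
  define N where "N = density lborel (normal_density 0 \<sigma>)"
  have cN: "centered_normal s = N" using False by (simp add: centered_normal_def N_def \<sigma>_def)
  interpret N: prob_space N
    unfolding N_def by (rule prob_space_normal_density[OF \<sigma>(1)])
  have "distributed N lborel (\<lambda>x. x) (normal_density 0 \<sigma>)"
    unfolding distributed_def by (auto simp: N_def intro!: distr_id2)
  then have "distributed N lborel (\<lambda>x. (x - 0) / \<sigma>) std_normal_density"
    using N.normal_standard_normal_convert[OF \<sigma>(1), of "\<lambda>x. x" 0] by simp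
  then have D: "distr N lborel (\<lambda>x. x / \<sigma>) = density lborel std_normal_density"
    by (simp add: distributed_def)
  have "char (centered_normal s) t = (\<integral>x. iexp (t * \<sigma> * (x / \<sigma>)) \<partial>N)"
    using \<sigma>(1) by (simp add: cN char_def)
  also have "\<dots> = (\<integral>y. iexp (t * \<sigma> * y) \<partial>distr N lborel (\<lambda>x. x / \<sigma>))"
    by (subst integral_distr) (auto simp: N_def)
  also have "\<dots> = char std_normal_distribution (t * \<sigma>)"
    by (simp add: D char_def)
  also have "\<dots> = exp (- (t\<^sup>2 * s / 2))"
  proof -
    have "(t * \<sigma>)\<^sup>2 = t\<^sup>2 * s" by (simp add: power_mult_distrib \<sigma>(2))
    then show ?thesis unfolding char_std_normal_distribution by simp
  qed
  finally show ?thesis .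
qed

context estimator_chain
begin

definition remainder :: "nat \<Rightarrow> real \<Rightarrow> real" where
  "remainder N u = (\<phi> k u)\<^sup>2 - (1 + comb b N u)"

lemma remainder_square_integrable: "square_integrable uniform01 (remainder N)"
  unfolding remainder_def
  by (intro square_integrable_diff square_integrable_add phi2_square_integrable
      unif.square_integrable_const comb_square_integrable)

lemma remainder_mean: "(\<integral>u. remainder N u \<partial>uniform01) = 0"
  unfolding remainder_def
  using unif.square_integrable_integrable[OF phi2_square_integrable]
    unif.square_integrable_integrable[OF comb_square_integrable]
  by (simp add: integral_phi2 integral_comb)

lemma remainder_norm_tendsto_0: "(\<lambda>N. \<integral>u. (remainder N u)\<^sup>2 \<partial>uniform01) \<longlonglongrightarrow> 0"
  using remainder_tendsto_0[OF phi2_square_integrable]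
  unfolding remainder_def b_def integral_phi2 .

text \<open>The part of the error that the martingale misses: the additive functional of the Fourier remainder and the
  boundary term left by telescoping the solution of the Poisson equation.\<close>

definition correction :: "nat \<Rightarrow> nat \<Rightarrow> 'a \<Rightarrow> real" where
  "correction N n x = \<alpha> * (\<Sum>i<n. remainder N (U i x)) + \<alpha> * (poisson b N (U 0 x) - poisson b N (U n x))"

lemma estimator_decomposition:
  "(\<Sum>i<n. \<phi> k (U i x) * \<phi> k (U (Suc i) x) - \<alpha>)
    = (\<Sum>i<n. D N i x) + correction N n x"
proof (induction n)
  case (Suc n)
  have "\<phi> k (U n x) * \<phi> k (U (Suc n) x) - \<alpha> = D N n x
      + \<alpha> * remainder N (U n x) + \<alpha> * (poisson b N (U n x) - poisson b N (U (Suc n) x))"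
    unfolding d_def remainder_def poisson_equation[symmetric] by (simp add: algebra_simps)
  then show ?case
    using Suc by (simp add: correction_def distrib_left right_diff_distrib)
qed (simp add: correction_def)

lemma estimator_error:
  assumes "1 \<le> n"
  shows "real n * (lambda_hat \<phi> k U n x - \<alpha>)
    = (\<Sum>i<n. D N i x) + correction N n x"
  unfolding estimator_decomposition[symmetric] lambda_hat_eq
  using assms by (simp add: right_diff_distrib sum_subtractf)

lemma correction_square_integrable: "square_integrable M (correction N n)"
  unfolding correction_def
  by (intro square_integrable_add square_integrable_cmult square_integrable_sum square_integrable_diff
      square_integrable_U remainder_square_integrable poisson_square_integrable)

text \<open>The mean square error is of order \<open>1 / n\<close>. The case \<open>N = 0\<close> of the decomposition suffices, in which no Poisson
  equation is solved and the remainder is \<open>(\<phi> k)\<^sup>2 - 1\<close>.\<close>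

lemma consistent_lambda_hat: "consistent M (lambda_hat \<phi> k U) \<alpha>"
proof -
  obtain K where K: "0 \<le> K"
    "\<And>f n. square_integrable uniform01 f \<Longrightarrow> (\<integral>u. f u \<partial>uniform01) = 0 \<Longrightarrow>
      (\<integral>x. (\<Sum>i<n. f (U i x))\<^sup>2 \<partial>M) \<le> K * real n * (\<integral>u. (f u)\<^sup>2 \<partial>uniform01)"
    by (rule variance_sum_bound) blast
  note dsq = d_square_integrable[of 0]
  have orth: "(\<integral>x. (\<Sum>i<n. D 0 i x) * D 0 n x \<partial>M) = 0" for n
  proof -
    let ?S = "\<lambda>x. \<Sum>i<n. D 0 i x"
    have S: "square_integrable M ?S" using dsq by auto
    have "(\<integral>x. complex_of_real (?S x) * complex_of_real (D 0 n x) \<partial>M) = 0"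
    proof (rule d_martingale)
      show "(\<lambda>x. complex_of_real (?S x)) \<in> borel_measurable (past M U n)"
        by (rule measurable_compose[OF past_sum_measurable borel_measurable_of_real])
      show "square_integrable M (\<lambda>x. cmod (complex_of_real (?S x)))"
        using S square_integrable_measurable[OF S] by (simp add: square_integrable_def del: of_real_sum)
    qed
    then have "complex_of_real (\<integral>x. ?S x * D 0 n x \<partial>M) = 0"
      unfolding integral_complex_of_real[symmetric] of_real_mult .
    then show ?thesis by (simp only: of_real_eq_0_iff)
  qed
  define L where "L = 2 * V 0 + 2 * (\<alpha>\<^sup>2 * (K * (\<integral>u. (remainder 0 u)\<^sup>2 \<partial>uniform01)))"
  have p0: "poisson b 0 = (\<lambda>u. 0)" by (auto simp: poisson_def comb_def)
  have bound: "(\<integral>x. (real n * (lambda_hat \<phi> k U n x - \<alpha>))\<^sup>2 \<partial>M) \<le> L * real n" if "1 \<le> n" for n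
  proof -
    have "(\<integral>x. (real n * (lambda_hat \<phi> k U n x - \<alpha>))\<^sup>2 \<partial>M)
        \<le> 2 * (\<integral>x. (\<Sum>i<n. D 0 i x)\<^sup>2 \<partial>M) + 2 * (\<integral>x. (correction 0 n x)\<^sup>2 \<partial>M)"
      unfolding estimator_error[OF that, of _ 0]
      by (intro integral_power2_add_le square_integrable_sum d_square_integrable correction_square_integrable)
    also have "(\<integral>x. (\<Sum>i<n. D 0 i x)\<^sup>2 \<partial>M) = real n * V 0"
      using integral_power2_orthogonal_sum[where X = "\<lambda>i x. D 0 i x", OF dsq orth]
      by (simp add: integral_d_power2)
    also have "(\<integral>x. (correction 0 n x)\<^sup>2 \<partial>M) = \<alpha>\<^sup>2 * (\<integral>x. (\<Sum>i<n. remainder 0 (U i x))\<^sup>2 \<partial>M)"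
      by (simp add: correction_def p0 power_mult_distrib)
    also have "\<dots> \<le> \<alpha>\<^sup>2 * (K * real n * (\<integral>u. (remainder 0 u)\<^sup>2 \<partial>uniform01))"
      by (intro mult_left_mono K(2) remainder_square_integrable remainder_mean) simp
    finally show ?thesis by (simp add: L_def algebra_simps)
  qed
  have lsq: "square_integrable M (\<lambda>x. real n * (lambda_hat \<phi> k U n x - \<alpha>))" if "1 \<le> n" for n
    unfolding estimator_error[OF that, of _ 0]
    by (intro square_integrable_add square_integrable_sum d_square_integrable correction_square_integrable)
  show ?thesis
    unfolding consistent_def
  proof (intro conjI allI impI)
    show "lambda_hat \<phi> k U n \<in> borel_measurable M" for n by (rule lambda_hat_measurable[OF k])
    fix \<epsilon> :: real assume "\<epsilon> > 0"
    show "(\<lambda>n. measure M {x \<in> space M. \<epsilon> \<le> \<bar>lambda_hat \<phi> k U n x - \<alpha>\<bar>}) \<longlonglongrightarrow> 0"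
    proof (rule Lim_null_comparison)
      show "(\<lambda>n. L / \<epsilon>\<^sup>2 * (1 / real n)) \<longlonglongrightarrow> 0"
        by (rule tendsto_mult_right_zero[OF lim_1_over_n])
      show "\<forall>\<^sub>F n in sequentially. norm (measure M {x \<in> space M. \<epsilon> \<le> \<bar>lambda_hat \<phi> k U n x - \<alpha>\<bar>}) \<le> L / \<epsilon>\<^sup>2 * (1 / real n)"
        using eventually_ge_at_top[of 1]
      proof eventually_elim
        case (elim n)
        have "{x \<in> space M. \<epsilon> \<le> \<bar>lambda_hat \<phi> k U n x - \<alpha>\<bar>}
            = {x \<in> space M. (real n * \<epsilon>)\<^sup>2 \<le> (real n * (lambda_hat \<phi> k U n x - \<alpha>))\<^sup>2}"
        proof -
          have "\<epsilon> \<le> \<bar>x\<bar> \<longleftrightarrow> (real n * \<epsilon>)\<^sup>2 \<le> (real n * x)\<^sup>2" for x :: real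
            unfolding abs_le_square_iff[symmetric] abs_mult using elim \<open>\<epsilon> > 0\<close> by simp
          then show ?thesis by simp
        qed
        also have "measure M \<dots> \<le> (\<integral>x. (real n * (lambda_hat \<phi> k U n x - \<alpha>))\<^sup>2 \<partial>M) / (real n * \<epsilon>)\<^sup>2"
          using elim \<open>\<epsilon> > 0\<close>
          by (intro integral_Markov_inequality_measure[where A = "{}"] square_integrable_power2 lsq) auto
        also have "\<dots> \<le> (L * real n) / (real n * \<epsilon>)\<^sup>2"
          by (intro divide_right_mono bound elim) simp
        also have "\<dots> = L / \<epsilon>\<^sup>2 * (1 / real n)"
          using elim by (simp add: power_mult_distrib power2_eq_square)
        finally show ?case by simp
      qed
    qed
  qed
qed

text \<open>Characteristic functions differ by at most the mean distance of their arguments. The normalised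
  \<open>correction N n\<close> has a mean absolute value of at most \<open>\<delta> N\<close> in the limit, uniformly in \<open>n\<close>
  apart from the boundary term, and \<open>\<delta> N\<close> and \<open>V N\<close> converge as \<open>N\<close> grows.\<close>

lemma clt_lambda_hat:
  "(\<lambda>n. \<integral>x. iexp (t * (sqrt (real n) * (lambda_hat \<phi> k U n x - \<alpha>))) \<partial>M)
    \<longlonglongrightarrow> exp (- (t\<^sup>2 * asymptotic_variance lam \<phi> k / 2))"
proof (rule tendsto_by_approximation)
  fix e :: real assume "e > 0"
  obtain K where K: "0 \<le> K"
    "\<And>f n. square_integrable uniform01 f \<Longrightarrow> (\<integral>u. f u \<partial>uniform01) = 0 \<Longrightarrow>
      (\<integral>x. (\<Sum>i<n. f (U i x))\<^sup>2 \<partial>M) \<le> K * real n * (\<integral>u. (f u)\<^sup>2 \<partial>uniform01)"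
    by (rule variance_sum_bound) blast
  define \<delta> where "\<delta> N = \<bar>t\<bar> * (\<bar>\<alpha>\<bar> * sqrt (K * (\<integral>u. (remainder N u)\<^sup>2 \<partial>uniform01)))" for N
  define E where "E s = complex_of_real (exp (- (t\<^sup>2 * s / 2)))" for s
  have "(\<lambda>N. \<delta> N + cmod (E (V N) - E (asymptotic_variance lam \<phi> k)))
      \<longlonglongrightarrow> \<bar>t\<bar> * (\<bar>\<alpha>\<bar> * sqrt (K * 0)) + cmod (E (asymptotic_variance lam \<phi> k) - E (asymptotic_variance lam \<phi> k))"
    unfolding \<delta>_def E_def by (intro tendsto_intros remainder_norm_tendsto_0 V_tendsto) simp_all
  then have "(\<lambda>N. \<delta> N + cmod (E (V N) - E (asymptotic_variance lam \<phi> k))) \<longlonglongrightarrow> 0" by simp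
  from order_tendstoD(2)[OF this \<open>e > 0\<close>]
  obtain N where N: "\<delta> N + cmod (E (V N) - E (asymptotic_variance lam \<phi> k)) < e"
    unfolding eventually_sequentially by blast
  let ?S = "\<lambda>n x. \<Sum>i<n. D N i x"
  define P where "P = (\<integral>u. \<bar>poisson b N u\<bar> \<partial>uniform01)"
  define b' where "b' n = \<delta> N + \<bar>t / sqrt (real n)\<bar> * (\<bar>\<alpha>\<bar> * (2 * P))
    + cmod ((\<integral>x. iexp (t / sqrt (real n) * ?S n x) \<partial>M) - E (V N)) + cmod (E (V N) - E (asymptotic_variance lam \<phi> k))" for n
  have corr: "(\<integral>x. \<bar>correction N n x\<bar> \<partial>M)
      \<le> sqrt (real n) * (\<bar>\<alpha>\<bar> * sqrt (K * (\<integral>u. (remainder N u)\<^sup>2 \<partial>uniform01))) + \<bar>\<alpha>\<bar> * (2 * P)" for n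
  proof -
    let ?R = "\<lambda>x. \<Sum>i<n. remainder N (U i x)"
    have R: "square_integrable M ?R"
      by (intro square_integrable_sum square_integrable_U remainder_square_integrable)
    have Ri: "integrable M ?R" by (rule square_integrable_integrable[OF R])
    have pi: "integrable M (\<lambda>x. poisson b N (U i x))" for i
      by (intro integrable_U unif.square_integrable_integrable poisson_square_integrable)
    have pP: "(\<integral>x. \<bar>poisson b N (U i x)\<bar> \<partial>M) = P" for i
      unfolding P_def by (rule integral_U) measurable
    have "(\<integral>x. \<bar>correction N n x\<bar> \<partial>M)
        \<le> (\<integral>x. \<bar>\<alpha>\<bar> * \<bar>?R x\<bar> + \<bar>\<alpha>\<bar> * (\<bar>poisson b N (U 0 x)\<bar> + \<bar>poisson b N (U n x)\<bar>) \<partial>M)"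
    proof (rule integral_mono)
      show "integrable M (\<lambda>x. \<bar>correction N n x\<bar>)"
        using square_integrable_integrable[OF correction_square_integrable] by simp
      show "integrable M (\<lambda>x. \<bar>\<alpha>\<bar> * \<bar>?R x\<bar> + \<bar>\<alpha>\<bar> * (\<bar>poisson b N (U 0 x)\<bar> + \<bar>poisson b N (U n x)\<bar>))"
        using Ri pi by simp
      show "\<bar>correction N n x\<bar> \<le> \<bar>\<alpha>\<bar> * \<bar>?R x\<bar> + \<bar>\<alpha>\<bar> * (\<bar>poisson b N (U 0 x)\<bar> + \<bar>poisson b N (U n x)\<bar>)" for x
        unfolding correction_def
        by (intro order_trans[OF abs_triangle_ineq] add_mono) (simp_all add: abs_mult mult_left_mono abs_triangle_ineq4)
    qed
    also have "\<dots> = \<bar>\<alpha>\<bar> * (\<integral>x. \<bar>?R x\<bar> \<partial>M) + \<bar>\<alpha>\<bar> * (2 * P)"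
      using Ri pi by (simp add: pP)
    also have "\<dots> \<le> \<bar>\<alpha>\<bar> * (sqrt (real n) * sqrt (K * (\<integral>u. (remainder N u)\<^sup>2 \<partial>uniform01))) + \<bar>\<alpha>\<bar> * (2 * P)"
    proof (intro add_right_mono mult_left_mono)
      have "(\<integral>x. \<bar>?R x\<bar> \<partial>M) \<le> sqrt (\<integral>x. (?R x)\<^sup>2 \<partial>M)"
        by (rule integral_abs_le_sqrt_integral_power2[OF R])
      also have "\<dots> \<le> sqrt (real n * (K * (\<integral>u. (remainder N u)\<^sup>2 \<partial>uniform01)))"
        using K(2)[OF remainder_square_integrable remainder_mean, of N n]
        by (intro real_sqrt_le_mono) (simp only: mult_ac)
      finally show "(\<integral>x. \<bar>?R x\<bar> \<partial>M) \<le> sqrt (real n) * sqrt (K * (\<integral>u. (remainder N u)\<^sup>2 \<partial>uniform01))"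
        by (simp only: real_sqrt_mult)
    qed simp
    finally show ?thesis by (simp only: mult_ac)
  qed
  have [measurable]: "?S n \<in> borel_measurable M" for n by measurable
  have [measurable]: "correction N n \<in> borel_measurable M" for n
    by (rule square_integrable_measurable[OF correction_square_integrable])
  have key: "cmod ((\<integral>x. iexp (t * (sqrt (real n) * (lambda_hat \<phi> k U n x - \<alpha>))) \<partial>M)
      - (\<integral>x. iexp (t / sqrt (real n) * ?S n x) \<partial>M)) \<le> \<delta> N + \<bar>t / sqrt (real n)\<bar> * (\<bar>\<alpha>\<bar> * (2 * P))" if n: "1 \<le> n" for n
  proof -
    define s where "s = t / sqrt (real n)"
    have arg: "t * (sqrt (real n) * (lambda_hat \<phi> k U n x - \<alpha>)) = s * ?S n x + s * correction N n x" for x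
    proof -
      have "t * (sqrt (real n) * (lambda_hat \<phi> k U n x - \<alpha>)) = s * (real n * (lambda_hat \<phi> k U n x - \<alpha>))"
        using n unfolding s_def by (simp add: field_simps)
      then show ?thesis unfolding estimator_error[OF n, of _ N] by (simp add: distrib_left)
    qed
    have ii: "integrable M (\<lambda>x. iexp (X x))" if [measurable]: "X \<in> borel_measurable M" for X
      by (rule integrable_const_bound[of _ 1]) auto
    have "cmod ((\<integral>x. iexp (s * ?S n x + s * correction N n x) \<partial>M) - (\<integral>x. iexp (s * ?S n x) \<partial>M))
        = cmod (\<integral>x. iexp (s * ?S n x + s * correction N n x) - iexp (s * ?S n x) \<partial>M)"
      by (subst Bochner_Integration.integral_diff[OF ii ii]) auto
    also have "\<dots> \<le> (\<integral>x. \<bar>s * correction N n x\<bar> \<partial>M)"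
    proof (rule norm_integral_le)
      show "integrable M (\<lambda>x. iexp (s * ?S n x + s * correction N n x) - iexp (s * ?S n x))"
        by (intro Bochner_Integration.integrable_diff ii) measurable
      show "integrable M (\<lambda>x. \<bar>s * correction N n x\<bar>)"
        using square_integrable_integrable[OF correction_square_integrable] by simp
    qed (rule iexp_diff_le)
    also have "\<dots> = \<bar>s\<bar> * (\<integral>x. \<bar>correction N n x\<bar> \<partial>M)"
      by (simp add: abs_mult)
    also have "\<dots> \<le> \<bar>s\<bar> * (sqrt (real n) * (\<bar>\<alpha>\<bar> * sqrt (K * (\<integral>u. (remainder N u)\<^sup>2 \<partial>uniform01))) + \<bar>\<alpha>\<bar> * (2 * P))"
      by (intro mult_left_mono corr) simp
    also have "\<dots> = \<delta> N + \<bar>s\<bar> * (\<bar>\<alpha>\<bar> * (2 * P))"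
      using n unfolding s_def \<delta>_def by (simp add: distrib_left abs_divide)
    finally show ?thesis unfolding arg s_def .
  qed
  show "\<exists>b \<beta>. (\<forall>\<^sub>F n in sequentially. norm ((\<integral>x. iexp (t * (sqrt (real n) * (lambda_hat \<phi> k U n x - \<alpha>))) \<partial>M)
      - exp (- (t\<^sup>2 * asymptotic_variance lam \<phi> k / 2))) \<le> b n) \<and> b \<longlonglongrightarrow> \<beta> \<and> \<beta> < e"
  proof (intro exI conjI)
    show "\<forall>\<^sub>F n in sequentially. norm ((\<integral>x. iexp (t * (sqrt (real n) * (lambda_hat \<phi> k U n x - \<alpha>))) \<partial>M)
      - exp (- (t\<^sup>2 * asymptotic_variance lam \<phi> k / 2))) \<le> b' n"
      using eventually_ge_at_top[of 1]
    proof eventually_elim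
      case (elim n)
      from norm_diff_triangle_le[OF norm_diff_triangle_le[OF key[OF elim] order_refl] order_refl]
      show ?case unfolding b'_def E_def .
    qed
    have t0: "(\<lambda>n. t / sqrt (real n)) \<longlonglongrightarrow> 0"
      by (intro tendsto_divide_0[OF tendsto_const] filterlim_at_top_imp_at_infinity
          filterlim_compose[OF sqrt_at_top filterlim_real_sequentially])
    have "(\<lambda>n. \<integral>x. iexp (t / sqrt (real n) * ?S n x) \<partial>M) \<longlonglongrightarrow> E (V N)"
      using clt_d[of t N] unfolding E_def .
    then have "b' \<longlonglongrightarrow> \<delta> N + \<bar>0\<bar> * (\<bar>\<alpha>\<bar> * (2 * P)) + cmod (E (V N) - E (V N)) + cmod (E (V N) - E (asymptotic_variance lam \<phi> k))"
      unfolding b'_def by (intro tendsto_intros t0)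
    then show "b' \<longlonglongrightarrow> \<delta> N + cmod (E (V N) - E (asymptotic_variance lam \<phi> k))" by simp
  qed (rule N)
qed

lemma weak_conv_lambda_hat:
  "weak_conv_m (\<lambda>n. distr M borel (\<lambda>x. sqrt (real n) * (lambda_hat \<phi> k U n x - \<alpha>)))
    (centered_normal (asymptotic_variance lam \<phi> k))"
proof (rule levy_continuity)
  note [measurable] = lambda_hat_measurable[OF k]
  show "real_distribution (distr M borel (\<lambda>x. sqrt (real n) * (lambda_hat \<phi> k U n x - \<alpha>)))" for n
    by (rule real_distribution_distr) measurable
  show "real_distribution (centered_normal (asymptotic_variance lam \<phi> k))"
    by (rule real_distribution_centered_normal[OF asymptotic_variance_nonneg])
  fix t
  have "char (distr M borel (\<lambda>x. sqrt (real n) * (lambda_hat \<phi> k U n x - \<alpha>))) t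
      = (\<integral>x. iexp (t * (sqrt (real n) * (lambda_hat \<phi> k U n x - \<alpha>))) \<partial>M)" for n
    unfolding char_def by (subst integral_distr) measurable
  then show "(\<lambda>n. char (distr M borel (\<lambda>x. sqrt (real n) * (lambda_hat \<phi> k U n x - \<alpha>))) t)
      \<longlonglongrightarrow> char (centered_normal (asymptotic_variance lam \<phi> k)) t"
    using clt_lambda_hat[of t] unfolding char_centered_normal[OF asymptotic_variance_nonneg] by simp
qed

end

theorem theorem3p1:
  fixes M :: "'a measure"
    and U :: "nat \<Rightarrow> 'a \<Rightarrow> real"
    and C :: "real \<Rightarrow> real \<Rightarrow> real"
    and \<phi> :: "nat \<Rightarrow> real \<Rightarrow> real"
    and lam :: "nat \<Rightarrow> real"
    and k :: nat
  assumes "prob_space M"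
    and "onb_with_one \<phi>"
    and "finite ((\<lambda>z. \<bar>lam z\<bar>) ` {1..}) \<or> (\<lambda>z. \<bar>lam z\<bar>) \<longlonglongrightarrow> 0"
    and "series_converges lam \<phi>"
    and "copula_density C (series_density lam \<phi>)"
    and "copula_markov_chain M C U"
    and "k \<ge> 1"
    and "summable (\<lambda>z. \<bar>lam (Suc z)\<bar> * (basis_coef \<phi> k (Suc z))\<^sup>2)"
    and "set_integrable lborel {0<..<1} (\<lambda>x. (\<phi> k x) ^ 4)"
  shows "(\<forall>n\<ge>1. unbiased M (lambda_hat \<phi> k U n) (lam k))
    \<and> ((\<forall>z\<ge>1. lam z \<noteq> 1) \<longrightarrow>
         consistent M (lambda_hat \<phi> k U) (lam k)
       \<and> asymptotic_variance_converges lam \<phi> k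
       \<and> 0 \<le> asymptotic_variance lam \<phi> k
       \<and> weak_conv_m
           (\<lambda>n. distr M borel (\<lambda>\<omega>. sqrt (real n) * (lambda_hat \<phi> k U n \<omega> - lam k)))
           (centered_normal (asymptotic_variance lam \<phi> k)))
    \<and> ((AE p in lborel. p \<in> {0<..<1} \<times> {0<..<1} \<longrightarrow> 0 < series_density lam \<phi> (fst p) (snd p)) \<longrightarrow>
         (\<forall>z\<ge>1. lam z \<noteq> 1) \<and> 0 < asymptotic_variance lam \<phi> k)"
proof -
  interpret chain: basis_copula_chain \<phi> M lam C U
    using assms(1,2,4,5,6)
    by (simp add: basis_copula_chain_def basis_copula_chain_axioms_def orthonormal_basis_def)
  have [measurable]: "\<phi> k \<in> borel_measurable borel"
    by (rule chain.basis_measurable[OF assms(7)])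
  have fourth: "integrable uniform01 (\<lambda>x. (\<phi> k x) ^ 4)"
    using assms(9) by (subst (asm) integrable_uniform01) auto
  have estimator: "estimator_chain \<phi> M lam C U k" if "\<forall>z\<ge>1. lam z \<noteq> 1"
    using that assms(3,7) fourth
    by unfold_locales auto
  show ?thesis
  proof (intro conjI impI)
    show "\<forall>n\<ge>1. unbiased M (lambda_hat \<phi> k U n) (lam k)"
      using chain.lambda_hat_unbiased[OF assms(7)] by blast
  next
    assume "\<forall>z\<ge>1. lam z \<noteq> 1"
    then interpret estimator_chain \<phi> M lam C U k by (rule estimator)
    show "consistent M (lambda_hat \<phi> k U) (lam k)" by (rule consistent_lambda_hat)
    show "asymptotic_variance_converges lam \<phi> k" by (rule asymptotic_variance_converges)
    show "0 \<le> asymptotic_variance lam \<phi> k" by (rule asymptotic_variance_nonneg)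
    show "weak_conv_m (\<lambda>n. distr M borel (\<lambda>\<omega>. sqrt (real n) * (lambda_hat \<phi> k U n \<omega> - lam k)))
        (centered_normal (asymptotic_variance lam \<phi> k))"
      by (rule weak_conv_lambda_hat)
  next
    assume pos: "AE p in lborel. p \<in> {0<..<1} \<times> {0<..<1} \<longrightarrow> 0 < series_density lam \<phi> (fst p) (snd p)"
    show ne: "\<forall>z\<ge>1. lam z \<noteq> 1" using chain.lam_ne_1_if_positive[OF pos] by blast
    then interpret estimator_chain \<phi> M lam C U k by (rule estimator)
    show "0 < asymptotic_variance lam \<phi> k" by (rule asymptotic_variance_pos[OF pos])
  qed
qed

end
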